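(* Let $-\infty<a<b<\infty$, $I=(a,b)$, $\alpha\in(-1,0]$, $\beta,\gamma\in[-1/2,1/2]$, $\omega(x)=(x-a)^{\beta}(b-x)^{\gamma}$, and assume $2\alpha+\gamma+1>0$. Let $f$ be a real-valued function belonging to $L_{r}(I,\omega)$ for some $r$ satisfying the Pollard condition, and let $f_n=\int_a^b f(x)p_n(x)\omega(x)\,dx$, $n\in\mathbb{N}_0$, be its Jacobi coefficients. Assume that the series $$\sum_{n=0}^{\infty} f_n c_n,\qquad c_n=\frac{\delta'_n\, n!\,\Gamma(n+\beta+1)\Gamma(n+\gamma+1)}{4^{n}},$$ converges absolutely. Put $\lambda=2\alpha+\gamma+3/2$ (so $\lambda>1/2$) and $s=3/2+\max\{\beta,\gamma\}$. Then there is an index $p$ satisfying the Pollard condition such that the Abel equation $I_{b-}^{-\alpha}\varphi=f$ has a unique solution $\psi$ in $L_p(I,\omega)$. Moreover $\psi\in L_q(I,\omega)$ and $$\psi(x)=\sum_{m=0}^{\infty}p_m(x)(-1)^m\sum_{n=0}^{\infty}f_nA_{mn}^{\alpha,\gamma,\beta},$$ where the series over $m$ converges in $L_q(I,\omega)$, for the following $q$: if $1/2<\lambda<s$, then $q=\max\{p,t\}$ with any $t<(2s-1)/(s-\lambda)$; if $\lambda\ge s$, then $q$ may be taken arbitrarily large (finite).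
   Context: $\mathbb{N}_0=\{0,1,2,\dots\}$. $L_p(I,\omega)$ is the space of measurable functions with $\|f\|_{L_p(I,\omega)}=\left(\int_a^b|f(x)|^p\omega(x)\,dx\right)^{1/p}<\infty$. An index $p$ satisfies the Pollard condition if $$4\max\left\{\frac{\beta+1}{2\beta+3},\frac{\gamma+1}{2\gamma+3}\right\}<p<4\min\left\{\frac{\beta+1}{2\beta+1},\frac{\gamma+1}{2\gamma+1}\right\},$$ where a fraction with zero denominator is understood as $+\infty$, and $p<\infty$. Fractional operators: for $\mu>0$, $(I_{b-}^{\mu}\varphi)(x)=\frac{1}{\Gamma(\mu)}\int_x^b\varphi(t)(t-x)^{\mu-1}dt$; $I_{b-}^{0}$ is the identity; for $0<\mu<1$, $(D_{b-}^{\mu}f)(x)=-\frac{1}{\Gamma(1-\mu)}\frac{d}{dx}\int_x^b f(t)(t-x)^{-\mu}dt$, and one writes $I_{b-}^{-\mu}:=D_{b-}^{\mu}$. Since $\alpha\in(-1,0]$, the equation $I_{b-}^{-\alpha}\varphi=f$ involves the fractional integral of order $-\alpha\ge0$, and $I_{b-}^{\alpha}=D_{b-}^{-\alpha}$. Jacobi polynomials: $p_n(x)=p_n^{(\beta,\gamma)}(x)=\delta_n\,(x-a)^{-\beta}(b-x)^{-\gamma}\frac{d^n}{dx^n}\left[(x-a)^{\beta+n}(b-x)^{\gamma+n}\right]$, where $\delta_n=(-1)^n(b-a)^{-n-(\beta+\gamma+1)/2}\,\delta'_n$ and $$\delta'_n=\sqrt{\frac{(\beta+\gamma+2n+1)\Gamma(\beta+\gamma+n+1)}{n!\,\Gamma(\beta+n+1)\Gamma(\gamma+n+1)}},$$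 with $\delta'_0=1/\sqrt{\Gamma(\beta+1)\Gamma(\gamma+1)}$ when $\beta+\gamma+1=0$. These polynomials are orthonormal in $L_2(I,\omega)$. The numbers $A_{mn}^{\alpha,\gamma,\beta}$ ($m,n\in\mathbb{N}_0$) are given by $$\int_a^b p_m(x)\,(I_{b-}^{\alpha}p_n)(x)\,\omega(x)\,dx=(-1)^mA_{mn}^{\alpha,\gamma,\beta}.$$ *)

theory Defs
  imports "HOL-Analysis.Analysis"
begin

section \<open>Weighted Lebesgue spaces on a bounded interval\<close>

definition jacobi_weight :: "real \<Rightarrow> real \<Rightarrow> real \<Rightarrow> real \<Rightarrow> real \<Rightarrow> real" where
  "jacobi_weight a b \<beta> \<gamma> x = (x - a) powr \<beta> * (b - x) powr \<gamma>"

text \<open>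
  Elements of the spaces below are functions rather than equivalence classes, so equality of
  elements has to be stated almost everywhere. Only the values on the open interval matter.
\<close>

definition Lp_space :: "real \<Rightarrow> real \<Rightarrow> (real \<Rightarrow> real) \<Rightarrow> real \<Rightarrow> (real \<Rightarrow> real) set" where
  "Lp_space a b w p =
     {f. set_borel_measurable lebesgue {a<..<b} f \<and>
         set_integrable lebesgue {a<..<b} (\<lambda>x. \<bar>f x\<bar> powr p * w x)}"

definition Lp_norm :: "real \<Rightarrow> real \<Rightarrow> (real \<Rightarrow> real) \<Rightarrow> real \<Rightarrow> (real \<Rightarrow> real) \<Rightarrow> real" where
  "Lp_norm a b w p f = (LINT x:{a<..<b}|lebesgue. \<bar>f x\<bar> powr p * w x) powr (1 / p)"

text \<open>
  \<open>Lp_norm\<close> is the norm only on \<open>Lp_space\<close> (elsewhere the integral has a default value), hence the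
  membership conditions in the definition of convergence.
\<close>

definition Lp_converges ::
  "real \<Rightarrow> real \<Rightarrow> (real \<Rightarrow> real) \<Rightarrow> real \<Rightarrow> (nat \<Rightarrow> real \<Rightarrow> real) \<Rightarrow> (real \<Rightarrow> real) \<Rightarrow> bool" where
  "Lp_converges a b w p F g \<longleftrightarrow>
     g \<in> Lp_space a b w p \<and> (\<forall>N. F N \<in> Lp_space a b w p) \<and>
     (\<lambda>N. Lp_norm a b w p (\<lambda>x. F N x - g x)) \<longlonglongrightarrow> 0"

text \<open>A fraction with zero denominator in the upper bound is read as \<open>\<infinity>\<close>.\<close>

definition pollard_upper :: "real \<Rightarrow> ereal" where
  "pollard_upper \<beta> = (if 2 * \<beta> + 1 = 0 then \<infinity> else ereal ((\<beta> + 1) / (2 * \<beta> + 1)))"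

definition pollard :: "real \<Rightarrow> real \<Rightarrow> real \<Rightarrow> bool" where
  "pollard \<beta> \<gamma> p \<longleftrightarrow>
     4 * max ((\<beta> + 1) / (2 * \<beta> + 3)) ((\<gamma> + 1) / (2 * \<gamma> + 3)) < p \<and>
     ereal p < 4 * min (pollard_upper \<beta>) (pollard_upper \<gamma>)"

section \<open>Right-sided Riemann--Liouville operators\<close>

definition frac_integral :: "real \<Rightarrow> real \<Rightarrow> (real \<Rightarrow> real) \<Rightarrow> real \<Rightarrow> real" where
  "frac_integral b \<mu> \<phi> x =
     (if \<mu> = 0 then \<phi> x
      else 1 / Gamma \<mu> * (LINT t:{x<..<b}|lebesgue. \<phi> t * (t - x) powr (\<mu> - 1)))"

definition frac_derivative :: "real \<Rightarrow> real \<Rightarrow> (real \<Rightarrow> real) \<Rightarrow> real \<Rightarrow> real" where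
  "frac_derivative b \<mu> f x =
     - (1 / Gamma (1 - \<mu>)) * deriv (\<lambda>y. LINT t:{y<..<b}|lebesgue. f t * (t - y) powr (- \<mu>)) x"

text \<open>The operator of signed order \<open>\<mu> > -1\<close>: negative orders are derivatives of order \<open>-\<mu>\<close>.\<close>

definition frac_op :: "real \<Rightarrow> real \<Rightarrow> (real \<Rightarrow> real) \<Rightarrow> real \<Rightarrow> real" where
  "frac_op b \<mu> = (if \<mu> \<ge> 0 then frac_integral b \<mu> else frac_derivative b (- \<mu>))"

section \<open>Orthonormal Jacobi polynomials\<close>

definition jacobi_delta' :: "real \<Rightarrow> real \<Rightarrow> nat \<Rightarrow> real" where
  "jacobi_delta' \<beta> \<gamma> n =
     (if n = 0 \<and> \<beta> + \<gamma> + 1 = 0 then 1 / sqrt (Gamma (\<beta> + 1) * Gamma (\<gamma> + 1))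
      else sqrt ((\<beta> + \<gamma> + 2 * real n + 1) * Gamma (\<beta> + \<gamma> + real n + 1) /
                 (fact n * Gamma (\<beta> + real n + 1) * Gamma (\<gamma> + real n + 1))))"

definition jacobi_delta :: "real \<Rightarrow> real \<Rightarrow> real \<Rightarrow> real \<Rightarrow> nat \<Rightarrow> real" where
  "jacobi_delta a b \<beta> \<gamma> n =
     (-1) ^ n * (b - a) powr (- real n - (\<beta> + \<gamma> + 1) / 2) * jacobi_delta' \<beta> \<gamma> n"

text \<open>
  Rodrigues' formula; its values agree with those of the polynomial only for \<open>x\<close> in the open
  interval from \<open>a\<close> to \<open>b\<close>.
\<close>

definition jacobi_p :: "real \<Rightarrow> real \<Rightarrow> real \<Rightarrow> real \<Rightarrow> nat \<Rightarrow> real \<Rightarrow> real" where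
  "jacobi_p a b \<beta> \<gamma> n x =
     jacobi_delta a b \<beta> \<gamma> n * (x - a) powr (- \<beta>) * (b - x) powr (- \<gamma>) *
     (deriv ^^ n) (\<lambda>y. (y - a) powr (\<beta> + real n) * (b - y) powr (\<gamma> + real n)) x"

definition jacobi_coeff :: "real \<Rightarrow> real \<Rightarrow> real \<Rightarrow> real \<Rightarrow> (real \<Rightarrow> real) \<Rightarrow> nat \<Rightarrow> real" where
  "jacobi_coeff a b \<beta> \<gamma> f n =
     (LINT x:{a<..<b}|lebesgue. f x * jacobi_p a b \<beta> \<gamma> n x * jacobi_weight a b \<beta> \<gamma> x)"

text \<open>
  The factor \<open>(-1) ^ m\<close> is its own inverse: the matrix element of the operator of order \<open>\<alpha>\<close>
  is \<open>(-1) ^ m * abel_A a b \<alpha> \<beta> \<gamma> m n\<close>.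
\<close>

definition abel_A :: "real \<Rightarrow> real \<Rightarrow> real \<Rightarrow> real \<Rightarrow> real \<Rightarrow> nat \<Rightarrow> nat \<Rightarrow> real" where
  "abel_A a b \<alpha> \<beta> \<gamma> m n =
     (-1) ^ m * (LINT x:{a<..<b}|lebesgue.
       jacobi_p a b \<beta> \<gamma> m x * frac_op b \<alpha> (jacobi_p a b \<beta> \<gamma> n) x * jacobi_weight a b \<beta> \<gamma> x)"

definition abel_solution :: "real \<Rightarrow> real \<Rightarrow> real \<Rightarrow> (real \<Rightarrow> real) \<Rightarrow> (real \<Rightarrow> real) \<Rightarrow> bool" where
  "abel_solution a b \<alpha> f \<phi> \<longleftrightarrow> (AE x\<in>{a<..<b} in lebesgue. frac_op b (- \<alpha>) \<phi> x = f x)"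

end

theory Submission
  imports Defs
begin

text \<open>
  The factor \<open>n! \<Gamma>(n + \<beta> + 1) \<Gamma>(n + \<gamma> + 1)\<close> in \<open>c\<^sub>n\<close> forces the coefficients \<open>f\<^sub>n\<close> to decay so fast
  that \<open>\<Sum> f\<^sub>n p\<^sub>n\<close> still converges after the coefficients of each \<open>p\<^sub>n\<close> in powers of \<open>b - x\<close> are
  replaced by their absolute values and \<open>b - x\<close> by any \<open>R\<close>. By completeness \<open>f\<close> equals this series,
  and \<open>\<psi> = \<Sum> f\<^sub>n q\<^sub>n\<close> with \<open>q\<^sub>n = I\<^sup>\<alpha> p\<^sub>n\<close>, which is \<open>(b - x)\<^sup>\<alpha>\<close> times a polynomial, solves the Abel
  equation; one takes \<open>p = 2\<close>. Uniqueness is Fubini: the moments of \<open>I\<^sup>\<mu> \<phi>\<close> are multiples of those of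
  \<open>\<phi>(t) (t - a)\<^sup>\<mu>\<close>.

  The Jacobi coefficients of \<open>(b - x)\<^bsup>k + \<alpha>\<^esup>\<close> are explicit and \<open>O(m\<^bsup>-\<lambda>\<^esup>)\<close>, and Sonin's monotone function
  gives \<open>p\<^sub>m = O(m\<^bsup>s - 1\<^esup>)\<close> uniformly. For a dyadic block \<open>B\<close> of the Jacobi series of \<open>\<psi>\<close> the inequality
  \<open>\<parallel>B\<parallel>\<^sub>q\<^sup>q \<le> \<parallel>B\<parallel>\<^sub>\<infinity>\<^bsup>q - 2\<^esup> \<parallel>B\<parallel>\<^sub>2\<^sup>2\<close> then gives geometric decay precisely when \<open>q (s - \<lambda>) < 2s - 1\<close>, which
  replaces the Paley--Marcinkiewicz--Zygmund theorem.
\<close>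

section \<open>Moments and Beta integrals\<close>

text \<open>The decay of the coefficients is spent on a change of basis. Fractional operators based
  at b act term by term on powers of b - x, but in these powers p_n has exponentially large
  coefficients, and working term by term gives up all cancellation. For each R the resulting
  majorant of p_n is at most a constant times c_n z^n / n! for some z, so a loss of the form C^k on
  the k-th power only enlarges R and costs nothing. The pointwise series for \<psi> has the common
  majorant (b - x)^\<alpha>. This yields integrability and the Jacobi coefficients, but no statement
  on the partial sums of the Jacobi series. These are controlled through their coefficients alone,
  and their limit is identified with \<psi> because integrable functions with equal Jacobi
  coefficients agree almost everywhere. At q = 2 the convergence condition reads \<lambda> > 1/2,
  that is 2\<alpha> + \<gamma> + 1 > 0, and 2 satisfies the Pollard condition for all \<beta>,
  \<gamma> \<ge> -1/2. So one exponent serves for every choice of the parameters, and uniqueness is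
  proved in L_2.\<close>

lemma integrable_mult_bounded:
  fixes f g :: "'a \<Rightarrow> real"
  assumes "integrable M f" "g \<in> borel_measurable M" "\<And>x. x \<in> space M \<Longrightarrow> \<bar>g x\<bar> \<le> C"
  shows "integrable M (\<lambda>x. f x * g x)"
proof (rule Bochner_Integration.integrable_bound)
  show "integrable M (\<lambda>x. C * f x)" using assms(1) by simp
  show "AE x in M. norm (f x * g x) \<le> norm (C * f x)"
  proof (rule AE_I2)
    fix x assume "x \<in> space M"
    then have "\<bar>g x\<bar> \<le> \<bar>C\<bar>" using assms(3)[of x] by linarith
    then show "norm (f x * g x) \<le> norm (C * f x)"
      by (simp add: abs_mult) (metis abs_ge_zero mult.commute mult_right_mono)
  qed
qed (use assms in measurable)

text \<open>Weierstrass approximation turns vanishing moments into vanishing integrals against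
  continuous functions; ramps then reach the indicators of half-lines, and these determine the
  finite measures with densities h+ and h-. The centre c is left free because moments about both
  endpoints occur later.\<close>

lemma AE_zero_if_moments_zero_lborel:
  fixes h :: "real \<Rightarrow> real"
  assumes int: "integrable lborel h" and out: "\<And>x. x \<notin> {a..b} \<Longrightarrow> h x = 0"
    and mom: "\<And>k. (LINT x|lborel. h x * (x - c) ^ k) = 0"
  shows "AE x in lborel. h x = 0"
proof -
  note [measurable] = borel_measurable_integrable[OF int]
  have int_bdd: "integrable lborel (\<lambda>x. h x * u x)"
    if u: "continuous_on UNIV u" for u :: "real \<Rightarrow> real"
  proof -
    have "bounded (u ` {a..b})"
      using u continuous_on_subset compact_continuous_image compact_imp_bounded by blast
    then obtain B where "\<forall>x\<in>{a..b}. \<bar>u x\<bar> \<le> B"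
      by (auto simp: bounded_iff)
    moreover have [measurable]: "u \<in> borel_measurable borel"
      using u by (rule borel_measurable_continuous_onI)
    ultimately have "integrable lborel (\<lambda>x. h x * (indicator {a..b} x * u x))"
      by (intro integrable_mult_bounded[OF int, where C = "\<bar>B\<bar>"])
         (auto simp: indicator_def split: if_splits intro: order_trans[OF _ abs_ge_self])
    moreover have "(\<lambda>x. h x * (indicator {a..b} x * u x)) = (\<lambda>x. h x * u x)"
      using out by (auto simp: indicator_def fun_eq_iff)
    ultimately show ?thesis by simp
  qed
  have poly0: "(LINT x|lborel. h x * g x) = 0" if "real_polynomial_function g" for g
  proof -
    have "real_polynomial_function (\<lambda>x. g (x + c))"
    proof -
      have "real_polynomial_function (g \<circ> (\<lambda>x. x + c))"
        by (rule real_polynomial_function_compose[OF _ that]) (intro polynomial_function_add, auto)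
      then show ?thesis by (simp add: o_def)
    qed
    then obtain A n where An: "(\<lambda>x. g (x + c)) = (\<lambda>x. \<Sum>i\<le>n. A i * x ^ i)"
      unfolding real_polynomial_function_iff_sum by blast
    have "g = (\<lambda>x. \<Sum>i\<le>n. A i * (x - c) ^ i)"
      using fun_cong[OF An, of "x - c" for x] by auto
    then have "(\<lambda>x. h x * g x) = (\<lambda>x. \<Sum>i\<le>n. A i * (h x * (x - c) ^ i))"
      by (auto simp: sum_distrib_left mult_ac)
    moreover have "(LINT x|lborel. (\<Sum>i\<le>n. A i * (h x * (x - c) ^ i))) = 0"
      by (subst Bochner_Integration.integral_sum)
         (auto intro!: integrable_mult_right int_bdd continuous_intros simp: mom)
    ultimately show ?thesis by simp
  qed
  have cont0: "(LINT x|lborel. h x * u x) = 0" if u: "continuous_on UNIV u" for u :: "real \<Rightarrow> real"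
  proof -
    have le: "\<bar>\<integral>x. h x * u x \<partial>lborel\<bar> \<le> e * (LINT x|lborel. \<bar>h x\<bar>)" if "e > 0" for e
    proof -
      obtain g where g: "real_polynomial_function g" "\<And>x. x \<in> {a..b} \<Longrightarrow> \<bar>u x - g x\<bar> < e"
        using Stone_Weierstrass_real_polynomial_function[of "{a..b}" u e] u \<open>e > 0\<close>
          continuous_on_subset by blast
      have cg: "continuous_on UNIV g"
        using g(1) continuous_on_polymonial_function real_polynomial_function_eq by blast
      have "(LINT x|lborel. h x * u x) = (LINT x|lborel. h x * u x - h x * g x)"
        by (subst Bochner_Integration.integral_diff) (auto intro: int_bdd u cg simp: poly0 g(1))
      also have "\<bar>\<dots>\<bar> \<le> (LINT x|lborel. \<bar>h x * u x - h x * g x\<bar>)"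
        by (rule integral_abs_bound)
      also have "\<dots> \<le> (LINT x|lborel. e * \<bar>h x\<bar>)"
      proof (rule integral_mono)
        fix x
        show "\<bar>h x * u x - h x * g x\<bar> \<le> e * \<bar>h x\<bar>"
        proof (cases "x \<in> {a..b}")
          case True
          have "\<bar>h x * u x - h x * g x\<bar> = \<bar>u x - g x\<bar> * \<bar>h x\<bar>"
            by (simp add: abs_mult[symmetric] algebra_simps)
          also have "\<dots> \<le> e * \<bar>h x\<bar>"
            using g(2)[OF True] by (intro mult_right_mono) auto
          finally show ?thesis .
        qed (use out in auto)
      qed (auto intro!: int_bdd u cg int Bochner_Integration.integrable_diff integrable_abs)
      finally show ?thesis by simp
    qed
    have "\<bar>\<integral>x. h x * u x \<partial>lborel\<bar> \<le> 0"
    proof (rule field_le_epsilon)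
      fix e :: real assume "e > 0"
      let ?I = "\<integral>x. \<bar>h x\<bar> \<partial>lborel"
      have I: "?I \<ge> 0" by simp
      \<comment> \<open>The accuracy e / (I + 1) instead of e / I also covers I = 0.\<close>
      have "?I / (?I + 1) \<le> 1" by (subst divide_le_eq_1_pos) (use I in linarith)+
      then have "e * (?I / (?I + 1)) \<le> e" using \<open>e > 0\<close> by (intro mult_left_le) auto
      then have "e / (?I + 1) * ?I \<le> e" by simp
      then show "\<bar>\<integral>x. h x * u x \<partial>lborel\<bar> \<le> 0 + e"
        using le[OF divide_pos_pos[OF \<open>e > 0\<close>, of "?I + 1"]] I by linarith
    qed
    then show ?thesis by simp
  qed
  have half0: "(LINT x|lborel. h x * indicator {y<..} x) = 0" for y
  proof (rule LIMSEQ_unique)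
    \<comment> \<open>A ramp of slope n, rising from 0 at y to 1 at y + 1/n; its limit is the
      indicator of the open half-line at every point, y included.\<close>
    define u where "u n x = min 1 (max 0 (real n * (x - y)))" for n x
    have [measurable]: "u n \<in> borel_measurable borel" for n unfolding u_def by measurable
    show "(\<lambda>n. \<integral>x. h x * u n x \<partial>lborel) \<longlonglongrightarrow> (LINT x|lborel. h x * indicator {y<..} x)"
    proof (rule integral_dominated_convergence[where w = "\<lambda>x. \<bar>h x\<bar>"])
      show "AE x in lborel. (\<lambda>n. h x * u n x) \<longlonglongrightarrow> h x * indicator {y<..} x"
      proof (rule AE_I2)
        fix x
        have "(\<lambda>n. u n x) \<longlonglongrightarrow> indicator {y<..} x"
        proof (cases "x > y")
          case True
          obtain N where N: "1 / (x - y) < real N" using reals_Archimedean2 by blast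
          have "\<forall>\<^sub>F n in sequentially. u n x = 1"
            using eventually_ge_at_top[of N]
          proof eventually_elim
            case (elim n)
            then have "1 / (x - y) \<le> real n" using N by linarith
            then have "1 \<le> real n * (x - y)" using True by (simp add: field_simps)
            then show ?case by (simp add: u_def)
          qed
          then show ?thesis using True by (simp add: tendsto_eventually)
        next
          case False
          then have "real n * (x - y) \<le> 0" for n by (simp add: mult_le_0_iff)
          then have "u n x = 0" for n by (simp add: u_def max_absorb1)
          then show ?thesis using False by simp
        qed
        then show "(\<lambda>n. h x * u n x) \<longlonglongrightarrow> h x * indicator {y<..} x"
          by (intro tendsto_intros)
      qed
      show "AE x in lborel. norm (h x * u n x) \<le> \<bar>h x\<bar>" for n
        by (rule AE_I2) (auto simp: u_def abs_mult mult_left_le)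
    qed (use int in \<open>auto intro: integrable_abs\<close>)
    have "continuous_on UNIV (u n)" for n unfolding u_def by (intro continuous_intros)
    then show "(\<lambda>n. \<integral>x. h x * u n x \<partial>lborel) \<longlonglongrightarrow> 0" by (simp add: cont0)
  qed
  define hp hm where "hp x = max 0 (h x)" and "hm x = max 0 (- h x)" for x
  have hpm [measurable]: "hp \<in> borel_measurable borel" "hm \<in> borel_measurable borel"
    by (simp_all add: hp_def[abs_def] hm_def[abs_def])
  have ip: "integrable lborel (\<lambda>x. hp x * indicator A x)" "integrable lborel (\<lambda>x. hm x * indicator A x)"
    if "A \<in> sets borel" for A
    by (rule Bochner_Integration.integrable_bound[OF int], use that in \<open>auto simp: hp_def hm_def indicator_def\<close>)+
  have em: "emeasure (density lborel hp) A = ennreal (LINT x|lborel. hp x * indicator A x)"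
           "emeasure (density lborel hm) A = ennreal (LINT x|lborel. hm x * indicator A x)"
    if [measurable]: "A \<in> sets borel" for A
  proof -
    have "emeasure (density lborel u) A = ennreal (LINT x|lborel. u x * indicator A x)"
      if [measurable]: "u \<in> borel_measurable borel" and "\<And>x. u x \<ge> 0"
        and "integrable lborel (\<lambda>x. u x * indicator A x)" for u :: "real \<Rightarrow> real"
    proof -
      have "emeasure (density lborel u) A = (\<integral>\<^sup>+x. ennreal (u x * indicator A x) \<partial>lborel)"
        by (subst emeasure_density) (auto intro!: nn_integral_cong simp: indicator_def)
      also have "\<dots> = ennreal (LINT x|lborel. u x * indicator A x)"
        using that by (intro nn_integral_eq_integral) auto
      finally show ?thesis .
    qed
    from this[OF hpm(1) _ ip(1)[OF that]] this[OF hpm(2) _ ip(2)[OF that]]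
    show "emeasure (density lborel hp) A = ennreal (LINT x|lborel. hp x * indicator A x)"
      "emeasure (density lborel hm) A = ennreal (LINT x|lborel. hm x * indicator A x)"
      by (simp_all add: hp_def hm_def)
  qed
  \<comment> \<open>Finite measures on the line that agree on open right half-lines coincide, and
    equal densities give h+ = h- almost everywhere.\<close>
  have "density lborel hp = density lborel hm"
  proof (rule measure_eqI_lessThan)
    fix y
    have "(LINT x|lborel. hp x * indicator {y<..} x) - (LINT x|lborel. hm x * indicator {y<..} x)
        = (LINT x|lborel. hp x * indicator {y<..} x - hm x * indicator {y<..} x)"
      by (intro Bochner_Integration.integral_diff[symmetric] ip) auto
    also have "(\<lambda>x. hp x * indicator {y<..} x - hm x * indicator {y<..} x) = (\<lambda>x. h x * indicator {y<..} x)"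
      by (rule ext) (simp add: hp_def hm_def max_def split: split_indicator)
    finally show "emeasure (density lborel hp) {y<..} = emeasure (density lborel hm) {y<..}"
      by (simp add: em half0)
    show "emeasure (density lborel hp) {y<..} < \<infinity>" by (simp add: em)
  qed auto
  then have "AE x in lborel. ennreal (hp x) = ennreal (hm x)"
    by (intro sigma_finite_measure.density_unique[OF sigma_finite_lborel]) auto
  then show ?thesis
  proof eventually_elim
    case (elim x)
    then have "hp x = hm x" by (simp add: hp_def hm_def ennreal_inj)
    then show ?case by (auto simp: hp_def hm_def max_def split: if_splits)
  qed
qed

text \<open>The integrals of the development are over the completed measure, whereas Fubini and the
  uniqueness of measures are applied over \<open>lborel\<close>. Cutting the representative by the
  indicator makes it vanish off A everywhere, not just almost everywhere.\<close>

lemma lebesgue_borel_representative: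
  fixes g :: "real \<Rightarrow> real"
  assumes "set_integrable lebesgue A g" "A \<in> sets borel"
  obtains h where "integrable lborel h" "h \<in> borel_measurable borel" "\<And>x. x \<notin> A \<Longrightarrow> h x = 0"
    "AE x in lebesgue. indicator A x * g x = h x"
proof -
  have int: "integrable lebesgue (\<lambda>x. indicator A x * g x)"
    using assms(1) by (simp add: set_integrable_def)
  then obtain h0 where h0: "h0 \<in> borel_measurable lborel" "AE x in lborel. indicator A x * g x = h0 x"
    using completion_ex_borel_measurable_real[of "\<lambda>x. indicator A x * g x" lborel] by auto
  define h where "h x = indicator A x * h0 x" for x
  have [measurable]: "h \<in> borel_measurable borel" "A \<in> sets borel" using h0(1) assms(2) by (auto simp: h_def[abs_def])
  have ae: "AE x in lebesgue. indicator A x * g x = h x"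
    using AE_completion[OF h0(2)] by eventually_elim (auto simp: h_def indicator_def)
  have "integrable lebesgue h"
    using ae by (intro integrable_cong_AE_imp[OF int] measurable_completion) (auto simp: eq_commute)
  then have "integrable lborel h"
    by (simp add: integrable_completion)
  then show ?thesis using that[of h] ae by (auto simp: h_def)
qed

lemma AE_zero_if_moments_zero:
  fixes g :: "real \<Rightarrow> real"
  assumes int: "set_integrable lebesgue {a<..<b} g"
    and mom: "\<And>k. (LINT x:{a<..<b}|lebesgue. g x * (x - c) ^ k) = 0"
  shows "AE x\<in>{a<..<b} in lebesgue. g x = 0"
proof -
  obtain h where h: "integrable lborel h" "h \<in> borel_measurable borel"
    "\<And>x. x \<notin> {a<..<b} \<Longrightarrow> h x = 0" "AE x in lebesgue. indicator {a<..<b} x * g x = h x"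
    using lebesgue_borel_representative[OF int] by auto
  note [measurable] = h(2)
  have g: "(\<lambda>x. indicator {a<..<b} x * g x) \<in> borel_measurable lebesgue"
    using int by (auto simp: set_integrable_def)
  have "(LINT x|lborel. h x * (x - c) ^ k) = 0" for k
  proof -
    have "(LINT x|lborel. h x * (x - c) ^ k) = (LINT x|lebesgue. h x * (x - c) ^ k)"
      by (subst integral_completion) auto
    also have "\<dots> = (LINT x|lebesgue. (indicator {a<..<b} x * g x) * (x - c) ^ k)"
    proof (rule integral_cong_AE)
      show "(\<lambda>x. h x * (x - c) ^ k) \<in> borel_measurable lebesgue"
        by (rule measurable_completion) measurable
      have "(\<lambda>x. (x - c) ^ k) \<in> borel_measurable lebesgue"
        by (rule measurable_completion) measurable
      then show "(\<lambda>x. indicator {a<..<b} x * g x * (x - c) ^ k) \<in> borel_measurable lebesgue"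
        by (rule borel_measurable_times[OF g])
    qed (use h(4) in \<open>auto elim: eventually_mono\<close>)
    also have "\<dots> = 0" using mom[of k] by (simp add: set_lebesgue_integral_def mult_ac)
    finally show ?thesis .
  qed
  then have "AE x in lborel. h x = 0"
    by (intro AE_zero_if_moments_zero_lborel[OF h(1), of a b]) (use h(3) in auto)
  from AE_completion[OF this] h(4) show ?thesis
    by eventually_elim (auto simp: indicator_def split: if_splits)
qed

text \<open>An affine change of variable from the standard Beta integral; since the integrand is
  nonnegative, gauge integrability upgrades to absolute integrability.\<close>

lemma Beta_interval_integral:
  fixes u v p q :: real
  assumes "u < v" "p > 0" "q > 0"
  shows "set_integrable lebesgue {u<..<v} (\<lambda>t. (t - u) powr (p - 1) * (v - t) powr (q - 1))"
    and "(LINT t:{u<..<v}|lebesgue. (t - u) powr (p - 1) * (v - t) powr (q - 1))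
         = (v - u) powr (p + q - 1) * Beta p q"
proof -
  define F where "F t = t powr (p - 1) * (1 - t) powr (q - 1)" for t :: real
  have "(F has_integral Beta p q) (cbox 0 1)"
    using has_integral_Beta_real[OF assms(2,3)] by (simp add: F_def[abs_def])
  from has_integral_affinity[OF this, of "1 / (v - u)" "- u / (v - u)"]
  have "((\<lambda>x. F ((x - u) / (v - u))) has_integral \<bar>v - u\<bar> * Beta p q)
     ((\<lambda>x. (v - u) * x + u) ` {0..1})"
    using assms(1) by (simp add: diff_divide_distrib)
  moreover have "(\<lambda>x. (v - u) * x + u) ` {0..1} = {u..v}"
    using assms(1) image_affinity_atLeastAtMost[of "v - u" u 0 1] by simp
  ultimately have "((\<lambda>x. F ((x - u) / (v - u))) has_integral (v - u) * Beta p q) {u<..<v}"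
    using assms(1) by (simp add: has_integral_Icc_iff_Ioo)
  then have i1: "((\<lambda>x. (v - u) powr (p + q - 2) * F ((x - u) / (v - u))) has_integral
      (v - u) powr (p + q - 2) * ((v - u) * Beta p q)) {u<..<v}"
    by (rule has_integral_mult_right)
  have powr_eq: "(v - u) powr (p + q - 2) * ((v - u) * Beta p q) = (v - u) powr (p + q - 1) * Beta p q"
  proof -
    have "(v - u) powr (p + q - 1) = (v - u) powr (p + q - 2) * (v - u) powr 1"
      by (subst powr_add[symmetric]) simp
    then show ?thesis using assms(1) by simp
  qed
  have Feq: "(v - u) powr (p + q - 2) * F ((x - u) / (v - u))
     = (x - u) powr (p - 1) * (v - x) powr (q - 1)" if "x \<in> {u<..<v}" for x
  proof -
    have "1 - (x - u) / (v - u) = (v - x) / (v - u)" using assms(1) by (simp add: field_simps)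
    moreover have "(v - u) powr (p + q - 2) = (v - u) powr (p - 1) * (v - u) powr (q - 1)"
      by (subst powr_add[symmetric]) (simp add: algebra_simps)
    ultimately show ?thesis using that assms(1)
      by (simp add: F_def powr_divide)
  qed
  have "((\<lambda>x. (x - u) powr (p - 1) * (v - x) powr (q - 1)) has_integral
      (v - u) powr (p + q - 2) * ((v - u) * Beta p q)) {u<..<v}"
    using has_integral_eq[OF Feq i1] by simp
  then have *: "((\<lambda>t. (t - u) powr (p - 1) * (v - t) powr (q - 1)) has_integral
      (v - u) powr (p + q - 1) * Beta p q) {u<..<v}"
    using powr_eq by simp
  have abs: "(\<lambda>t. (t - u) powr (p - 1) * (v - t) powr (q - 1)) absolutely_integrable_on {u<..<v}"
    by (rule nonnegative_absolutely_integrable_1) (use * in auto)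
  then show "set_integrable lebesgue {u<..<v} (\<lambda>t. (t - u) powr (p - 1) * (v - t) powr (q - 1))" .
  show "(LINT t:{u<..<v}|lebesgue. (t - u) powr (p - 1) * (v - t) powr (q - 1))
         = (v - u) powr (p + q - 1) * Beta p q"
    using set_lebesgue_integral_eq_integral(2)[OF abs] * by (simp add: integral_unique)
qed

section \<open>Orthonormal series in \<open>L\<^sub>p\<close>\<close>

lemma abs_add_powr_le:
  fixes x y q :: real
  assumes "q \<ge> 0"
  shows "\<bar>x + y\<bar> powr q \<le> 2 powr q * (\<bar>x\<bar> powr q + \<bar>y\<bar> powr q)"
proof -
  have "\<bar>x + y\<bar> powr q \<le> (2 * max \<bar>x\<bar> \<bar>y\<bar>) powr q"
    using assms by (intro powr_mono2) auto
  also have "\<dots> = 2 powr q * (max \<bar>x\<bar> \<bar>y\<bar>) powr q"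
    by (subst powr_mult) auto
  also have "\<dots> \<le> 2 powr q * (\<bar>x\<bar> powr q + \<bar>y\<bar> powr q)"
    by (intro mult_left_mono) (auto simp: max_def)
  finally show ?thesis .
qed

text \<open>Split at the threshold e. With e = 1 this gives integrability of lower powers, with e
  small it transfers convergence from exponent q to exponent p; together they replace Hoelder's
  inequality.\<close>

lemma powr_le_interpolate:
  fixes y e p q :: real
  assumes "0 \<le> y" "0 < e" "0 < p" "p \<le> q"
  shows "y powr p \<le> e powr p + e powr (p - q) * y powr q"
proof (cases "y \<le> e")
  case True
  then have "y powr p \<le> e powr p" using assms by (intro powr_mono2) auto
  then show ?thesis by (simp add: add_increasing2)
next
  case False
  then have "y powr (p - q) \<le> e powr (p - q)" using assms by (intro powr_mono2') auto
  then have "y powr (p - q) * y powr q \<le> e powr (p - q) * y powr q"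
    by (intro mult_right_mono) auto
  moreover have "y powr (p - q) * y powr q = y powr p" by (simp add: powr_add[symmetric])
  ultimately show ?thesis by (simp add: add_increasing)
qed

lemma (in finite_measure) integrable_powr_mono:
  fixes h :: "'a \<Rightarrow> real"
  assumes "h \<in> borel_measurable M" "integrable M (\<lambda>x. \<bar>h x\<bar> powr q)" "0 < p" "p \<le> q"
  shows "integrable M (\<lambda>x. \<bar>h x\<bar> powr p)"
proof (rule Bochner_Integration.integrable_bound)
  show "integrable M (\<lambda>x. 1 + \<bar>h x\<bar> powr q)" using assms by simp
  show "AE x in M. norm (\<bar>h x\<bar> powr p) \<le> norm (1 + \<bar>h x\<bar> powr q)"
    using powr_le_interpolate[of _ 1 p q] assms by (intro AE_I2) auto
qed (use assms in measurable)

lemma (in finite_measure) tendsto_powr_mono: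
  fixes h :: "nat \<Rightarrow> 'a \<Rightarrow> real"
  assumes [measurable]: "\<And>N. h N \<in> borel_measurable M"
    and int: "\<And>N. integrable M (\<lambda>x. \<bar>h N x\<bar> powr q)"
    and pq: "0 < p" "p \<le> q"
    and lim: "(\<lambda>N. \<integral>x. \<bar>h N x\<bar> powr q \<partial>M) \<longlonglongrightarrow> 0"
  shows "(\<lambda>N. \<integral>x. \<bar>h N x\<bar> powr p \<partial>M) \<longlonglongrightarrow> 0"
proof (rule LIMSEQ_I)
  fix r :: real assume "r > 0"
  define m where "m = measure M (space M)"
  have m: "m \<ge> 0" by (simp add: m_def)
  \<comment> \<open>Chosen so that e^p times the total mass is at most r/2; m + 1 in place of m
    keeps it meaningful for the zero measure.\<close>
  define e where "e = (r / (2 * (m + 1))) powr (1 / p)"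
  have e: "e > 0" using \<open>r > 0\<close> m by (simp add: e_def)
  have ep: "e powr p = r / (2 * (m + 1))"
    using \<open>r > 0\<close> m pq by (simp add: e_def powr_powr)
  have "(\<lambda>N. e powr (p - q) * (LINT x|M. \<bar>h N x\<bar> powr q)) \<longlonglongrightarrow> e powr (p - q) * 0"
    by (intro tendsto_intros lim)
  then obtain N0 where N0: "\<And>N. N \<ge> N0 \<Longrightarrow> \<bar>e powr (p - q) * (LINT x|M. \<bar>h N x\<bar> powr q)\<bar> < r / 2"
    using LIMSEQ_D[of _ _ "r / 2"] \<open>r > 0\<close> by fastforce
  show "\<exists>no. \<forall>n\<ge>no. norm ((LINT x|M. \<bar>h n x\<bar> powr p) - 0) < r"
  proof (intro exI allI impI)
    fix N assume "N \<ge> N0"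
    have "(LINT x|M. \<bar>h N x\<bar> powr p) \<le> (LINT x|M. e powr p + e powr (p - q) * \<bar>h N x\<bar> powr q)"
      using pq e int
      by (intro integral_mono integrable_powr_mono[OF _ int]) (auto intro: powr_le_interpolate)
    also have "\<dots> = e powr p * m + e powr (p - q) * (LINT x|M. \<bar>h N x\<bar> powr q)"
      using int by (simp add: m_def mult.commute)
    also have "\<dots> < r"
    proof -
      have "e powr p * m \<le> r / 2"
        unfolding ep using \<open>r > 0\<close> m by (simp add: field_simps)
      then show ?thesis using N0[OF \<open>N \<ge> N0\<close>] by linarith
    qed
    finally show "norm ((LINT x|M. \<bar>h N x\<bar> powr p) - 0) < r" by simp
  qed
qed

text \<open>On the block, n + 1 lies between 2^k and 2^(k+1); the constant 2^|z| serves both signs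
  of z.\<close>

lemma powr_dyadic_le:
  fixes z :: real
  assumes "2 ^ k \<le> n" "n < 2 ^ Suc k"
  shows "(real n + 1) powr z \<le> 2 powr \<bar>z\<bar> * 2 powr (real k * z)"
proof -
  have l: "2 powr real k \<le> real n + 1"
    using assms(1) by (simp add: powr_realpow) (metis add_increasing2 of_nat_le_iff of_nat_numeral of_nat_power zero_le_one)
  have "real (n + 1) \<le> real (2 ^ Suc k)" using assms(2) unfolding of_nat_le_iff by simp
  then have u: "real n + 1 \<le> 2 powr (real k + 1)"
    by (simp add: powr_add powr_realpow)
  show ?thesis
  proof (cases "z \<ge> 0")
    case True
    then have "(real n + 1) powr z \<le> (2 powr (real k + 1)) powr z"
      using u by (intro powr_mono2) auto
    also have "\<dots> = 2 powr \<bar>z\<bar> * 2 powr (real k * z)"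
      using True by (simp add: powr_powr powr_add[symmetric] algebra_simps)
    finally show ?thesis .
  next
    case False
    then have "(real n + 1) powr z \<le> (2 powr real k) powr z"
      using l by (intro powr_mono2') auto
    also have "\<dots> = 1 * 2 powr (real k * z)" by (simp add: powr_powr)
    also have "\<dots> \<le> 2 powr \<bar>z\<bar> * 2 powr (real k * z)"
      by (intro mult_right_mono) (auto intro: ge_one_powr_ge_zero)
    finally show ?thesis .
  qed
qed

text \<open>The growth exponent e is s - 1 for the Jacobi system. Boundedness on a finite measure
  makes the integrals in \<open>\<phi>_orthonormal\<close> genuine ones and gives every integrable
  function its coefficients.\<close>

locale bounded_orthonormal = finite_measure M for M :: "'a measure" +
  fixes \<phi> :: "nat \<Rightarrow> 'a \<Rightarrow> real" and C e :: real
  assumes \<phi>_measurable [measurable]: "\<And>n. \<phi> n \<in> borel_measurable M"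
    and \<phi>_bound: "\<And>n x. x \<in> space M \<Longrightarrow> \<bar>\<phi> n x\<bar> \<le> C * (real n + 1) powr e"
    and \<phi>_orthonormal: "\<And>m n. (LINT x|M. \<phi> m x * \<phi> n x) = (if m = n then 1 else 0)"
    and C_nonneg: "C \<ge> 0"
begin

lemma integrable_times_\<phi>: "integrable M f \<Longrightarrow> integrable M (\<lambda>x. f x * \<phi> n x)"
  by (rule integrable_mult_bounded[where C = "C * (real n + 1) powr e"]) (auto intro: \<phi>_bound)

lemma integrable_\<phi>: "integrable M (\<phi> n)"
  using integrable_times_\<phi>[of "\<lambda>_. 1" n] by simp

lemma integral_sum_\<phi>_square:
  assumes "finite A"
  shows "(LINT x|M. (\<Sum>n\<in>A. c n * \<phi> n x)\<^sup>2) = (\<Sum>n\<in>A. (c n)\<^sup>2)"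
    and "integrable M (\<lambda>x. (\<Sum>n\<in>A. c n * \<phi> n x)\<^sup>2)"
proof -
  have eq: "(\<Sum>n\<in>A. c n * \<phi> n x)\<^sup>2 = (\<Sum>m\<in>A. \<Sum>n\<in>A. (c m * c n) * (\<phi> m x * \<phi> n x))" for x
    by (simp add: power2_eq_square sum_product mult_ac)
  have i: "integrable M (\<lambda>x. \<Sum>n\<in>A. (c m * c n) * (\<phi> m x * \<phi> n x))" for m
    by (intro Bochner_Integration.integrable_sum integrable_mult_right integrable_times_\<phi> integrable_\<phi>)
  show "integrable M (\<lambda>x. (\<Sum>n\<in>A. c n * \<phi> n x)\<^sup>2)"
    unfolding eq by (intro Bochner_Integration.integrable_sum i)
  have "(LINT x|M. (\<Sum>n\<in>A. c n * \<phi> n x)\<^sup>2)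
     = (\<Sum>m\<in>A. \<Sum>n\<in>A. (c m * c n) * (LINT x|M. \<phi> m x * \<phi> n x))"
    unfolding eq using i integrable_times_\<phi>[OF integrable_\<phi>]
    by (subst Bochner_Integration.integral_sum, simp, intro sum.cong refl,
        subst Bochner_Integration.integral_sum) auto
  also have "\<dots> = (\<Sum>m\<in>A. \<Sum>n\<in>A. if m = n then (c m)\<^sup>2 else 0)"
    by (intro sum.cong refl) (simp add: \<phi>_orthonormal power2_eq_square)
  also have "\<dots> = (\<Sum>n\<in>A. (c n)\<^sup>2)" using assms by (simp add: sum.delta)
  finally show "(LINT x|M. (\<Sum>n\<in>A. c n * \<phi> n x)\<^sup>2) = (\<Sum>n\<in>A. (c n)\<^sup>2)" .
qed

lemma integrable_sum_\<phi>_powr: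
  assumes "q \<ge> 0"
  shows "integrable M (\<lambda>x. \<bar>\<Sum>n\<in>A. c n * \<phi> n x\<bar> powr q)"
proof (rule integrable_const_bound)
  show "AE x in M. norm (\<bar>\<Sum>n\<in>A. c n * \<phi> n x\<bar> powr q) \<le> (\<Sum>n\<in>A. \<bar>c n\<bar> * (C * (real n + 1) powr e)) powr q"
  proof (rule AE_I2)
    fix x assume x: "x \<in> space M"
    have "\<bar>\<Sum>n\<in>A. c n * \<phi> n x\<bar> \<le> (\<Sum>n\<in>A. \<bar>c n * \<phi> n x\<bar>)" by (rule sum_abs)
    also have "\<dots> \<le> (\<Sum>n\<in>A. \<bar>c n\<bar> * (C * (real n + 1) powr e))"
      unfolding abs_mult by (intro sum_mono mult_left_mono \<phi>_bound x) auto
    finally show "norm (\<bar>\<Sum>n\<in>A. c n * \<phi> n x\<bar> powr q) \<le> (\<Sum>n\<in>A. \<bar>c n\<bar> * (C * (real n + 1) powr e)) powr q"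
      using assms by (auto intro: powr_mono2)
  qed
qed measurable

text \<open>A block has at most 2^k terms, so its sup norm is O(2^(k(e+1-l))) and, by Parseval, its
  squared L_2 norm is O(2^(k(1-2l))); the exponent is (q-2)(e+1-l) + (1-2l). The free upper end N
  admits incomplete blocks, so that all partial sums are reached and not only those of dyadic
  length.\<close>

lemma dyadic_block_bound:
  assumes c: "\<And>n. \<bar>c n\<bar> \<le> D * (real n + 1) powr (- l)" and q: "q \<ge> 2"
  obtains E where "E \<ge> 0"
    "\<And>k N. N \<le> 2 ^ Suc k \<Longrightarrow> (LINT x|M. \<bar>\<Sum>n\<in>{2^k..<N}. c n * \<phi> n x\<bar> powr q)
        \<le> E * (2 powr (q * (e + 1 - l) - (2 * e + 1))) ^ k"
proof -
  have D: "D \<ge> 0" using c[of 0] by auto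
  define G where "G = D * C * 2 powr \<bar>e - l\<bar>"
  define G2 where "G2 = D\<^sup>2 * 2 powr \<bar>- 2 * l\<bar>"
  have G: "G \<ge> 0" "G2 \<ge> 0" using D C_nonneg by (auto simp: G_def G2_def)
  show ?thesis
  proof
    show "G powr (q - 2) * G2 \<ge> 0" using G by simp
    fix k N :: nat assume N: "N \<le> 2 ^ Suc k"
    define T where "T x = (\<Sum>n\<in>{2^k..<N}. c n * \<phi> n x)" for x
    have card: "real (card {2^k..<N}) \<le> 2 powr real k"
    proof -
      have "card {2^k..<N} \<le> 2 ^ k" using N by simp
      then have "real (card {2^k..<N}) \<le> real (2 ^ k)" by (simp only: of_nat_le_iff)
      then show ?thesis by (simp add: powr_realpow)
    qed
    have T: "\<bar>T x\<bar> \<le> G * 2 powr (real k * (e + 1 - l))" if x: "x \<in> space M" for x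
    proof -
      have "\<bar>T x\<bar> \<le> (\<Sum>n\<in>{2^k..<N}. \<bar>c n * \<phi> n x\<bar>)" unfolding T_def by (rule sum_abs)
      also have "\<dots> \<le> (\<Sum>n\<in>{2^k..<N}. G * 2 powr (real k * (e - l)))"
      proof (rule sum_mono)
        fix n assume n: "n \<in> {2^k..<N}"
        have "\<bar>c n * \<phi> n x\<bar> \<le> (D * (real n + 1) powr (- l)) * (C * (real n + 1) powr e)"
          unfolding abs_mult using D by (intro mult_mono c \<phi>_bound x) auto
        also have "\<dots> = D * C * (real n + 1) powr (e - l)"
          by (simp add: mult_ac powr_add[symmetric])
        also have "\<dots> \<le> D * C * (2 powr \<bar>e - l\<bar> * 2 powr (real k * (e - l)))"
          using n N D C_nonneg by (intro mult_left_mono powr_dyadic_le) auto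
        finally show "\<bar>c n * \<phi> n x\<bar> \<le> G * 2 powr (real k * (e - l))" by (simp add: G_def mult_ac)
      qed
      also have "\<dots> = real (card {2^k..<N}) * (G * 2 powr (real k * (e - l)))"
        by (subst sum_constant) simp
      also have "\<dots> \<le> 2 powr real k * (G * 2 powr (real k * (e - l)))"
        using card G by (intro mult_right_mono) auto
      also have "\<dots> = G * 2 powr (real k * (e + 1 - l))"
        by (simp add: mult_ac powr_add[symmetric]) (simp add: algebra_simps)
      finally show ?thesis .
    qed
    have T2: "(LINT x|M. (T x)\<^sup>2) \<le> G2 * 2 powr (real k * (1 - 2 * l))"
    proof -
      have "(LINT x|M. (T x)\<^sup>2) = (\<Sum>n\<in>{2^k..<N}. (c n)\<^sup>2)"
        unfolding T_def by (rule integral_sum_\<phi>_square) simp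
      also have "\<dots> \<le> (\<Sum>n\<in>{2^k..<N}. G2 * 2 powr (real k * (- 2 * l)))"
      proof (rule sum_mono)
        fix n assume n: "n \<in> {2^k..<N}"
        have "(c n)\<^sup>2 = \<bar>c n\<bar>\<^sup>2" by simp
        also have "\<dots> \<le> (D * (real n + 1) powr (- l))\<^sup>2"
          by (intro power_mono c) auto
        also have "\<dots> = D\<^sup>2 * (real n + 1) powr (- 2 * l)"
          by (simp add: power_mult_distrib power2_eq_square powr_add[symmetric])
        also have "\<dots> \<le> D\<^sup>2 * (2 powr \<bar>- 2 * l\<bar> * 2 powr (real k * (- 2 * l)))"
          using n N by (intro mult_left_mono powr_dyadic_le) auto
        finally show "(c n)\<^sup>2 \<le> G2 * 2 powr (real k * (- 2 * l))" by (simp add: G2_def mult_ac)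
      qed
      also have "\<dots> = real (card {2^k..<N}) * (G2 * 2 powr (real k * (- 2 * l)))"
        by (subst sum_constant) simp
      also have "\<dots> \<le> 2 powr real k * (G2 * 2 powr (real k * (- 2 * l)))"
        using card G by (intro mult_right_mono) auto
      also have "\<dots> = G2 * 2 powr (real k * (1 - 2 * l))"
        by (simp add: mult_ac powr_add[symmetric]) (simp add: algebra_simps)
      finally show ?thesis .
    qed
    let ?S = "G * 2 powr (real k * (e + 1 - l))"
    have "(LINT x|M. \<bar>T x\<bar> powr q) \<le> (LINT x|M. ?S powr (q - 2) * (T x)\<^sup>2)"
    proof (rule integral_mono)
      fix x assume x: "x \<in> space M"
      have "\<bar>T x\<bar> powr q = \<bar>T x\<bar> powr (q - 2) * \<bar>T x\<bar> powr 2"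
        by (subst powr_add[symmetric]) simp
      also have "\<bar>T x\<bar> powr 2 = (T x)\<^sup>2" by (cases "T x = 0") (auto simp: powr_numeral)
      also have "\<bar>T x\<bar> powr (q - 2) * (T x)\<^sup>2 \<le> ?S powr (q - 2) * (T x)\<^sup>2"
        using q T[OF x] by (intro mult_right_mono powr_mono2) auto
      finally show "\<bar>T x\<bar> powr q \<le> ?S powr (q - 2) * (T x)\<^sup>2" .
    qed (use q in \<open>auto simp: T_def intro!: integrable_sum_\<phi>_powr integral_sum_\<phi>_square\<close>)
    also have "\<dots> = ?S powr (q - 2) * (LINT x|M. (T x)\<^sup>2)" by simp
    also have "\<dots> \<le> ?S powr (q - 2) * (G2 * 2 powr (real k * (1 - 2 * l)))"
      by (intro mult_left_mono T2) auto
    also have "\<dots> = G powr (q - 2) * G2 *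
        (2 powr (real k * (e + 1 - l) * (q - 2)) * 2 powr (real k * (1 - 2 * l)))"
    proof -
      have "?S powr (q - 2) = G powr (q - 2) * 2 powr (real k * (e + 1 - l) * (q - 2))"
        by (simp only: powr_mult powr_powr)
      then show ?thesis by (simp only: mult_ac)
    qed
    also have "2 powr (real k * (e + 1 - l) * (q - 2)) * 2 powr (real k * (1 - 2 * l))
       = (2 powr (q * (e + 1 - l) - (2 * e + 1))) powr real k"
    proof -
      have "real k * (e + 1 - l) * (q - 2) + real k * (1 - 2 * l) = (q * (e + 1 - l) - (2 * e + 1)) * real k"
        by (simp add: algebra_simps)
      then show ?thesis by (simp only: powr_powr powr_add[symmetric])
    qed
    also have "\<dots> = (2 powr (q * (e + 1 - l) - (2 * e + 1))) ^ k"
      by (subst powr_realpow) auto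
    finally show "(LINT x|M. \<bar>\<Sum>n\<in>{2^k..<N}. c n * \<phi> n x\<bar> powr q)
        \<le> G powr (q - 2) * G2 * (2 powr (q * (e + 1 - l) - (2 * e + 1))) ^ k"
      by (simp add: T_def)
  qed
qed

end

lemma AE_summable_if_summable_integral:
  fixes f :: "nat \<Rightarrow> 'a \<Rightarrow> real"
  assumes int: "\<And>i. integrable M (f i)" and nn: "\<And>i x. 0 \<le> f i x"
    and s: "summable (\<lambda>i. \<integral>x. f i x \<partial>M)"
  shows "AE x in M. summable (\<lambda>i. f i x)"
proof -
  have [measurable]: "f i \<in> borel_measurable M" for i using int by auto
  have "(\<integral>\<^sup>+x. (\<Sum>i. ennreal (f i x)) \<partial>M) = (\<Sum>i. \<integral>\<^sup>+x. ennreal (f i x) \<partial>M)"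
    by (rule nn_integral_suminf) simp
  also have "\<dots> = (\<Sum>i. ennreal (LINT x|M. f i x))"
    using int nn by (simp add: nn_integral_eq_integral)
  also have "\<dots> \<noteq> \<infinity>"
    using s nn by (subst suminf_ennreal_eq[OF _ summable_sums]) auto
  finally have "AE x in M. (\<Sum>i. ennreal (f i x)) \<noteq> \<infinity>"
    by (intro nn_integral_noteq_infinite) auto
  then show ?thesis
    by eventually_elim (use nn in \<open>auto intro!: summable_suminf_not_top\<close>)
qed

context bounded_orthonormal
begin

text \<open>The sum is constructed pointwise: a single integrable V dominates the q-th powers of all
  blocks with geometric weights, so the block series converges absolutely almost everywhere and its
  tails come with a rate. The coefficients follow from convergence in L_1, since each
  \<open>\<phi> m\<close> is bounded.\<close>

theorem orthonormal_series_Lp: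
  assumes c: "\<And>n. \<bar>c n\<bar> \<le> D * (real n + 1) powr (- l)" and q: "q \<ge> 2"
    and ql: "q * (e + 1 - l) < 2 * e + 1"
  obtains S where "S \<in> borel_measurable M" "integrable M (\<lambda>x. \<bar>S x\<bar> powr q)"
    "(\<lambda>N. \<integral>x. \<bar>(\<Sum>n<N. c n * \<phi> n x) - S x\<bar> powr q \<partial>M) \<longlonglongrightarrow> 0"
    "integrable M S" "\<And>m. (LINT x|M. S x * \<phi> m x) = c m"
proof -
  define \<tau> where "\<tau> = 2 powr (q * (e + 1 - l) - (2 * e + 1))"
  have \<tau>: "0 < \<tau>" "\<tau> < 1" using ql by (auto simp: \<tau>_def powr_less_one)
  \<comment> \<open>The decay \<tau>^k is shared: one factor \<rho>^k makes the integrals of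
    \<open>v k\<close> summable, the other survives pointwise in |B_k|^q \<le> V \<rho>^k. The q-th
    root \<sigma> of \<rho> is then the ratio for |B_k| itself.\<close>
  define \<rho> where "\<rho> = sqrt \<tau>"
  have \<rho>: "0 < \<rho>" "\<rho> < 1" "\<tau> = \<rho> * \<rho>" using \<tau> by (auto simp: \<rho>_def)
  define \<sigma> where "\<sigma> = \<rho> powr (1 / q)"
  have \<sigma>: "0 < \<sigma>" "\<sigma> < 1" using \<rho> q powr_less_mono2[of "1/q" \<rho> 1] by (auto simp: \<sigma>_def)
  have \<sigma>k: "(\<sigma> ^ k) powr q = \<rho> ^ k" for k
  proof -
    have "(\<sigma> ^ k) powr q = (\<sigma> powr q) powr real k"
      using \<sigma> by (simp only: powr_realpow[symmetric] powr_powr mult.commute)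
    also have "\<sigma> powr q = \<rho>" using \<rho> q by (simp add: \<sigma>_def powr_powr)
    finally show ?thesis using \<rho> by (simp add: powr_realpow)
  qed
  obtain E where E: "E \<ge> 0" "\<And>k N. N \<le> 2 ^ Suc k \<Longrightarrow>
      (LINT x|M. \<bar>\<Sum>n\<in>{2^k..<N}. c n * \<phi> n x\<bar> powr q) \<le> E * \<tau> ^ k"
    by (rule dyadic_block_bound[OF c q, folded \<tau>_def]) (rule that)
  define P where "P N x = (\<Sum>n<N. c n * \<phi> n x)" for N x
  have P_diff: "(\<Sum>n\<in>{m..<N}. c n * \<phi> n x) = P N x - P m x" if "m \<le> N" for m N x
    unfolding P_def using sum_diff_nat_ivl[of 0 m N "\<lambda>n. c n * \<phi> n x"] that
    by (simp add: lessThan_atLeast0)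
  have [measurable]: "P N \<in> borel_measurable M" for N unfolding P_def by measurable
  define B where "B k x = P (2 ^ Suc k) x - P (2 ^ k) x" for k x
  have [measurable]: "B k \<in> borel_measurable M" for k unfolding B_def by measurable
  have B_sum: "B k x = (\<Sum>n\<in>{2^k..<2 ^ Suc k}. c n * \<phi> n x)" for k x
    unfolding B_def by (rule P_diff[symmetric]) simp
  have iB: "integrable M (\<lambda>x. \<bar>B k x\<bar> powr q)" for k
    unfolding B_sum using q by (intro integrable_sum_\<phi>_powr) auto
  define v where "v k x = \<bar>B k x\<bar> powr q / \<rho> ^ k" for k x
  have v: "integrable M (v k)" "v k x \<ge> 0" for k x
    unfolding v_def using iB \<rho> by auto
  have vk: "(LINT x|M. v k x) \<le> E * \<rho> ^ k" for k
  proof -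
    have "(LINT x|M. v k x) = (LINT x|M. \<bar>B k x\<bar> powr q) / \<rho> ^ k" by (simp add: v_def)
    also have "\<dots> \<le> (E * \<tau> ^ k) / \<rho> ^ k"
      unfolding B_sum using \<rho> by (intro divide_right_mono E) auto
    also have "\<dots> = E * \<rho> ^ k" using \<rho> by (simp add: power_mult_distrib)
    finally show ?thesis .
  qed
  have sv: "summable (\<lambda>k. \<integral>x. v k x \<partial>M)"
    by (rule summable_comparison_test[of _ "\<lambda>k. E * \<rho> ^ k"])
       (use vk v(2) \<rho> in \<open>auto intro!: summable_mult summable_geometric simp: integral_nonneg_AE abs_of_nonneg\<close>)
  have aev: "AE x in M. summable (\<lambda>k. v k x)"
    by (rule AE_summable_if_summable_integral[OF v sv])
  define V where "V x = (\<Sum>k. v k x)" for x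
  have V: "integrable M V" unfolding V_def
    using v aev sv by (intro integrable_suminf) auto
  \<comment> \<open>The blocks start at n = 1; \<open>P 1\<close> supplies the term n = 0.\<close>
  define S where "S x = P 1 x + (\<Sum>k. B k x)" for x
  have [measurable]: "S \<in> borel_measurable M" unfolding S_def by measurable
  define W where "W x = V x powr (1 / q)" for x
  have tail: "AE x in M. \<forall>k. \<bar>P (2 ^ k) x - S x\<bar> powr q \<le> (1 - \<sigma>) powr (- q) * V x * \<rho> ^ k"
    using aev
  proof eventually_elim
    case (elim x)
    have V0: "V x \<ge> 0" unfolding V_def using elim v by (intro suminf_nonneg) auto
    have Bk: "\<bar>B k x\<bar> \<le> W x * \<sigma> ^ k" for k
    proof -
      have "v k x \<le> V x" unfolding V_def
        using sum_le_suminf[OF elim, of "{k}"] v by auto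
      then have "\<bar>B k x\<bar> powr q \<le> V x * \<rho> ^ k" using \<rho> by (simp add: v_def field_simps)
      then have "(\<bar>B k x\<bar> powr q) powr (1 / q) \<le> (V x * \<rho> ^ k) powr (1 / q)"
        using q by (intro powr_mono2) auto
      also have "(V x * \<rho> ^ k) powr (1 / q) = W x * ((\<sigma> ^ k) powr q) powr (1 / q)"
        using V0 \<rho> by (simp add: powr_mult W_def \<sigma>k)
      finally show ?thesis using q \<sigma> by (simp add: powr_powr)
    qed
    have sB: "summable (\<lambda>k. \<bar>B k x\<bar>)"
      by (rule summable_comparison_test[of _ "\<lambda>k. W x * \<sigma> ^ k"])
         (use Bk \<sigma> in \<open>auto intro!: summable_mult summable_geometric\<close>)
    show ?case
    proof
      fix k
      have P2k: "P (2 ^ k) x = P 1 x + (\<Sum>j<k. B j x)"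
        by (induction k) (auto simp: B_def)
      have "(\<Sum>j. B j x) = (\<Sum>j. B (j + k) x) + (\<Sum>j<k. B j x)"
        by (rule suminf_split_initial_segment) (use sB in \<open>rule summable_rabs_cancel\<close>)
      then have "P (2 ^ k) x - S x = - (\<Sum>j. B (j + k) x)"
        by (simp add: S_def P2k)
      then have "\<bar>P (2 ^ k) x - S x\<bar> \<le> (\<Sum>j. \<bar>B (j + k) x\<bar>)"
        using summable_rabs[of "\<lambda>j. B (j + k) x"] sB by (simp add: summable_iff_shift[of "\<lambda>j. \<bar>B j x\<bar>"])
      also have "\<dots> \<le> (\<Sum>j. W x * \<sigma> ^ k * \<sigma> ^ j)"
      proof (rule suminf_le)
        show "\<bar>B (j + k) x\<bar> \<le> W x * \<sigma> ^ k * \<sigma> ^ j" for j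
          using Bk[of "j + k"] by (simp add: power_add mult_ac)
        show "summable (\<lambda>j. \<bar>B (j + k) x\<bar>)" using sB by (simp add: summable_iff_shift[of "\<lambda>j. \<bar>B j x\<bar>"])
        show "summable (\<lambda>j. W x * \<sigma> ^ k * \<sigma> ^ j)" using \<sigma> by (intro summable_mult summable_geometric) auto
      qed
      also have "\<dots> = W x * \<sigma> ^ k / (1 - \<sigma>)"
        using \<sigma> by (subst suminf_mult) (auto simp: suminf_geometric summable_geometric)
      finally have "\<bar>P (2 ^ k) x - S x\<bar> powr q \<le> (W x * \<sigma> ^ k / (1 - \<sigma>)) powr q"
        using q by (intro powr_mono2) auto
      also have "\<dots> = W x powr q * (\<sigma> ^ k) powr q / (1 - \<sigma>) powr q"
        using \<sigma> V0 by (simp add: W_def powr_mult powr_divide)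
      also have "\<dots> = (1 - \<sigma>) powr (- q) * V x * \<rho> ^ k"
        using V0 q by (simp add: \<sigma>k W_def powr_powr powr_minus divide_simps)
      finally show "\<bar>P (2 ^ k) x - S x\<bar> powr q \<le> (1 - \<sigma>) powr (- q) * V x * \<rho> ^ k" .
    qed
  qed
  have i2: "integrable M (\<lambda>x. \<bar>P (2 ^ k) x - S x\<bar> powr q)" for k
  proof (rule Bochner_Integration.integrable_bound)
    show "integrable M (\<lambda>x. (1 - \<sigma>) powr (- q) * V x * \<rho> ^ k)" using V by simp
    show "AE x in M. norm (\<bar>P (2 ^ k) x - S x\<bar> powr q) \<le> norm ((1 - \<sigma>) powr (- q) * V x * \<rho> ^ k)"
      using tail by eventually_elim (auto intro: order_trans[OF _ abs_ge_self])
  qed measurable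
  have iP: "integrable M (\<lambda>x. \<bar>P N x\<bar> powr q)" for N
    unfolding P_def using q by (intro integrable_sum_\<phi>_powr) auto
  have add_int: "integrable M (\<lambda>x. \<bar>f x + g x\<bar> powr q)"
    if "integrable M (\<lambda>x. \<bar>f x\<bar> powr q)" "integrable M (\<lambda>x. \<bar>g x\<bar> powr q)"
      and [measurable]: "f \<in> borel_measurable M" "g \<in> borel_measurable M" for f g
  proof (rule Bochner_Integration.integrable_bound)
    show "integrable M (\<lambda>x. 2 powr q * (\<bar>f x\<bar> powr q + \<bar>g x\<bar> powr q))" using that by simp
    show "AE x in M. norm (\<bar>f x + g x\<bar> powr q) \<le> norm (2 powr q * (\<bar>f x\<bar> powr q + \<bar>g x\<bar> powr q))"
      using q by (intro AE_I2) (auto intro!: abs_add_powr_le)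
  qed measurable
  have iS: "integrable M (\<lambda>x. \<bar>S x\<bar> powr q)"
    using add_int[of "\<lambda>x. - (P (2 ^ 0) x - S x)" "P (2 ^ 0)"] iP i2[of 0] by (simp add: abs_minus_commute)
  have iPS: "integrable M (\<lambda>x. \<bar>P N x - S x\<bar> powr q)" for N
    using add_int[of "P N" "\<lambda>x. - S x"] iP iS by simp
  define K where "K = 2 powr q * (E + (1 - \<sigma>) powr (- q) * (LINT x|M. V x))"
  \<comment> \<open>For N inside block k the error splits at the dyadic start of the block: the
    incomplete block costs E \<tau>^k, the rest is the pointwise tail estimate.\<close>
  have bnd: "(LINT x|M. \<bar>P N x - S x\<bar> powr q) \<le> K * \<rho> ^ k" if N: "2 ^ k \<le> N" "N \<le> 2 ^ Suc k" for N k
  proof -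
    have "(LINT x|M. \<bar>P N x - S x\<bar> powr q)
      \<le> (LINT x|M. 2 powr q * (\<bar>\<Sum>n\<in>{2^k..<N}. c n * \<phi> n x\<bar> powr q + \<bar>P (2 ^ k) x - S x\<bar> powr q))"
    proof (rule integral_mono)
      fix x
      show "\<bar>P N x - S x\<bar> powr q \<le> 2 powr q * (\<bar>\<Sum>n\<in>{2^k..<N}. c n * \<phi> n x\<bar> powr q + \<bar>P (2 ^ k) x - S x\<bar> powr q)"
        using abs_add_powr_le[of q "\<Sum>n\<in>{2^k..<N}. c n * \<phi> n x" "P (2 ^ k) x - S x"] q
        by (simp add: P_diff[OF N(1)])
    qed (use q iPS i2 in \<open>auto intro!: integrable_sum_\<phi>_powr\<close>)
    also have "\<dots> = 2 powr q * ((LINT x|M. \<bar>\<Sum>n\<in>{2^k..<N}. c n * \<phi> n x\<bar> powr q)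
        + (LINT x|M. \<bar>P (2 ^ k) x - S x\<bar> powr q))"
      using q i2 by (subst Bochner_Integration.integral_mult_right_zero,
        subst Bochner_Integration.integral_add) (auto intro!: integrable_sum_\<phi>_powr)
    also have "\<dots> \<le> 2 powr q * (E * \<rho> ^ k + (LINT x|M. (1 - \<sigma>) powr (- q) * V x * \<rho> ^ k))"
    proof (intro mult_left_mono add_mono)
      have "E * \<tau> ^ k \<le> E * \<rho> ^ k"
        using \<rho> E(1) by (intro mult_left_mono power_mono) (auto intro: mult_left_le)
      then show "(LINT x|M. \<bar>\<Sum>n\<in>{2^k..<N}. c n * \<phi> n x\<bar> powr q) \<le> E * \<rho> ^ k"
        using E(2)[OF N(2)] by linarith
      show "(LINT x|M. \<bar>P (2 ^ k) x - S x\<bar> powr q) \<le> (LINT x|M. (1 - \<sigma>) powr (- q) * V x * \<rho> ^ k)"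
        by (rule integral_mono_AE) (use i2 V tail in \<open>auto elim: eventually_mono\<close>)
    qed auto
    also have "\<dots> = K * \<rho> ^ k" using V by (simp add: K_def algebra_simps)
    finally show ?thesis .
  qed
  have lim: "(\<lambda>N. \<integral>x. \<bar>P N x - S x\<bar> powr q \<partial>M) \<longlonglongrightarrow> 0"
  proof (rule LIMSEQ_I)
    fix r :: real assume "r > 0"
    have "(\<lambda>k. K * \<rho> ^ k) \<longlonglongrightarrow> K * 0" using \<rho> by (intro tendsto_intros LIMSEQ_realpow_zero) auto
    then obtain k0 where k0: "\<And>k. k \<ge> k0 \<Longrightarrow> \<bar>K * \<rho> ^ k\<bar> < r"
      using LIMSEQ_D[of _ _ r] \<open>r > 0\<close> by fastforce
    show "\<exists>no. \<forall>N\<ge>no. norm ((LINT x|M. \<bar>P N x - S x\<bar> powr q) - 0) < r"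
    proof (intro exI allI impI)
      fix N :: nat assume N: "N \<ge> 2 ^ k0"
      then have "N \<ge> 1" using one_le_power[of "2::nat" k0] by linarith
      then obtain k where k: "2 ^ k \<le> N" "N < 2 ^ (k + 1)" using ex_power_ivl1[of 2 N] by auto
      have "k0 \<le> k"
      proof (rule ccontr)
        assume "\<not> k0 \<le> k"
        then have "(2::nat) ^ (k + 1) \<le> 2 ^ k0" by (intro power_increasing) auto
        then show False using k N by linarith
      qed
      then show "norm ((LINT x|M. \<bar>P N x - S x\<bar> powr q) - 0) < r"
        using bnd[OF k(1)] k k0[of k] by (auto simp: abs_of_nonneg)
    qed
  qed
  have int_from_powr: "integrable M f" if [measurable]: "f \<in> borel_measurable M" and "integrable M (\<lambda>x. \<bar>f x\<bar> powr q)" for f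
    using integrable_powr_mono[OF that, of 1] q by (auto intro: integrable_abs_cancel simp: )
  have S_int: "integrable M S" by (rule int_from_powr) (use iS in auto)
  have P_int: "integrable M (P N)" for N by (rule int_from_powr) (use iP in auto)
  have lim1: "(\<lambda>N. \<integral>x. \<bar>P N x - S x\<bar> powr 1 \<partial>M) \<longlonglongrightarrow> 0"
    by (rule tendsto_powr_mono[OF _ iPS _ _ lim]) (use q in auto)
  have coeff: "(LINT x|M. S x * \<phi> m x) = c m" for m
  proof (rule LIMSEQ_unique)
    let ?B = "C * (real m + 1) powr e"
    have "(\<lambda>N. (LINT x|M. P N x * \<phi> m x) - (LINT x|M. S x * \<phi> m x)) \<longlonglongrightarrow> 0"
    proof (rule Lim_null_comparison)
      show "\<forall>\<^sub>F N in sequentially. norm ((LINT x|M. P N x * \<phi> m x) - (LINT x|M. S x * \<phi> m x))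
          \<le> ?B * (LINT x|M. \<bar>P N x - S x\<bar> powr 1)"
      proof (rule always_eventually, rule allI)
        fix N
        have "(LINT x|M. P N x * \<phi> m x) - (LINT x|M. S x * \<phi> m x) = (LINT x|M. (P N x - S x) * \<phi> m x)"
          using S_int P_int by (simp add: left_diff_distrib integrable_times_\<phi>)
        also have "norm \<dots> \<le> (LINT x|M. norm ((P N x - S x) * \<phi> m x))"
          by (rule integral_norm_bound)
        also have "\<dots> \<le> (LINT x|M. ?B * \<bar>P N x - S x\<bar>)"
        proof (rule integral_mono)
          show "norm ((P N x - S x) * \<phi> m x) \<le> ?B * \<bar>P N x - S x\<bar>" if "x \<in> space M" for x
            using mult_left_mono[OF \<phi>_bound[OF that, of m], of "\<bar>P N x - S x\<bar>"]
            by (simp add: abs_mult mult_ac)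
        qed (use S_int P_int in \<open>auto intro!: integrable_times_\<phi>\<close>)
        finally show "norm ((LINT x|M. P N x * \<phi> m x) - (LINT x|M. S x * \<phi> m x))
          \<le> ?B * (LINT x|M. \<bar>P N x - S x\<bar> powr 1)" by simp
      qed
      show "(\<lambda>N. ?B * (LINT x|M. \<bar>P N x - S x\<bar> powr 1)) \<longlonglongrightarrow> 0"
        using tendsto_mult_left[OF lim1, of ?B] by simp
    qed
    then show "(\<lambda>N. \<integral>x. P N x * \<phi> m x \<partial>M) \<longlonglongrightarrow> (LINT x|M. S x * \<phi> m x)"
      using LIM_zero_iff by blast
    have "(LINT x|M. P N x * \<phi> m x) = c m" if "N > m" for N
    proof -
      have "(LINT x|M. P N x * \<phi> m x) = (LINT x|M. (\<Sum>n<N. c n * (\<phi> n x * \<phi> m x)))"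
        by (simp add: P_def sum_distrib_right mult.assoc)
      also have "\<dots> = (\<Sum>n<N. c n * (if n = m then 1 else 0))"
        by (subst Bochner_Integration.integral_sum)
           (auto intro!: integrable_mult_right integrable_times_\<phi> integrable_\<phi> simp: \<phi>_orthonormal)
      also have "\<dots> = (\<Sum>n<N. if n = m then c n else 0)" by (intro sum.cong) auto
      also have "\<dots> = c m" using that by simp
      finally show ?thesis .
    qed
    then show "(\<lambda>N. \<integral>x. P N x * \<phi> m x \<partial>M) \<longlonglongrightarrow> c m"
      by (intro tendsto_eventually) (auto intro: eventually_mono[OF eventually_gt_at_top[of m]])
  qed
  show ?thesis
    by (rule that[of S]) (use iS lim S_int coeff in \<open>auto simp: P_def\<close>)
qed

end

section \<open>The Jacobi polynomials as homogeneous sums\<close>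

text \<open>Pascal's rule as it occurs in Leibniz's formula: \<open>u i l\<close> stands for the
  i-th derivative of one factor times the l-th derivative of the other.\<close>

lemma binomial_Pascal_sum:
  fixes u :: "nat \<Rightarrow> nat \<Rightarrow> real"
  shows "(\<Sum>j\<le>m. real (m choose j) * (u (Suc j) (m - j) + u j (Suc (m - j))))
       = (\<Sum>j\<le>Suc m. real (Suc m choose j) * u j (Suc m - j))"
proof -
  have "(\<Sum>j\<le>Suc m. real (Suc m choose j) * u j (Suc m - j))
      = u 0 (Suc m) + (\<Sum>j\<le>m. real (Suc m choose Suc j) * u (Suc j) (m - j))"
    by (subst sum.atMost_Suc_shift) simp
  also have "\<dots> = (\<Sum>j\<le>m. real (m choose j) * u (Suc j) (m - j))
      + (u 0 (Suc m) + (\<Sum>j\<le>m. real (m choose Suc j) * u (Suc j) (m - j)))"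
    by (simp add: algebra_simps sum.distrib)
  also have "u 0 (Suc m) + (\<Sum>j\<le>m. real (m choose Suc j) * u (Suc j) (m - j))
      = (\<Sum>j\<le>Suc m. real (m choose j) * u j (Suc m - j))"
    by (subst sum.atMost_Suc_shift) simp
  also have "\<dots> = (\<Sum>j\<le>m. real (m choose j) * u j (Suc (m - j)))"
    by (simp add: Suc_diff_le)
  finally show ?thesis by (simp add: algebra_simps sum.distrib)
qed

text \<open>Leibniz's rule. The falling factorial of p is (-1)^j \<open>pochhammer (- p) j\<close>;
  for the factor in b - y the sign of the inner derivative cancels the corresponding sign, so
  \<open>pochhammer (- q)\<close> stands bare.\<close>

lemma higher_deriv_powr_product:
  fixes a b p q :: real
  assumes "x \<in> {a<..<b}"
  shows "(deriv ^^ m) (\<lambda>y. (y - a) powr p * (b - y) powr q) x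
    = (\<Sum>j\<le>m. real (m choose j) * ((-1) ^ j * pochhammer (- p) j * pochhammer (- q) (m - j)
         * (x - a) powr (p - real j) * (b - x) powr (q - real (m - j))))"
  using assms
proof (induction m arbitrary: x)
  case 0
  then show ?case by simp
next
  case (Suc m)
  define u where "u i l y = (-1) ^ i * pochhammer (- p) i * pochhammer (- q) l
      * (y - a) powr (p - real i) * (b - y) powr (q - real l)" for i l :: nat and y
  have du: "(u i l has_field_derivative u (Suc i) l x + u i (Suc l) x) (at x)" for i l
  proof -
    have "((\<lambda>y. (y - a) powr (p - real i) * (b - y) powr (q - real l)) has_field_derivative
        (p - real i) * (x - a) powr (p - real i - 1) * (b - x) powr (q - real l)
        - (x - a) powr (p - real i) * ((q - real l) * (b - x) powr (q - real l - 1))) (at x)"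
      using Suc.prems by (auto intro!: derivative_eq_intros simp: mult_ac)
    note DERIV_cmult[OF this, of "(-1) ^ i * pochhammer (- p) i * pochhammer (- q) l"]
    moreover have "u i l = (\<lambda>y. (-1) ^ i * pochhammer (- p) i * pochhammer (- q) l *
        ((y - a) powr (p - real i) * (b - y) powr (q - real l)))"
      by (simp add: u_def fun_eq_iff mult.assoc)
    moreover have "(-1) ^ i * pochhammer (- p) i * pochhammer (- q) l *
        ((p - real i) * (x - a) powr (p - real i - 1) * (b - x) powr (q - real l)
        - (x - a) powr (p - real i) * ((q - real l) * (b - x) powr (q - real l - 1)))
       = u (Suc i) l x + u i (Suc l) x"
    proof -
      have "p - real (Suc i) = p - real i - 1" "q - real (Suc l) = q - real l - 1" by auto
      then show ?thesis unfolding u_def pochhammer_Suc by (simp only:) (simp add: algebra_simps)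
    qed
    ultimately show ?thesis by simp
  qed
  have D: "((\<lambda>y. \<Sum>j\<le>m. real (m choose j) * u j (m - j) y) has_field_derivative
      (\<Sum>j\<le>m. real (m choose j) * (u (Suc j) (m - j) x + u j (Suc (m - j)) x))) (at x)"
    by (intro DERIV_sum DERIV_cmult du)
  \<comment> \<open>The induction hypothesis holds on the whole open interval, so the closed form
    may be differentiated in place of the m-th derivative.\<close>
  have "((deriv ^^ m) (\<lambda>y. (y - a) powr p * (b - y) powr q) has_field_derivative
      (\<Sum>j\<le>m. real (m choose j) * (u (Suc j) (m - j) x + u j (Suc (m - j)) x))) (at x)"
    by (rule has_field_derivative_transform_within_open[OF D, of "{a<..<b}"])
       (use Suc in \<open>auto simp: u_def\<close>)
  then have "(deriv ^^ Suc m) (\<lambda>y. (y - a) powr p * (b - y) powr q) x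
      = (\<Sum>j\<le>m. real (m choose j) * (u (Suc j) (m - j) x + u j (Suc (m - j)) x))"
    by (simp add: DERIV_imp_deriv)
  also have "\<dots> = (\<Sum>j\<le>Suc m. real (Suc m choose j) * u j (Suc m - j) x)"
    by (rule binomial_Pascal_sum[of m "\<lambda>i l. u i l x"])
  finally show ?case by (simp only: u_def)
qed

text \<open>Coefficient of (x-a)^(n-j) (b-x)^j once the powers of the weight are cancelled in
  Rodrigues' formula; it equals (-1)^(n-j) n! binom(n+\<beta>, j) binom(n+\<gamma>, n-j). This basis
  treats both endpoints alike.\<close>

definition jacobi_d :: "real \<Rightarrow> real \<Rightarrow> nat \<Rightarrow> nat \<Rightarrow> real" where
  "jacobi_d \<beta> \<gamma> n j =
     (-1) ^ j * real (n choose j) * pochhammer (- (\<beta> + real n)) j * pochhammer (- (\<gamma> + real n)) (n - j)"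

lemma jacobi_p_eq_sum:
  assumes "x \<in> {a<..<b}"
  shows "jacobi_p a b \<beta> \<gamma> n x
    = jacobi_delta a b \<beta> \<gamma> n * (\<Sum>j\<le>n. jacobi_d \<beta> \<gamma> n j * (x - a) ^ (n - j) * (b - x) ^ j)"
proof -
  have "(x - a) powr (- \<beta>) * (b - x) powr (- \<gamma>) *
      (real (n choose j) * ((-1) ^ j * pochhammer (- (\<beta> + real n)) j * pochhammer (- (\<gamma> + real n)) (n - j)
         * (x - a) powr (\<beta> + real n - real j) * (b - x) powr (\<gamma> + real n - real (n - j))))
    = jacobi_d \<beta> \<gamma> n j * (x - a) ^ (n - j) * (b - x) ^ j" if "j \<le> n" for j
  proof -
    have "(x - a) powr (- \<beta>) * (x - a) powr (\<beta> + real n - real j) = (x - a) powr real (n - j)"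
      using that by (subst powr_add[symmetric]) (simp add: of_nat_diff)
    also have "\<dots> = (x - a) ^ (n - j)" using assms by (intro powr_realpow) auto
    finally have 1: "(x - a) powr (- \<beta>) * (x - a) powr (\<beta> + real n - real j) = (x - a) ^ (n - j)" .
    have "(b - x) powr (- \<gamma>) * (b - x) powr (\<gamma> + real n - real (n - j)) = (b - x) powr real j"
      using that by (subst powr_add[symmetric]) (simp add: of_nat_diff)
    also have "\<dots> = (b - x) ^ j" using assms by (intro powr_realpow) auto
    finally have 2: "(b - x) powr (- \<gamma>) * (b - x) powr (\<gamma> + real n - real (n - j)) = (b - x) ^ j" .
    show ?thesis
      unfolding jacobi_d_def 1[symmetric] 2[symmetric] by (simp only: mult_ac)
  qed
  then have "(x - a) powr (- \<beta>) * (b - x) powr (- \<gamma>) *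
     (deriv ^^ n) (\<lambda>y. (y - a) powr (\<beta> + real n) * (b - y) powr (\<gamma> + real n)) x
     = (\<Sum>j\<le>n. jacobi_d \<beta> \<gamma> n j * (x - a) ^ (n - j) * (b - x) ^ j)"
    unfolding higher_deriv_powr_product[OF assms] sum_distrib_left by (intro sum.cong) auto
  then show ?thesis unfolding jacobi_p_def by (simp only: mult.assoc)
qed

text \<open>At x = b only j = 0 survives in the homogeneous sum and at x = a only j = n, so this
  coefficient and \<open>jacobi_d_n\<close> are the endpoint values up to (b-a)^n.\<close>

lemma jacobi_d_0: "jacobi_d \<beta> \<gamma> n 0 = (-1) ^ n * pochhammer (\<gamma> + 1) n"
  using pochhammer_minus[of "\<gamma> + real n" n] by (simp add: jacobi_d_def)

lemma jacobi_d_n: "jacobi_d \<beta> \<gamma> n n = pochhammer (\<beta> + 1) n"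
  using pochhammer_minus[of "\<beta> + real n" n] by (simp add: jacobi_d_def mult.assoc[symmetric] power_mult_distrib[symmetric])

text \<open>The two-term recurrence that makes the residual of the differential equation telescope;
  at j = n both sides are 0.\<close>

lemma jacobi_d_Suc:
  assumes "j \<le> n"
  shows "jacobi_d \<beta> \<gamma> n (Suc j) * (real (Suc j) * (real (Suc j) + \<gamma>))
       = - (jacobi_d \<beta> \<gamma> n j * (real (n - j) * (real (n - j) + \<beta>)))"
proof (cases "j = n")
  case True
  then show ?thesis by (simp add: jacobi_d_def)
next
  case False
  then obtain i where n: "n = Suc (j + i)" using assms by (metis le_neq_implies_less less_imp_Suc_add)
  have "Suc j * (n choose Suc j) = Suc i * (n choose j)"
    using binomial_absorption[of j n] binomial_absorb_comp[of n j] n by simp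
  then have "real (Suc j * (n choose Suc j)) = real (Suc i * (n choose j))" by (rule arg_cong)
  then have c: "real (n choose Suc j) * real (Suc j) = real (n choose j) * real (Suc i)"
    by (simp only: of_nat_mult mult.commute)
  have "jacobi_d \<beta> \<gamma> n (Suc j) * (real (Suc j) * (real (Suc j) + \<gamma>))
     = (real (n choose Suc j) * real (Suc j)) * ((-1) ^ Suc j * (pochhammer (- (\<beta> + real n)) j
        * (- (\<beta> + real n) + real j)) * (pochhammer (- (\<gamma> + real n)) i * (real (Suc j) + \<gamma>)))"
    by (simp add: jacobi_d_def pochhammer_Suc n mult_ac)
  also have "\<dots> = - (real (n choose j) * real (Suc i) * ((-1) ^ j * (pochhammer (- (\<beta> + real n)) j
        * (real (Suc i) + \<beta>)) * (pochhammer (- (\<gamma> + real n)) i * (- (\<gamma> + real n) + real i))))"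
    unfolding c by (simp add: n algebra_simps)
  also have "\<dots> = - (jacobi_d \<beta> \<gamma> n j * (real (n - j) * (real (n - j) + \<beta>)))"
    by (simp add: jacobi_d_def pochhammer_Suc n Suc_diff_le mult_ac)
  finally show ?thesis .
qed

text \<open>Under x - a = L - Y the j-th basis element contributes (-1)^(n-j) to the coefficient of
  Y^n, so this is the leading coefficient in powers of Y = b - x. The sum is Vandermonde's
  convolution of Pochhammer symbols.\<close>

lemma jacobi_lead_sum:
  "(\<Sum>j\<le>n. jacobi_d \<beta> \<gamma> n j * (-1) ^ (n - j)) = pochhammer (\<beta> + \<gamma> + real n + 1) n"
proof -
  have "(\<Sum>j\<le>n. jacobi_d \<beta> \<gamma> n j * (-1) ^ (n - j))
      = (-1) ^ n * (\<Sum>j\<le>n. real (n choose j) * pochhammer (- (\<beta> + real n)) j * pochhammer (- (\<gamma> + real n)) (n - j))"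
    unfolding sum_distrib_left
  proof (rule sum.cong)
    fix j assume "j \<in> {..n}"
    then have "(-1::real) ^ n = (-1) ^ j * (-1) ^ (n - j)" by (simp add: power_add[symmetric])
    then show "jacobi_d \<beta> \<gamma> n j * (-1) ^ (n - j) = (-1) ^ n * (real (n choose j)
        * pochhammer (- (\<beta> + real n)) j * pochhammer (- (\<gamma> + real n)) (n - j))"
      by (simp add: jacobi_d_def)
  qed simp
  also have "\<dots> = (-1) ^ n * pochhammer (- (\<beta> + real n) + - (\<gamma> + real n)) n"
    by (subst pochhammer_binomial_sum) simp
  also have "- (\<beta> + real n) + - (\<gamma> + real n) = - (\<beta> + \<gamma> + 2 * real n)" by simp
  also have "(-1) ^ n * pochhammer (- (\<beta> + \<gamma> + 2 * real n)) n = pochhammer (\<beta> + \<gamma> + real n + 1) n"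
    by (subst pochhammer_minus) (simp add: mult.assoc[symmetric] power_mult_distrib[symmetric] algebra_simps)
  finally show ?thesis .
qed

text \<open>The sign s = -1 expands the polynomial itself; s = 1 expands the majorant with absolute
  values.\<close>

lemma power_diff_expand:
  fixes L Y s :: real
  assumes "j \<le> n"
  shows "(L + s * Y) ^ (n - j) * Y ^ j
    = (\<Sum>k\<le>n. (if j \<le> k then real ((n - j) choose (k - j)) * L ^ (n - k) * s ^ (k - j) else 0) * Y ^ k)"
proof -
  have "(L + s * Y) ^ (n - j) * Y ^ j
     = (\<Sum>i\<le>n - j. real ((n - j) choose i) * (s * Y) ^ i * L ^ (n - j - i) * Y ^ j)"
    unfolding add.commute[of L] binomial_ring sum_distrib_right by simp
  also have "\<dots> = (\<Sum>k\<in>{j..n}. real ((n - j) choose (k - j)) * L ^ (n - k) * s ^ (k - j) * Y ^ k)"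
    by (rule sum.reindex_bij_witness[of _ "\<lambda>k. k - j" "\<lambda>i. i + j"])
       (use assms in \<open>auto simp: power_mult_distrib power_add mult_ac add_ac\<close>)
  also have "\<dots> = (\<Sum>k\<le>n. (if j \<le> k then real ((n - j) choose (k - j)) * L ^ (n - k) * s ^ (k - j) else 0) * Y ^ k)"
    by (intro sum.mono_neutral_cong_left) auto
  finally show ?thesis .
qed

text \<open>Coefficients in powers of Y = b - x of the polynomial without \<delta>_n, where L = b -
  a. The homogeneous form is left because the fractional operators act term by term on these
  powers.\<close>

definition jacobi_a :: "real \<Rightarrow> real \<Rightarrow> real \<Rightarrow> nat \<Rightarrow> nat \<Rightarrow> real" where
  "jacobi_a L \<beta> \<gamma> n k =
     (\<Sum>j\<le>n. jacobi_d \<beta> \<gamma> n j * (if j \<le> k then real ((n - j) choose (k - j)) * L ^ (n - k) * (-1) ^ (k - j) else 0))"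

lemma jacobi_sum_eq_a:
  "(\<Sum>j\<le>n. jacobi_d \<beta> \<gamma> n j * (L - Y) ^ (n - j) * Y ^ j) = (\<Sum>k\<le>n. jacobi_a L \<beta> \<gamma> n k * Y ^ k)"
proof -
  have "(\<Sum>j\<le>n. jacobi_d \<beta> \<gamma> n j * (L - Y) ^ (n - j) * Y ^ j)
    = (\<Sum>j\<le>n. jacobi_d \<beta> \<gamma> n j * (\<Sum>k\<le>n. (if j \<le> k then real ((n - j) choose (k - j)) * L ^ (n - k) * (-1) ^ (k - j) else 0) * Y ^ k))"
    using power_diff_expand[of _ n L "-1" Y] by (intro sum.cong refl) (simp add: mult.assoc)
  also have "\<dots> = (\<Sum>k\<le>n. \<Sum>j\<le>n. jacobi_d \<beta> \<gamma> n j * ((if j \<le> k then real ((n - j) choose (k - j)) * L ^ (n - k) * (-1) ^ (k - j) else 0) * Y ^ k))"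
    unfolding sum_distrib_left by (rule sum.swap)
  also have "\<dots> = (\<Sum>k\<le>n. jacobi_a L \<beta> \<gamma> n k * Y ^ k)"
    by (simp only: jacobi_a_def sum_distrib_right mult.assoc)
  finally show ?thesis .
qed

text \<open>After absolute values are taken, the inner sum is the binomial expansion of (L+R)^(n-j)
  R^j, which is at most (L+R)^n.\<close>

lemma jacobi_a_abs_sum_le:
  assumes "L \<ge> 0" "R \<ge> 0"
  shows "(\<Sum>k\<le>n. \<bar>jacobi_a L \<beta> \<gamma> n k\<bar> * R ^ k) \<le> (\<Sum>j\<le>n. \<bar>jacobi_d \<beta> \<gamma> n j\<bar>) * (L + R) ^ n"
proof -
  define t where "t j k = (if j \<le> k then real ((n - j) choose (k - j)) * L ^ (n - k) else 0)" for j k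
  have "\<bar>jacobi_a L \<beta> \<gamma> n k\<bar> \<le> (\<Sum>j\<le>n. \<bar>jacobi_d \<beta> \<gamma> n j\<bar> * t j k)" for k
    unfolding jacobi_a_def using assms
    by (intro order_trans[OF sum_abs] sum_mono) (auto simp: abs_mult power_abs t_def)
  then have "(\<Sum>k\<le>n. \<bar>jacobi_a L \<beta> \<gamma> n k\<bar> * R ^ k) \<le> (\<Sum>k\<le>n. (\<Sum>j\<le>n. \<bar>jacobi_d \<beta> \<gamma> n j\<bar> * t j k) * R ^ k)"
    using assms by (intro sum_mono mult_right_mono) auto
  also have "\<dots> = (\<Sum>j\<le>n. \<bar>jacobi_d \<beta> \<gamma> n j\<bar> * (\<Sum>k\<le>n. t j k * R ^ k))"
    unfolding sum_distrib_left sum_distrib_right mult.assoc by (rule sum.swap)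
  also have "\<dots> = (\<Sum>j\<le>n. \<bar>jacobi_d \<beta> \<gamma> n j\<bar> * ((L + R) ^ (n - j) * R ^ j))"
    using power_diff_expand[of _ n L 1 R, unfolded power_one mult_1_right mult_1] by (intro sum.cong refl) (simp add: t_def)
  also have "\<dots> \<le> (\<Sum>j\<le>n. \<bar>jacobi_d \<beta> \<gamma> n j\<bar> * (L + R) ^ n)"
  proof (intro sum_mono mult_left_mono)
    fix j assume "j \<in> {..n}"
    have "(L + R) ^ (n - j) * R ^ j \<le> (L + R) ^ (n - j) * (L + R) ^ j"
      using assms by (intro mult_left_mono power_mono) auto
    also have "\<dots> = (L + R) ^ n" using \<open>j \<in> {..n}\<close> by (simp add: power_add[symmetric])
    finally show "(L + R) ^ (n - j) * R ^ j \<le> (L + R) ^ n" .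
  qed auto
  finally show ?thesis by (simp add: sum_distrib_right)
qed

lemma jacobi_a_lead: "jacobi_a L \<beta> \<gamma> n n = pochhammer (\<beta> + \<gamma> + real n + 1) n"
  unfolding jacobi_a_def jacobi_lead_sum[symmetric] by (intro sum.cong) auto

text \<open>With X = x - a and Y = b - x, hence X' = 1 and Y' = -1, the left side is Jacobi's
  differential operator applied to X^i Y^j, with the eigenvalue of degree i + j. The case split is
  for the truncated exponents i - 1, i - 2, j - 1, j - 2: wherever truncation bites, the coefficient
  vanishes.\<close>

lemma jacobi_residual_term:
  fixes X Y \<beta> \<gamma> :: real and i j :: nat
  shows "X * Y * (real i * real (i - 1) * X ^ (i - 2) * Y ^ j - 2 * real i * real j * X ^ (i - 1) * Y ^ (j - 1)
            + real j * real (j - 1) * X ^ i * Y ^ (j - 2))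
     + ((\<beta> + 1) * Y - (\<gamma> + 1) * X) * (real i * X ^ (i - 1) * Y ^ j - real j * X ^ i * Y ^ (j - 1))
     + real (i + j) * (real (i + j) + \<beta> + \<gamma> + 1) * (X ^ i * Y ^ j)
   = real j * (real j + \<gamma>) * (X ^ i * Y ^ j + X ^ Suc i * Y ^ (j - 1))
     + real i * (real i + \<beta>) * (X ^ (i - 1) * Y ^ Suc j + X ^ i * Y ^ j)"
proof -
  consider "i = 0" | "i = 1" | i' where "i = Suc (Suc i')" by (metis One_nat_def not0_implies_Suc)
  then show ?thesis
  proof cases
    case 1
    consider "j = 0" | "j = 1" | j' where "j = Suc (Suc j')" by (metis One_nat_def not0_implies_Suc)
    then show ?thesis using 1 by cases (simp_all add: algebra_simps)
  next
    case 2
    consider "j = 0" | "j = 1" | j' where "j = Suc (Suc j')" by (metis One_nat_def not0_implies_Suc)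
    then show ?thesis using 2 by cases (simp_all add: algebra_simps)
  next
    case 3
    consider "j = 0" | "j = 1" | j' where "j = Suc (Suc j')" by (metis One_nat_def not0_implies_Suc)
    then show ?thesis using 3 by cases (simp_all add: algebra_simps)
  qed
qed

text \<open>Sonin's function F equals y^2 at both ends and dominates y^2 between them. Its
  derivative has the sign of an affine function l wherever y' is nonzero, and l is nondecreasing
  because \<beta>, \<gamma> \<ge> -1/2; so F falls and then rises, and its maximum sits at an
  endpoint.\<close>

lemma jacobi_sum_bound:
  fixes a b \<beta> \<gamma> :: real
  assumes ab: "a < b" and bg: "-1/2 \<le> \<beta>" "-1/2 \<le> \<gamma>" and x: "x \<in> {a..b}"
  shows "\<bar>\<Sum>j\<le>n. jacobi_d \<beta> \<gamma> n j * (x - a) ^ (n - j) * (b - x) ^ j\<bar>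
     \<le> (b - a) ^ n * max (pochhammer (\<beta> + 1) n) (pochhammer (\<gamma> + 1) n)"
proof (cases "n = 0")
  case True
  then show ?thesis by (simp add: jacobi_d_def)
next
  case False
  define y where "y x = (\<Sum>j\<le>n. jacobi_d \<beta> \<gamma> n j * ((x - a) ^ (n - j) * (b - x) ^ j))" for x
  define y1 where "y1 x = (\<Sum>j\<le>n. jacobi_d \<beta> \<gamma> n j * (real (n - j) * (x - a) ^ (n - j - 1) * (b - x) ^ j
      - real j * (x - a) ^ (n - j) * (b - x) ^ (j - 1)))" for x
  define y2 where "y2 x = (\<Sum>j\<le>n. jacobi_d \<beta> \<gamma> n j * (real (n - j) * real (n - j - 1) * (x - a) ^ (n - j - 2) * (b - x) ^ j
      - 2 * real (n - j) * real j * (x - a) ^ (n - j - 1) * (b - x) ^ (j - 1)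
      + real j * real (j - 1) * (x - a) ^ (n - j) * (b - x) ^ (j - 2)))" for x
  have y': "(y has_field_derivative y1 x) (at x)" for x
    unfolding y_def[abs_def] y1_def
    by (intro DERIV_sum DERIV_cmult) (auto intro!: derivative_eq_intros simp: algebra_simps)
  have y1': "(y1 has_field_derivative y2 x) (at x)" for x
    unfolding y1_def[abs_def] y2_def
    by (intro DERIV_sum DERIV_cmult)
       (auto intro!: derivative_eq_intros simp: algebra_simps numeral_2_eq_2)
  \<comment> \<open>The eigenvalue of the equation. It vanishes for n = 0, which is why that case is
    separate: F divides by it.\<close>
  define N where "N = real n * (real n + \<beta> + \<gamma> + 1)"
  have N: "N > 0" using False bg by (auto simp: N_def intro!: mult_pos_pos)
  have ode: "(x - a) * (b - x) * y2 x + ((\<beta> + 1) * (b - x) - (\<gamma> + 1) * (x - a)) * y1 x + N * y x = 0" for x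
  proof -
    let ?d = "jacobi_d \<beta> \<gamma> n"
    let ?P = "\<lambda>j. (x - a) ^ (n - j) * (b - x) ^ j + (x - a) ^ Suc (n - j) * (b - x) ^ (j - 1)"
    let ?Q = "\<lambda>j. (x - a) ^ (n - j - 1) * (b - x) ^ Suc j + (x - a) ^ (n - j) * (b - x) ^ j"
    let ?Q' = "\<lambda>j. (x - a) ^ (n - Suc j) * (b - x) ^ Suc j + (x - a) ^ Suc (n - Suc j) * (b - x) ^ j"
    \<comment> \<open>The part of the j-th residual with the factor j(j+\<gamma>);
      \<open>jacobi_d_Suc\<close> identifies the other part with -G(j+1).\<close>
    define G where "G j = ?d j * (real j * (real j + \<gamma>))
        * ?P j" for j
    have "(x - a) * (b - x) * y2 x + ((\<beta> + 1) * (b - x) - (\<gamma> + 1) * (x - a)) * y1 x + N * y x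
      = (\<Sum>j\<le>n. ?d j * (real j * (real j + \<gamma>) * ?P j
         + real (n - j) * (real (n - j) + \<beta>) * ?Q j))"
      unfolding y_def y1_def y2_def sum_distrib_left sum.distrib[symmetric]
    proof (rule sum.cong)
      fix j assume "j \<in> {..n}"
      then have N': "N = real (n - j + j) * (real (n - j + j) + \<beta> + \<gamma> + 1)" by (simp add: N_def)
      show "(x - a) * (b - x) * (?d j * (real (n - j) * real (n - j - 1) * (x - a) ^ (n - j - 2) * (b - x) ^ j
            - 2 * real (n - j) * real j * (x - a) ^ (n - j - 1) * (b - x) ^ (j - 1)
            + real j * real (j - 1) * (x - a) ^ (n - j) * (b - x) ^ (j - 2)))
         + ((\<beta> + 1) * (b - x) - (\<gamma> + 1) * (x - a)) * (?d j * (real (n - j) * (x - a) ^ (n - j - 1) * (b - x) ^ j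
            - real j * (x - a) ^ (n - j) * (b - x) ^ (j - 1)))
         + N * (?d j * ((x - a) ^ (n - j) * (b - x) ^ j))
         = ?d j * (real j * (real j + \<gamma>) * ?P j
         + real (n - j) * (real (n - j) + \<beta>) * ?Q j)"
        unfolding jacobi_residual_term[symmetric] N' by (simp only: distrib_left mult_ac)
    qed simp
    also have "\<dots> = (\<Sum>j\<le>n. G j - G (Suc j))"
    proof (rule sum.cong)
      fix j assume j: "j \<in> {..n}"
      have ring: "d * (q * V + r * W) = d * q * V - (- (d * r)) * W" for d q V r W :: real
        by (simp add: algebra_simps)
      have "?Q j
         = (x - a) ^ (n - Suc j) * (b - x) ^ Suc j + (x - a) ^ Suc (n - Suc j) * (b - x) ^ j" if "j \<noteq> n"
        using that j by (simp add: Suc_diff_Suc)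
      then have T: "real (n - j) * (real (n - j) + \<beta>) * ?Q j
         = real (n - j) * (real (n - j) + \<beta>) * ?Q' j"
        by (cases "j = n") auto
      have Gs: "G (Suc j) = - (?d j * (real (n - j) * (real (n - j) + \<beta>)))
          * ?Q' j"
        unfolding G_def using jacobi_d_Suc[of j n \<beta> \<gamma>] j by simp
      show "?d j * (real j * (real j + \<gamma>) * ?P j
         + real (n - j) * (real (n - j) + \<beta>) * ?Q j)
         = G j - G (Suc j)"
        unfolding T Gs G_def[of j] by (rule ring)
    qed simp
    also have "\<dots> = G 0 - G (Suc n)" by (rule sum_telescope)
    \<comment> \<open>G 0 contains the factor j = 0 and G (n+1) the binomial coefficient n over n+1,
      so both ends vanish.\<close>
    also have "\<dots> = 0" by (simp add: G_def jacobi_d_def)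
    finally show ?thesis .
  qed
  define F where "F x = (y x)\<^sup>2 + (x - a) * (b - x) * (y1 x)\<^sup>2 / N" for x
  define l where "l x = (2 * \<gamma> + 1) * (x - a) - (2 * \<beta> + 1) * (b - x)" for x
  have F': "(F has_field_derivative (y1 x)\<^sup>2 / N * l x) (at x)" for x
  proof -
    have "(F has_field_derivative 2 * y x * y1 x
       + ((b - x) * (y1 x)\<^sup>2 - (x - a) * (y1 x)\<^sup>2 + (x - a) * (b - x) * (2 * y1 x * y2 x)) / N) (at x)"
      unfolding F_def[abs_def] using N
      by (auto intro!: derivative_eq_intros y' y1' simp: field_simps)
    also have "2 * y x * y1 x + ((b - x) * (y1 x)\<^sup>2 - (x - a) * (y1 x)\<^sup>2 + (x - a) * (b - x) * (2 * y1 x * y2 x)) / N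
       = (2 * y1 x * ((x - a) * (b - x) * y2 x + N * y x) + ((b - x) - (x - a)) * (y1 x)\<^sup>2) / N"
      using N by (simp add: field_simps)
    \<comment> \<open>The equation eliminates y'' together with y, leaving y'^2 times an affine
      function.\<close>
    also have "(x - a) * (b - x) * y2 x + N * y x = - ((\<beta> + 1) * (b - x) - (\<gamma> + 1) * (x - a)) * y1 x"
      using ode[of x] by (simp add: algebra_simps)
    also have "(2 * y1 x * (- ((\<beta> + 1) * (b - x) - (\<gamma> + 1) * (x - a)) * y1 x) + ((b - x) - (x - a)) * (y1 x)\<^sup>2) / N
       = (y1 x)\<^sup>2 / N * l x"
      unfolding times_divide_eq_left
      by (rule arg_cong[where f = "\<lambda>z. z / N"]) (simp add: l_def power2_eq_square algebra_simps)
    finally show ?thesis .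
  qed
  have lmono: "l u \<le> l v" if "u \<le> v" for u v
    unfolding l_def using bg that by (intro diff_mono mult_left_mono) auto
  have "(y x)\<^sup>2 \<le> F x" using x N by (simp add: F_def)
  also have "F x \<le> max ((y a)\<^sup>2) ((y b)\<^sup>2)"
  \<comment> \<open>Where l is nonpositive, F has been nonincreasing since a; otherwise it is
    nondecreasing from there to b.\<close>
  proof (cases "l x \<le> 0")
    case True
    have "F x \<le> F a"
    proof (rule DERIV_nonpos_imp_nonincreasing[of a x F])
      fix u assume "a \<le> u" "u \<le> x"
      then have "(y1 u)\<^sup>2 / N * l u \<le> 0" using True lmono[of u x] N by (intro mult_nonneg_nonpos) auto
      then show "\<exists>y. DERIV F u :> y \<and> y \<le> 0" using F' by blast
    qed (use x in auto)
    then show ?thesis by (simp add: F_def)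
  next
    case False
    have "F x \<le> F b"
    proof (rule DERIV_nonneg_imp_nondecreasing[of x b F])
      fix u assume "x \<le> u" "u \<le> b"
      then have "(y1 u)\<^sup>2 / N * l u \<ge> 0" using False lmono[of x u] N by (intro mult_nonneg_nonneg) auto
      then show "\<exists>y. DERIV F u :> y \<and> 0 \<le> y" using F' by blast
    qed (use x in auto)
    then show ?thesis by (simp add: F_def)
  qed
  also have "y a = (b - a) ^ n * pochhammer (\<beta> + 1) n"
  proof -
    have "y a = (\<Sum>j\<le>n. if j = n then jacobi_d \<beta> \<gamma> n n * (b - a) ^ n else 0)"
      unfolding y_def by (intro sum.cong) (auto simp: power_0_left)
    then show ?thesis by (simp add: jacobi_d_n mult.commute)
  qed
  also have "y b = (-1) ^ n * ((b - a) ^ n * pochhammer (\<gamma> + 1) n)"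
  proof -
    have "y b = (\<Sum>j\<le>n. if j = 0 then jacobi_d \<beta> \<gamma> n 0 * (b - a) ^ n else 0)"
      unfolding y_def by (intro sum.cong) (auto simp: power_0_left)
    then show ?thesis by (simp add: jacobi_d_0 mult_ac)
  qed
  also have "((-1) ^ n * ((b - a) ^ n * pochhammer (\<gamma> + 1) n))\<^sup>2 = ((b - a) ^ n * pochhammer (\<gamma> + 1) n)\<^sup>2"
    by (simp add: power_mult_distrib power_mult[symmetric])
  also have "max (((b - a) ^ n * pochhammer (\<beta> + 1) n)\<^sup>2) (((b - a) ^ n * pochhammer (\<gamma> + 1) n)\<^sup>2)
     \<le> ((b - a) ^ n * max (pochhammer (\<beta> + 1) n) (pochhammer (\<gamma> + 1) n))\<^sup>2"
    using ab bg by (intro max.boundedI power_mono mult_left_mono mult_nonneg_nonneg pochhammer_nonneg) auto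
  finally have "\<bar>y x\<bar> \<le> (b - a) ^ n * max (pochhammer (\<beta> + 1) n) (pochhammer (\<gamma> + 1) n)"
    by (rule abs_le_square_iff[THEN iffD2, THEN order_trans])
       (use ab bg in \<open>auto simp: abs_mult pochhammer_nonneg le_max_iff_disj abs_of_nonneg\<close>)
  then show ?thesis by (simp add: y_def mult.assoc)
qed

section \<open>Orthonormality and completeness\<close>

text \<open>Gauss's limit formula in place of Stirling's: the quotient S of the approximant by
  \<open>Gamma x\<close> is positive and tends to 1, so S and 1/S are bounded, and S yields the
  wanted ratio up to a rational factor trapped between positive constants.\<close>

lemma Gamma_fact_powr_bounds:
  fixes x :: real
  assumes x: "x > 0"
  obtains c C where "c > 0" "C > 0"
    "\<And>n. c * (fact n * (real n + 1) powr (x - 1)) \<le> Gamma (real n + x)"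
    "\<And>n. Gamma (real n + x) \<le> C * (fact n * (real n + 1) powr (x - 1))"
proof -
  \<comment> \<open>The index n + 1 of the approximant produces the base n + 1, so the estimates
    hold from n = 0 on.\<close>
  define S where "S n = Gamma_series x (Suc n) / Gamma x" for n
  have Gx: "Gamma x > 0" using x by (rule Gamma_real_pos)
  have S_lim: "S \<longlonglongrightarrow> 1"
    using tendsto_divide[OF LIMSEQ_Suc[OF Gamma_series_LIMSEQ[of x]] tendsto_const[of "Gamma x"]] Gx
    unfolding S_def by simp
  have S_eq: "S n = fact n * (real n + 1) powr (x - 1) * (real n + 1)\<^sup>2
      / ((x + real n + 1) * (x + real n) * Gamma (real n + x))" for n
  proof -
    have nz: "x \<notin> \<int>\<^sub>\<le>\<^sub>0" "x + real n \<notin> \<int>\<^sub>\<le>\<^sub>0" using x by (auto elim!: nonpos_Ints_cases)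
    have "pochhammer x (Suc n + 1) = pochhammer x n * (x + real n) * (x + real n + 1)"
      by (simp add: pochhammer_Suc algebra_simps)
    also have "pochhammer x n = Gamma (real n + x) / Gamma x"
      by (simp add: pochhammer_Gamma[OF nz(1)] add.commute)
    finally have "S n = fact (Suc n) * exp (x * ln (real (Suc n))) / (Gamma (real n + x) * (x + real n) * (x + real n + 1))"
      using Gx by (simp add: S_def Gamma_series_def field_simps)
    moreover have "exp (x * ln (real (Suc n))) = (real n + 1) powr (x - 1) * (real n + 1)"
    proof -
      have "(real n + 1) powr (x - 1) * (real n + 1) = (real n + 1) powr (x - 1) * (real n + 1) powr 1"
        by simp
      also have "\<dots> = (real n + 1) powr x" by (subst powr_add[symmetric]) simp
      finally show ?thesis by (simp add: powr_def add.commute)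
    qed
    ultimately show ?thesis by (simp add: power2_eq_square mult_ac)
  qed
  have Gn: "Gamma (real n + x) > 0" for n using x by (intro Gamma_real_pos) auto
  have S_pos: "S n > 0" for n unfolding S_eq using x Gn by (intro divide_pos_pos mult_pos_pos) auto
  obtain K where K0: "K > 0" "\<forall>n. norm (S n) \<le> K"
    by (rule BseqE[OF convergent_imp_Bseq[OF convergentI[OF S_lim]]])
  have K: "K > 0" "S n \<le> K" for n using K0 abs_le_D1 by auto
  have "(\<lambda>n. inverse (S n)) \<longlonglongrightarrow> inverse 1" by (intro tendsto_inverse S_lim) simp
  then obtain K' where K0': "K' > 0" "\<forall>n. norm (inverse (S n)) \<le> K'"
    by (rule BseqE[OF convergent_imp_Bseq[OF convergentI]])
  have K': "K' > 0" "inverse (S n) \<le> K'" for n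
    using K0'(1) spec[OF K0'(2), of n] S_pos[of n] by simp_all
  \<comment> \<open>Ensures m (n+1) \<le> x + n for all n, also for small x at n = 0.\<close>
  define m where "m = min x 1"
  have m: "m > 0" "m \<le> 1" "m \<le> x" using x by (auto simp: m_def)
  have G_eq: "Gamma (real n + x) = inverse (S n) * (fact n * (real n + 1) powr (x - 1))
      * ((real n + 1)\<^sup>2 / ((x + real n + 1) * (x + real n)))" for n
  proof -
    have "G = inverse (f * N / (A * B * G)) * f * (N / (A * B))"
      if "f > 0" "N > 0" "A > 0" "B > 0" "G > 0" for f N A B G :: real
      using that by simp
    then show ?thesis unfolding S_eq using Gn[of n] x by simp
  qed
  have lo: "(real n + 1)\<^sup>2 / ((x + real n + 1) * (x + real n)) \<ge> 1 / (x + 1)\<^sup>2" for n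
  proof -
    have "(x + real n + 1) * (x + real n) \<le> ((x + 1) * (real n + 1)) * ((x + 1) * (real n + 1))"
      using x by (intro mult_mono) (auto simp: algebra_simps)
    also have "\<dots> = (real n + 1)\<^sup>2 * (x + 1)\<^sup>2" by (simp add: power2_eq_square mult_ac)
    finally show ?thesis using x by (simp add: divide_simps mult_ac)
  qed
  have hi: "(real n + 1)\<^sup>2 / ((x + real n + 1) * (x + real n)) \<le> 1 / m" for n
  proof -
    have "m * (real n + 1) \<le> x + real n"
      using m mult_right_mono[of m 1 "real n"] by (simp add: algebra_simps)
    then have "(real n + 1) * (m * (real n + 1)) \<le> (x + real n + 1) * (x + real n)"
      using x m by (intro mult_mono) auto
    then show ?thesis using x m by (simp add: divide_simps power2_eq_square mult_ac)
  qed
  show ?thesis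
  proof (rule that[of "1 / K * (1 / (x + 1)\<^sup>2)" "K' * (1 / m)"])
    fix n
    have "1 / K \<le> inverse (S n)" using K S_pos[of n] by (simp add: field_simps)
    then have "1 / K * (1 / (x + 1)\<^sup>2) \<le> inverse (S n) * ((real n + 1)\<^sup>2 / ((x + real n + 1) * (x + real n)))"
      using K S_pos[of n] by (intro mult_mono lo) auto
    from mult_right_mono[OF this, of "fact n * (real n + 1) powr (x - 1)"]
    show "1 / K * (1 / (x + 1)\<^sup>2) * (fact n * (real n + 1) powr (x - 1)) \<le> Gamma (real n + x)"
      unfolding G_eq by (simp only: mult_ac) simp
    have "inverse (S n) * ((real n + 1)\<^sup>2 / ((x + real n + 1) * (x + real n))) \<le> K' * (1 / m)"
      using K' S_pos[of n] x by (intro mult_mono hi) auto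
    from mult_right_mono[OF this, of "fact n * (real n + 1) powr (x - 1)"]
    show "Gamma (real n + x) \<le> K' * (1 / m) * (fact n * (real n + 1) powr (x - 1))"
      unfolding G_eq by (simp only: mult_ac) simp
  qed (use K K' m x in auto)
qed

text \<open>The weight goes into the measure and the space is the open interval, which is where
  Rodrigues' formula is a polynomial; general facts on finite measures then apply directly.\<close>

definition jacobi_measure :: "real \<Rightarrow> real \<Rightarrow> real \<Rightarrow> real \<Rightarrow> real measure" where
  "jacobi_measure a b \<beta> \<gamma> = density (lebesgue_on {a<..<b}) (\<lambda>x. ennreal (jacobi_weight a b \<beta> \<gamma> x))"

locale jacobi =
  fixes a b \<beta> \<gamma> :: real
  assumes ab: "a < b"
    and beta: "-1/2 \<le> \<beta>" "\<beta> \<le> 1/2"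
    and gamma: "-1/2 \<le> \<gamma>" "\<gamma> \<le> 1/2"
begin

abbreviation "J \<equiv> jacobi_measure a b \<beta> \<gamma>"
abbreviation "w \<equiv> jacobi_weight a b \<beta> \<gamma>"
abbreviation "p \<equiv> jacobi_p a b \<beta> \<gamma>"
abbreviation "\<delta> \<equiv> jacobi_delta a b \<beta> \<gamma>"
abbreviation "\<delta>' \<equiv> jacobi_delta' \<beta> \<gamma>"
abbreviation "A \<equiv> jacobi_a (b - a) \<beta> \<gamma>"

section \<open>The weighted measure and its Beta integrals\<close>

lemma weight_pos: "x \<in> {a<..<b} \<Longrightarrow> w x > 0"
  by (simp add: jacobi_weight_def)

lemma weight_measurable [measurable]: "w \<in> borel_measurable (lebesgue_on {a<..<b})"
proof -
  have "w \<in> borel_measurable borel" unfolding jacobi_weight_def by measurable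
  then have "w \<in> borel_measurable lebesgue" by (intro measurable_completion) simp
  then show ?thesis by (rule measurable_restrict_space1)
qed

lemma space_J [simp]: "space J = {a<..<b}"
  by (simp add: jacobi_measure_def space_restrict_space)

lemma measurable_J: "borel_measurable J = borel_measurable (lebesgue_on {a<..<b})"
  unfolding jacobi_measure_def by (intro measurable_cong_sets) auto

lemma measurable_J_iff: "f \<in> borel_measurable J \<longleftrightarrow> set_borel_measurable lebesgue {a<..<b} f"
  for f :: "real \<Rightarrow> real"
  unfolding measurable_J set_borel_measurable_def
  by (subst borel_measurable_restrict_space_iff) (auto simp: mult.commute)

lemma borel_measurable_J: "f \<in> borel_measurable borel \<Longrightarrow> f \<in> borel_measurable J"
  for f :: "real \<Rightarrow> real"
  unfolding measurable_J by (intro measurable_restrict_space1 measurable_completion) simp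

lemma integrable_J_iff:
  fixes f :: "real \<Rightarrow> real"
  assumes "f \<in> borel_measurable J"
  shows "integrable J f \<longleftrightarrow> set_integrable lebesgue {a<..<b} (\<lambda>x. f x * w x)"
proof -
  have "AE x in lebesgue_on {a<..<b}. 0 \<le> w x"
    using weight_pos by (intro AE_I2) (auto simp: space_restrict_space less_imp_le)
  then show ?thesis
    using assms unfolding jacobi_measure_def
    by (subst integrable_density)
       (auto simp: integrable_restrict_space set_integrable_def mult.commute)
qed

lemma integral_J_eq:
  fixes f :: "real \<Rightarrow> real"
  assumes "f \<in> borel_measurable J"
  shows "(LINT x|J. f x) = (LINT x:{a<..<b}|lebesgue. f x * w x)"
proof -
  have "AE x in lebesgue_on {a<..<b}. 0 \<le> w x"
    using weight_pos by (intro AE_I2) (auto simp: space_restrict_space less_imp_le)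
  then show ?thesis
    using assms unfolding jacobi_measure_def
    by (subst integral_density)
       (auto simp: integral_restrict_space set_lebesgue_integral_def mult.commute)
qed

lemma AE_J_iff: "(AE x in J. P x) \<longleftrightarrow> (AE x\<in>{a<..<b} in lebesgue. P x)"
proof -
  have "(AE x in J. P x) \<longleftrightarrow> (AE x in lebesgue_on {a<..<b}. 0 < ennreal (w x) \<longrightarrow> P x)"
    unfolding jacobi_measure_def by (rule AE_density) measurable
  also have "\<dots> \<longleftrightarrow> (AE x in lebesgue_on {a<..<b}. P x)"
    using weight_pos by (intro AE_cong) (auto simp: space_restrict_space)
  also have "\<dots> \<longleftrightarrow> (AE x\<in>{a<..<b} in lebesgue. P x)"
    by (rule AE_restrict_space_iff) auto
  finally show ?thesis .
qed

lemma powr_product_integral: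
  assumes "\<beta> + u > -1" "\<gamma> + v > -1"
  shows "integrable J (\<lambda>x. (x - a) powr u * (b - x) powr v)"
    and "(LINT x|J. (x - a) powr u * (b - x) powr v)
      = (b - a) powr (\<beta> + \<gamma> + u + v + 1) * Beta (\<beta> + u + 1) (\<gamma> + v + 1)"
proof -
  have m: "(\<lambda>x. (x - a) powr u * (b - x) powr v) \<in> borel_measurable J"
    by (rule borel_measurable_J) measurable
  have eq: "(x - a) powr u * (b - x) powr v * w x = (x - a) powr (\<beta> + u + 1 - 1) * (b - x) powr (\<gamma> + v + 1 - 1)" for x
    by (simp add: jacobi_weight_def powr_add)
  note B = Beta_interval_integral[OF ab, of "\<beta> + u + 1" "\<gamma> + v + 1"]
  show "integrable J (\<lambda>x. (x - a) powr u * (b - x) powr v)"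
    unfolding integrable_J_iff[OF m] eq by (rule B) (use assms in auto)
  show "(LINT x|J. (x - a) powr u * (b - x) powr v)
      = (b - a) powr (\<beta> + \<gamma> + u + v + 1) * Beta (\<beta> + u + 1) (\<gamma> + v + 1)"
    unfolding integral_J_eq[OF m] eq using assms by (subst B) (auto simp: algebra_simps)
qed

lemma finite_measure_J: "finite_measure J"
proof
  have "integrable J (\<lambda>x. (x - a) powr 0 * (b - x) powr 0)"
    using beta gamma by (intro powr_product_integral) auto
  also have "?this \<longleftrightarrow> integrable J (\<lambda>x. 1 :: real)"
    by (intro Bochner_Integration.integrable_cong) auto
  finally show "emeasure J (space J) \<noteq> \<infinity>"
    using integrable_iff_bounded[of J "\<lambda>x. 1::real"] by auto
qed

sublocale finite_measure J by (rule finite_measure_J)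

lemma p_eq_sum_a:
  assumes "x \<in> {a<..<b}"
  shows "p n x = \<delta> n * (\<Sum>k\<le>n. A n k * (b - x) ^ k)"
  unfolding jacobi_p_eq_sum[OF assms] jacobi_sum_eq_a[symmetric] by simp

lemma p_measurable [measurable]: "p n \<in> borel_measurable J"
proof -
  have "(\<lambda>x. \<delta> n * (\<Sum>k\<le>n. A n k * (b - x) ^ k)) \<in> borel_measurable J"
    by (rule borel_measurable_J) measurable
  also have "?this \<longleftrightarrow> ?thesis" by (intro measurable_cong) (auto simp: p_eq_sum_a)
  finally show ?thesis .
qed

text \<open>Each element of the homogeneous basis gives a Beta value. The two arguments have the
  same sum for all j, so the denominators agree, and one Gamma factor cancels against
  \<open>jacobi_d\<close>; Vandermonde's convolution sums the rest to (\<rho>+1-n)_n = (-1)^n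
  (-\<rho>)_n. A natural \<rho> < n gives 0, hence orthogonality; \<rho> = k + \<alpha> gives the
  coefficients of q_n.\<close>

lemma integral_powr_p:
  assumes "\<gamma> + \<rho> > -1"
  shows "integrable J (\<lambda>x. (b - x) powr \<rho> * p n x)"
    and "(LINT x|J. (b - x) powr \<rho> * p n x) = \<delta> n * (b - a) powr (\<beta> + \<gamma> + \<rho> + real n + 1) * ((-1) ^ n
       * pochhammer (- \<rho>) n * Beta (\<beta> + real n + 1) (\<gamma> + \<rho> + 1))"
proof -
  let ?t = "\<lambda>j x. \<delta> n * jacobi_d \<beta> \<gamma> n j * ((x - a) powr real (n - j) * (b - x) powr (\<rho> + real j))"
  have eq: "(b - x) powr \<rho> * p n x = (\<Sum>j\<le>n. ?t j x)" if "x \<in> space J" for x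
  proof -
    have "(x - a) ^ (n - j) = (x - a) powr real (n - j)" "(b - x) ^ j = (b - x) powr real j" for j
      using that by (auto simp: powr_realpow)
    then show ?thesis using that
      by (simp add: jacobi_p_eq_sum sum_distrib_left powr_add mult_ac)
  qed
  have i: "integrable J (?t j)" for j
    using beta assms by (intro integrable_mult_right powr_product_integral) auto
  have "integrable J (\<lambda>x. \<Sum>j\<le>n. ?t j x)" by (intro Bochner_Integration.integrable_sum i)
  then show "integrable J (\<lambda>x. (b - x) powr \<rho> * p n x)"
    using eq by (subst Bochner_Integration.integrable_cong[OF refl]) auto
  define Z where "Z = \<beta> + \<gamma> + \<rho> + real n + 2"
  have "(LINT x|J. (b - x) powr \<rho> * p n x) = (LINT x|J. (\<Sum>j\<le>n. ?t j x))"
    using eq by (intro Bochner_Integration.integral_cong) auto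
  also have "\<dots> = (\<Sum>j\<le>n. \<integral>x. ?t j x \<partial>J)"
    by (intro Bochner_Integration.integral_sum i)
  also have "\<dots> = (\<Sum>j\<le>n. \<delta> n * (b - a) powr (\<beta> + \<gamma> + \<rho> + real n + 1) * (Gamma (\<beta> + real n + 1) * Gamma (\<gamma> + \<rho> + 1) / Gamma Z)
      * (real (n choose j) * pochhammer (\<gamma> + \<rho> + 1) j * pochhammer (- (\<gamma> + real n)) (n - j)))"
  proof (rule sum.cong)
    fix j assume "j \<in> {..n}"
    then have j: "real (n - j) = real n - real j" "j \<le> n" by auto
    have "(LINT x|J. ?t j x) = \<delta> n * jacobi_d \<beta> \<gamma> n j * ((b - a) powr (\<beta> + \<gamma> + \<rho> + real n + 1)
        * Beta (\<beta> + real (n - j) + 1) (\<gamma> + (\<rho> + real j) + 1))"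
      using beta assms j by (subst Bochner_Integration.integral_mult_right_zero, subst powr_product_integral)
        (auto simp: algebra_simps)
    moreover have "Beta (\<beta> + real (n - j) + 1) (\<gamma> + (\<rho> + real j) + 1)
       = Gamma (\<beta> + real (n - j) + 1) * Gamma (\<gamma> + \<rho> + 1 + real j) / Gamma Z"
      by (simp add: Beta_def Z_def j algebra_simps)
    moreover have "Gamma (\<gamma> + \<rho> + 1 + real j) = pochhammer (\<gamma> + \<rho> + 1) j * Gamma (\<gamma> + \<rho> + 1)"
    proof -
      have "\<gamma> + \<rho> + 1 \<notin> \<int>\<^sub>\<le>\<^sub>0" using assms by (auto elim!: nonpos_Ints_cases)
      moreover have "Gamma (\<gamma> + \<rho> + 1) > 0" using assms by (intro Gamma_real_pos) auto
      ultimately show ?thesis by (subst pochhammer_Gamma) auto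
    qed
    moreover have "jacobi_d \<beta> \<gamma> n j = real (n choose j) * (((-1) ^ j * pochhammer (- (\<beta> + real n)) j)
          * pochhammer (- (\<gamma> + real n)) (n - j))" by (simp add: jacobi_d_def mult_ac)
    moreover have "(-1) ^ j * pochhammer (- (\<beta> + real n)) j = pochhammer (\<beta> + real (n - j) + 1) j"
      by (subst pochhammer_minus) (simp add: mult.assoc[symmetric] power_mult_distrib[symmetric] j algebra_simps)
    moreover have "pochhammer (\<beta> + real (n - j) + 1) j = Gamma (\<beta> + real n + 1) / Gamma (\<beta> + real (n - j) + 1)"
    proof -
      have "\<beta> + real (n - j) + 1 \<notin> \<int>\<^sub>\<le>\<^sub>0" using beta by (auto elim!: nonpos_Ints_cases)
      then show ?thesis by (subst pochhammer_Gamma) (auto simp: j algebra_simps)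
    qed
    ultimately have *: "(LINT x|J. ?t j x) = \<delta> n * (real (n choose j) * (Gamma (\<beta> + real n + 1) / Gamma (\<beta> + real (n - j) + 1)
          * pochhammer (- (\<gamma> + real n)) (n - j)))
       * ((b - a) powr (\<beta> + \<gamma> + \<rho> + real n + 1) * (Gamma (\<beta> + real (n - j) + 1)
          * (pochhammer (\<gamma> + \<rho> + 1) j * Gamma (\<gamma> + \<rho> + 1)) / Gamma Z))"
      by (simp only:)
    have "Gamma (\<beta> + real (n - j) + 1) > 0" using beta by (intro Gamma_real_pos) auto
    then show "(LINT x|J. ?t j x) = \<delta> n * (b - a) powr (\<beta> + \<gamma> + \<rho> + real n + 1) * (Gamma (\<beta> + real n + 1) * Gamma (\<gamma> + \<rho> + 1) / Gamma Z)
      * (real (n choose j) * pochhammer (\<gamma> + \<rho> + 1) j * pochhammer (- (\<gamma> + real n)) (n - j))"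
      unfolding * by (simp add: mult_ac)
  qed simp
  also have "\<dots> = \<delta> n * (b - a) powr (\<beta> + \<gamma> + \<rho> + real n + 1) * (Gamma (\<beta> + real n + 1) * Gamma (\<gamma> + \<rho> + 1) / Gamma Z)
      * pochhammer (\<gamma> + \<rho> + 1 + - (\<gamma> + real n)) n"
    by (simp only: sum_distrib_left[symmetric] pochhammer_binomial_sum)
  also have "pochhammer (\<gamma> + \<rho> + 1 + - (\<gamma> + real n)) n = (-1) ^ n * pochhammer (- \<rho>) n"
    using pochhammer_minus'[of \<rho> n] by (simp add: algebra_simps)
  also have "Gamma (\<beta> + real n + 1) * Gamma (\<gamma> + \<rho> + 1) / Gamma Z = Beta (\<beta> + real n + 1) (\<gamma> + \<rho> + 1)"
    by (simp add: Beta_def Z_def algebra_simps)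
  finally show "(LINT x|J. (b - x) powr \<rho> * p n x) = \<delta> n * (b - a) powr (\<beta> + \<gamma> + \<rho> + real n + 1) * ((-1) ^ n
       * pochhammer (- \<rho>) n * Beta (\<beta> + real n + 1) (\<gamma> + \<rho> + 1))"
    by (simp only: mult_ac)
qed

text \<open>The first identity is the normalisation of p_n, with the Pochhammer symbol as leading
  coefficient. The bound is written with Gamma(\<beta>+\<gamma>+n+2), which stays regular when
  \<beta>+\<gamma>+n+1 = 0.\<close>

lemma delta'_square:
  "(\<delta>' n)\<^sup>2 * (fact n * Gamma (\<beta> + real n + 1) * Gamma (\<gamma> + real n + 1) * pochhammer (\<beta> + \<gamma> + real n + 1) n)
     = Gamma (\<beta> + \<gamma> + 2 * real n + 2)"
  and delta'_pos: "\<delta>' n > 0"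
  and delta'_square_le: "(\<delta>' n)\<^sup>2 \<le> 2 * Gamma (\<beta> + \<gamma> + real n + 2)
     / (fact n * Gamma (\<beta> + real n + 1) * Gamma (\<gamma> + real n + 1))"
proof -
  have G: "Gamma (\<beta> + real n + 1) > 0" "Gamma (\<gamma> + real n + 1) > 0"
    using beta gamma by (auto intro!: Gamma_real_pos)
  \<comment> \<open>The exceptional value occurs only for \<beta> = \<gamma> = -1/2 and n =
    0.\<close>
  consider "n = 0" "\<beta> + \<gamma> + 1 = 0" | "\<beta> + \<gamma> + real n + 1 > 0" "\<not> (n = 0 \<and> \<beta> + \<gamma> + 1 = 0)"
    using beta gamma by force
  then have "(\<delta>' n)\<^sup>2 * (fact n * Gamma (\<beta> + real n + 1) * Gamma (\<gamma> + real n + 1) * pochhammer (\<beta> + \<gamma> + real n + 1) n)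
       = Gamma (\<beta> + \<gamma> + 2 * real n + 2) \<and> \<delta>' n > 0 \<and>
     (\<delta>' n)\<^sup>2 \<le> 2 * Gamma (\<beta> + \<gamma> + real n + 2)
       / (fact n * Gamma (\<beta> + real n + 1) * Gamma (\<gamma> + real n + 1))"
  proof cases
    case 1
    then have d: "\<delta>' n = 1 / sqrt (Gamma (\<beta> + 1) * Gamma (\<gamma> + 1))" by (simp add: jacobi_delta'_def)
    have e: "\<beta> + \<gamma> + 2 = 1" using 1 by simp
    have G0: "Gamma (\<beta> + 1) * Gamma (\<gamma> + 1) > 0" using G 1 by simp
    then have d2: "(\<delta>' n)\<^sup>2 = 1 / (Gamma (\<beta> + 1) * Gamma (\<gamma> + 1))"
      by (simp add: d power_divide)
    have "\<delta>' n > 0" using G0 by (simp add: d)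
    then show ?thesis using 1 G unfolding d2 by (simp add: e divide_simps)
  next
    case 2
    let ?s = "\<beta> + \<gamma> + real n + 1"
    have Gs: "Gamma ?s > 0" using 2 by (intro Gamma_real_pos)
    have nz: "?s \<notin> \<int>\<^sub>\<le>\<^sub>0" using 2 by (auto elim!: nonpos_Ints_cases)
    have pos: "(\<beta> + \<gamma> + 2 * real n + 1) * Gamma ?s / (fact n * Gamma (\<beta> + real n + 1) * Gamma (\<gamma> + real n + 1)) > 0"
      using G Gs 2 by (intro divide_pos_pos mult_pos_pos) auto
    have d: "\<delta>' n = sqrt ((\<beta> + \<gamma> + 2 * real n + 1) * Gamma ?s / (fact n * Gamma (\<beta> + real n + 1) * Gamma (\<gamma> + real n + 1)))"
      using 2 unfolding jacobi_delta'_def by (subst if_not_P) (auto simp: algebra_simps)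
    have d2: "(\<delta>' n)\<^sup>2 = (\<beta> + \<gamma> + 2 * real n + 1) * Gamma ?s / (fact n * Gamma (\<beta> + real n + 1) * Gamma (\<gamma> + real n + 1))"
      unfolding d using pos by simp
    have "pochhammer ?s n = Gamma (\<beta> + \<gamma> + 2 * real n + 1) / Gamma ?s"
      using pochhammer_Gamma[OF nz, of n] by (simp add: algebra_simps)
    moreover have "Gamma (\<beta> + \<gamma> + 2 * real n + 1 + 1) = (\<beta> + \<gamma> + 2 * real n + 1) * Gamma (\<beta> + \<gamma> + 2 * real n + 1)"
      using 2 by (intro Gamma_plus1) (auto elim!: nonpos_Ints_cases)
    moreover have "Gamma (?s + 1) = ?s * Gamma ?s"
      using nz by (intro Gamma_plus1)
    moreover have "(\<beta> + \<gamma> + 2 * real n + 1) * Gamma ?s \<le> 2 * (?s * Gamma ?s)"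
    proof -
      have "\<beta> + \<gamma> + 2 * real n + 1 \<le> 2 * ?s" using beta gamma by simp
      from mult_right_mono[OF this, of "Gamma ?s"] Gs show ?thesis by simp
    qed
    then have "(\<delta>' n)\<^sup>2 \<le> 2 * (?s * Gamma ?s) / (fact n * Gamma (\<beta> + real n + 1) * Gamma (\<gamma> + real n + 1))"
      unfolding d2 using G by (intro divide_right_mono) auto
    moreover have "\<delta>' n > 0" unfolding d using pos by (simp only: real_sqrt_gt_zero)
    ultimately show ?thesis using G Gs unfolding d2 by (simp add: add.assoc)
  qed
  then show "(\<delta>' n)\<^sup>2 * (fact n * Gamma (\<beta> + real n + 1) * Gamma (\<gamma> + real n + 1) * pochhammer (\<beta> + \<gamma> + real n + 1) n)
       = Gamma (\<beta> + \<gamma> + 2 * real n + 2)" "\<delta>' n > 0"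
     "(\<delta>' n)\<^sup>2 \<le> 2 * Gamma (\<beta> + \<gamma> + real n + 2)
       / (fact n * Gamma (\<beta> + real n + 1) * Gamma (\<gamma> + real n + 1))" by auto
qed

lemma delta_neq_0: "\<delta> n \<noteq> 0"
  using delta'_pos[of n] ab by (simp add: jacobi_delta_def)

lemma abs_delta: "\<bar>\<delta> n\<bar> = (b - a) powr (- real n - (\<beta> + \<gamma> + 1) / 2) * \<delta>' n"
  using delta'_pos[of n] by (simp add: jacobi_delta_def abs_mult)

lemma A_lead_pos: "A n n > 0"
proof (cases "n = 0")
  case False
  then show ?thesis unfolding jacobi_a_lead using beta gamma by (intro pochhammer_pos) auto
qed (simp add: jacobi_a_lead)

lemma integral_power_p:
  shows "(LINT x|J. (b - x) ^ k * p n x) = \<delta> n * (b - a) powr (\<beta> + \<gamma> + real k + real n + 1) * ((-1) ^ n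
       * pochhammer (- real k) n * Beta (\<beta> + real n + 1) (\<gamma> + real k + 1))"
    and integrable_power_p: "integrable J (\<lambda>x. (b - x) ^ k * p n x)"
proof -
  have g: "\<gamma> + real k > -1" using gamma by auto
  have eq: "(b - x) ^ k * p n x = (b - x) powr real k * p n x" if "x \<in> space J" for x
    using that by (simp add: powr_realpow)
  show "(LINT x|J. (b - x) ^ k * p n x) = \<delta> n * (b - a) powr (\<beta> + \<gamma> + real k + real n + 1) * ((-1) ^ n
       * pochhammer (- real k) n * Beta (\<beta> + real n + 1) (\<gamma> + real k + 1))"
  proof -
    have "(LINT x|J. (b - x) ^ k * p n x) = (LINT x|J. (b - x) powr real k * p n x)"
      by (intro Bochner_Integration.integral_cong refl eq)
    then show ?thesis using integral_powr_p(2)[OF g, of n] by simp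
  qed
  show "integrable J (\<lambda>x. (b - x) ^ k * p n x)"
  proof -
    have "integrable J (\<lambda>x. (b - x) ^ k * p n x) \<longleftrightarrow> integrable J (\<lambda>x. (b - x) powr real k * p n x)"
      by (intro Bochner_Integration.integrable_cong refl eq)
    then show ?thesis using integral_powr_p(1)[OF g, of n] by simp
  qed
qed

text \<open>p_n is orthogonal to lower powers of b - x because (-k)_n = 0 for k < n; the diagonal
  therefore sees only the leading coefficient, and there all powers of b - a cancel.\<close>

lemma p_orthonormal: "(LINT x|J. p m x * p n x) = (if m = n then 1 else 0)"
proof -
  have lower: "(LINT x|J. (b - x) ^ k * p n x) = 0" if "k < n" for k n
    using that pochhammer_of_nat_eq_0_iff[of k n, where 'a = real] by (simp add: integral_power_p)
  have expand: "(LINT x|J. p m x * p n x) = \<delta> m * (\<Sum>k\<le>m. A m k * (LINT x|J. (b - x) ^ k * p n x))" for m n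
  proof -
    have "(LINT x|J. p m x * p n x) = (LINT x|J. \<delta> m * (\<Sum>k\<le>m. A m k * ((b - x) ^ k * p n x)))"
      by (rule Bochner_Integration.integral_cong) (auto simp: p_eq_sum_a[of _ m] sum_distrib_right mult.assoc)
    also have "\<dots> = \<delta> m * (\<Sum>k\<le>m. \<integral>x. A m k * ((b - x) ^ k * p n x) \<partial>J)"
      by (subst Bochner_Integration.integral_mult_right_zero, subst Bochner_Integration.integral_sum)
         (auto intro!: integrable_mult_right integrable_power_p)
    finally show ?thesis by simp
  qed
  have less: "(LINT x|J. p m x * p n x) = 0" if "m < n" for m n
    unfolding expand using that by (simp add: lower)
  have diag: "(LINT x|J. p n x * p n x) = 1"
  proof -
    have "(\<Sum>k\<le>n. A n k * (LINT x|J. (b - x) ^ k * p n x)) = A n n * (LINT x|J. (b - x) ^ n * p n x)"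
      by (subst sum.remove[of _ n]) (auto simp: lower intro!: sum.neutral)
    then have "(LINT x|J. p n x * p n x) = \<delta> n * (A n n * (LINT x|J. (b - x) ^ n * p n x))"
      unfolding expand by simp
    also have "\<dots> = ((\<delta>' n)\<^sup>2 * ((b - a) powr (- real n - (\<beta> + \<gamma> + 1) / 2) * (b - a) powr (- real n - (\<beta> + \<gamma> + 1) / 2)
          * (b - a) powr (\<beta> + \<gamma> + real n + real n + 1)))
        * (pochhammer (\<beta> + \<gamma> + real n + 1) n * fact n * Beta (\<beta> + real n + 1) (\<gamma> + real n + 1)) * ((-1) ^ n * (-1) ^ n * ((-1) ^ n * (-1) ^ n))"
      by (simp only: integral_power_p jacobi_a_lead jacobi_delta_def pochhammer_same power2_eq_square mult_ac)
    also have "(b - a) powr (- real n - (\<beta> + \<gamma> + 1) / 2) * (b - a) powr (- real n - (\<beta> + \<gamma> + 1) / 2)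
          * (b - a) powr (\<beta> + \<gamma> + real n + real n + 1) = 1"
    proof -
      have "- real n - (\<beta> + \<gamma> + 1) / 2 + (- real n - (\<beta> + \<gamma> + 1) / 2) + (\<beta> + \<gamma> + real n + real n + 1) = 0"
        by (simp add: field_simps)
      then show ?thesis using ab by (simp only: powr_add[symmetric]) simp
    qed
    also have "(-1::real) ^ n * (-1) ^ n * ((-1) ^ n * (-1) ^ n) = 1"
      by (simp add: power_mult_distrib[symmetric])
    also have "(\<delta>' n)\<^sup>2 * 1 * (pochhammer (\<beta> + \<gamma> + real n + 1) n * fact n * Beta (\<beta> + real n + 1) (\<gamma> + real n + 1)) * 1
        = (\<delta>' n)\<^sup>2 * (fact n * Gamma (\<beta> + real n + 1) * Gamma (\<gamma> + real n + 1) * pochhammer (\<beta> + \<gamma> + real n + 1) n)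
          / Gamma (\<beta> + \<gamma> + 2 * real n + 2)"
      by (simp add: Beta_def algebra_simps)
    also have "\<dots> = 1"
    proof -
      have "Gamma (\<beta> + \<gamma> + 2 * real n + 2) > 0" using beta gamma by (intro Gamma_real_pos) auto
      then show ?thesis unfolding delta'_square by simp
    qed
    finally show ?thesis .
  qed
  show ?thesis
  proof (cases m n rule: linorder_cases)
    case greater
    then show ?thesis using less[OF greater] by (simp add: mult.commute)
  qed (use less diag in auto)
qed

text \<open>The leading coefficients are nonzero, so vanishing Jacobi coefficients force vanishing
  moments about b. Only integrability is assumed, because the exponent r of the datum f may lie
  below 2.\<close>

lemma AE_zero_if_coeff_zero:
  assumes h: "integrable J h" and z: "\<And>n. (LINT x|J. h x * p n x) = 0"
  shows "AE x in J. h x = 0"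
proof -
  note [measurable] = borel_measurable_integrable[OF h]
  have pm: "(\<lambda>x. (b - x) ^ k) \<in> borel_measurable J" for k
    by (rule borel_measurable_J) measurable
  have i: "integrable J (\<lambda>x. h x * (b - x) ^ k)" for k
    by (rule integrable_mult_bounded[OF h pm, of _ "(b - a) ^ k"])
       (auto simp: power_abs intro!: power_mono)
  have mom: "(LINT x|J. h x * (b - x) ^ k) = 0" for k
  proof (induction k rule: less_induct)
    case (less k)
    have "0 = (LINT x|J. h x * p k x)" using z by simp
    also have "\<dots> = (LINT x|J. \<delta> k * (\<Sum>j\<le>k. A k j * (h x * (b - x) ^ j)))"
      by (rule Bochner_Integration.integral_cong) (auto simp: p_eq_sum_a sum_distrib_left mult_ac)
    also have "\<dots> = \<delta> k * (\<Sum>j\<le>k. A k j * (LINT x|J. h x * (b - x) ^ j))"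
      by (subst Bochner_Integration.integral_mult_right_zero, subst Bochner_Integration.integral_sum)
         (auto intro!: integrable_mult_right i)
    also have "(\<Sum>j\<le>k. A k j * (LINT x|J. h x * (b - x) ^ j)) = A k k * (LINT x|J. h x * (b - x) ^ k)"
      by (subst sum.remove[of _ k]) (auto simp: less intro!: sum.neutral)
    finally show ?case using delta_neq_0[of k] A_lead_pos[of k] by simp
  qed
  have "AE x\<in>{a<..<b} in lebesgue. h x * w x = 0"
  proof (rule AE_zero_if_moments_zero)
    show "set_integrable lebesgue {a<..<b} (\<lambda>x. h x * w x)"
      using h by (subst integrable_J_iff[symmetric]) auto
    fix k
    have "(LINT x:{a<..<b}|lebesgue. h x * w x * (x - b) ^ k)
      = (LINT x:{a<..<b}|lebesgue. (-1) ^ k * (h x * (b - x) ^ k * w x))"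
    proof -
      have "(x - b) ^ k = (-1) ^ k * (b - x) ^ k" for x
        by (simp add: power_mult_distrib[symmetric])
      then show ?thesis by (simp only: mult_ac)
    qed
    also have "\<dots> = (-1) ^ k * (LINT x|J. h x * (b - x) ^ k)"
      using pm by (subst integral_J_eq) auto
    finally show "(LINT x:{a<..<b}|lebesgue. h x * w x * (x - b) ^ k) = 0" by (simp add: mom)
  qed
  then show ?thesis unfolding AE_J_iff
    by eventually_elim (use weight_pos in force)
qed

text \<open>In the square, the powers n^(\<beta>+\<gamma>+1), n^\<beta> and n^\<gamma> combine to n,
  whatever \<beta> and \<gamma> are.\<close>

lemma delta'_bound:
  obtains C where "C > 0" "\<And>n. \<delta>' n \<le> C * ((real n + 1) powr (1/2) / fact n)"
proof -
  obtain C1 where 1: "C1 > 0"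
    "\<And>n. Gamma (real n + (\<beta> + \<gamma> + 2)) \<le> C1 * (fact n * (real n + 1) powr (\<beta> + \<gamma> + 2 - 1))"
    by (rule Gamma_fact_powr_bounds[of "\<beta> + \<gamma> + 2"]) (use beta gamma in auto)
  have e1: "\<beta> + \<gamma> + 2 - 1 = \<beta> + \<gamma> + 1" by simp
  note 1 = 1[unfolded e1]
  obtain c2 where 2: "c2 > 0" "\<And>n. c2 * (fact n * (real n + 1) powr (\<beta> + 1 - 1)) \<le> Gamma (real n + (\<beta> + 1))"
    by (rule Gamma_fact_powr_bounds[of "\<beta> + 1"]) (use beta in auto)
  obtain c3 where 3: "c3 > 0" "\<And>n. c3 * (fact n * (real n + 1) powr (\<gamma> + 1 - 1)) \<le> Gamma (real n + (\<gamma> + 1))"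
    by (rule Gamma_fact_powr_bounds[of "\<gamma> + 1"]) (use gamma in auto)
  define C where "C = sqrt (2 * C1 / (c2 * c3))"
  have C: "C > 0" using 1 2 3 by (simp add: C_def)
  have "\<delta>' n \<le> C * ((real n + 1) powr (1/2) / fact n)" for n
  proof -
    have "(\<delta>' n)\<^sup>2 \<le> 2 * Gamma (\<beta> + \<gamma> + real n + 2) / (fact n * Gamma (\<beta> + real n + 1) * Gamma (\<gamma> + real n + 1))"
      by (rule delta'_square_le)
    also have "\<dots> = 2 * Gamma (real n + (\<beta> + \<gamma> + 2)) / (fact n * Gamma (real n + (\<beta> + 1)) * Gamma (real n + (\<gamma> + 1)))"
      by (simp add: add_ac)
    also have "\<dots> \<le> 2 * (C1 * (fact n * (real n + 1) powr (\<beta> + \<gamma> + 1)))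
        / (fact n * (c2 * (fact n * (real n + 1) powr (\<beta> + 1 - 1))) * (c3 * (fact n * (real n + 1) powr (\<gamma> + 1 - 1))))"
    proof -
      have "Gamma (real n + (\<beta> + 1)) > 0" "Gamma (real n + (\<beta> + \<gamma> + 2)) > 0"
        using beta gamma by (auto intro!: Gamma_real_pos)
      then show ?thesis
        using 1 2 3 by (intro frac_le mult_left_mono mult_mono mult_pos_pos mult_nonneg_nonneg) auto
    qed
    also have "\<dots> = 2 * C1 / (c2 * c3) * ((real n + 1) powr (\<beta> + \<gamma> + 1) / ((real n + 1) powr \<beta> * (real n + 1) powr \<gamma>)) / (fact n)\<^sup>2"
    proof -
      have "2 * (C1 * (F * u)) / (F * (c2 * (F * v)) * (c3 * (F * t))) = 2 * C1 / (c2 * c3) * (u / (v * t)) / F\<^sup>2"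
        if "F > 0" "v > 0" "t > 0" for F u v t :: real
        using that 2 3 by (simp add: field_simps power2_eq_square)
      from this[of "fact n" "(real n + 1) powr \<beta>" "(real n + 1) powr \<gamma>" "(real n + 1) powr (\<beta> + \<gamma> + 1)"]
      show ?thesis by simp
    qed
    also have "(real n + 1) powr (\<beta> + \<gamma> + 1) / ((real n + 1) powr \<beta> * (real n + 1) powr \<gamma>) = real n + 1"
      by (simp add: powr_add)
    also have "2 * C1 / (c2 * c3) * (real n + 1) / (fact n)\<^sup>2 = (C * ((real n + 1) powr (1/2) / fact n))\<^sup>2"
    proof -
      have "C\<^sup>2 = 2 * C1 / (c2 * c3)" using 1 2 3 by (simp add: C_def)
      moreover have "((real n + 1) powr (1/2))\<^sup>2 = real n + 1" by (simp add: powr_half_sqrt)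
      ultimately show ?thesis by (simp add: power_mult_distrib power_divide)
    qed
    finally show ?thesis by (rule power2_le_imp_le) (use C in simp)
  qed
  then show ?thesis by (rule that[OF C])
qed

text \<open>The larger endpoint Pochhammer symbol is n! times a power with exponent max(\<beta>,
  \<gamma>), and the n! cancels against the one in \<delta>'_n, which adds 1/2 to the exponent. The
  result is s - 1.\<close>

lemma p_sup_bound:
  obtains C where "C \<ge> 0" "\<And>n x. x \<in> {a<..<b} \<Longrightarrow> \<bar>p n x\<bar> \<le> C * (real n + 1) powr (max \<beta> \<gamma> + 1/2)"
proof -
  have poch: "\<exists>K>0. \<forall>n. pochhammer (z + 1) n \<le> K * (fact n * (real n + 1) powr max \<beta> \<gamma>)"
    if z: "-1/2 \<le> z" "z \<le> max \<beta> \<gamma>" for z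
  proof -
    obtain K where K: "K > 0" "\<And>n. Gamma (real n + (z + 1)) \<le> K * (fact n * (real n + 1) powr (z + 1 - 1))"
      by (rule Gamma_fact_powr_bounds[of "z + 1"]) (use z in auto)
    have Gz: "Gamma (z + 1) > 0" using z by (intro Gamma_real_pos) auto
    have "pochhammer (z + 1) n \<le> K / Gamma (z + 1) * (fact n * (real n + 1) powr max \<beta> \<gamma>)" for n
    proof -
      have "z + 1 \<notin> \<int>\<^sub>\<le>\<^sub>0" using z by (auto elim!: nonpos_Ints_cases)
      then have "pochhammer (z + 1) n = Gamma (real n + (z + 1)) / Gamma (z + 1)"
        by (simp add: pochhammer_Gamma add_ac)
      also have "\<dots> \<le> K * (fact n * (real n + 1) powr (z + 1 - 1)) / Gamma (z + 1)"
        using K Gz by (intro divide_right_mono) auto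
      also have "\<dots> \<le> K * (fact n * (real n + 1) powr max \<beta> \<gamma>) / Gamma (z + 1)"
        using K Gz z by (intro divide_right_mono mult_left_mono powr_mono) auto
      finally show ?thesis by simp
    qed
    then show ?thesis using K Gz by (intro exI[of _ "K / Gamma (z + 1)"]) auto
  qed
  obtain K1 where K1: "K1 > 0" "\<And>n. pochhammer (\<beta> + 1) n \<le> K1 * (fact n * (real n + 1) powr max \<beta> \<gamma>)"
    using poch[of \<beta>] beta by auto
  obtain K2 where K2: "K2 > 0" "\<And>n. pochhammer (\<gamma> + 1) n \<le> K2 * (fact n * (real n + 1) powr max \<beta> \<gamma>)"
    using poch[of \<gamma>] gamma by auto
  obtain C where C: "C > 0" "\<And>n. \<delta>' n \<le> C * ((real n + 1) powr (1/2) / fact n)"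
    by (rule delta'_bound) (rule that)
  define K where "K = max K1 K2"
  have K: "K > 0" "max (pochhammer (\<beta> + 1) n) (pochhammer (\<gamma> + 1) n) \<le> K * (fact n * (real n + 1) powr max \<beta> \<gamma>)" for n
  proof -
    show "K > 0" using K1 by (simp add: K_def)
    have Ks: "K1 * (fact n * (real n + 1) powr max \<beta> \<gamma>) \<le> K * (fact n * (real n + 1) powr max \<beta> \<gamma>)"
      "K2 * (fact n * (real n + 1) powr max \<beta> \<gamma>) \<le> K * (fact n * (real n + 1) powr max \<beta> \<gamma>)"
      by (intro mult_right_mono; simp add: K_def)+
    show "max (pochhammer (\<beta> + 1) n) (pochhammer (\<gamma> + 1) n) \<le> K * (fact n * (real n + 1) powr max \<beta> \<gamma>)"
      by (rule max.boundedI[OF order_trans[OF K1(2) Ks(1)] order_trans[OF K2(2) Ks(2)]])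
  qed
  let ?D = "(b - a) powr (- (\<beta> + \<gamma> + 1) / 2) * C * K"
  have "\<bar>p n x\<bar> \<le> ?D * (real n + 1) powr (max \<beta> \<gamma> + 1/2)" if x: "x \<in> {a<..<b}" for n x
  proof -
    have "\<bar>p n x\<bar> \<le> \<bar>\<delta> n\<bar> * ((b - a) ^ n * max (pochhammer (\<beta> + 1) n) (pochhammer (\<gamma> + 1) n))"
      unfolding jacobi_p_eq_sum[OF x] abs_mult using x ab beta gamma
      by (intro mult_left_mono jacobi_sum_bound) auto
    also have "\<dots> = ((b - a) powr (- real n - (\<beta> + \<gamma> + 1) / 2) * (b - a) powr real n)
        * (\<delta>' n * max (pochhammer (\<beta> + 1) n) (pochhammer (\<gamma> + 1) n))"
      using ab by (simp add: abs_delta powr_realpow)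
    also have "(b - a) powr (- real n - (\<beta> + \<gamma> + 1) / 2) * (b - a) powr real n = (b - a) powr (- (\<beta> + \<gamma> + 1) / 2)"
      by (subst powr_add[symmetric]) (simp add: field_simps)
    also have "\<delta>' n * max (pochhammer (\<beta> + 1) n) (pochhammer (\<gamma> + 1) n)
        \<le> (C * ((real n + 1) powr (1/2) / fact n)) * (K * (fact n * (real n + 1) powr max \<beta> \<gamma>))"
      using C(2)[of n] C(1) K(2)[of n] beta
      by (intro mult_mono) (auto intro!: pochhammer_nonneg simp: le_max_iff_disj)
    also have "\<dots> = C * K * (real n + 1) powr (max \<beta> \<gamma> + 1/2)" by (simp add: powr_add)
    finally show ?thesis by (simp add: mult_left_mono mult.assoc)
  qed
  then show ?thesis using that[of ?D] C K by auto
qed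

end

section \<open>Injectivity of the fractional integral\<close>

lemma set_integral_restrict_space:
  fixes f :: "real \<Rightarrow> real"
  assumes "S \<in> sets lebesgue"
  shows "(LINT x:S|lebesgue. f x) = (\<integral>x. f x \<partial>lebesgue_on S)"
    and "set_integrable lebesgue S f \<longleftrightarrow> integrable (lebesgue_on S) f"
  using assms by (simp_all add: set_lebesgue_integral_def set_integrable_def integral_restrict_space integrable_restrict_space)

lemma right_kernel_integral:
  fixes u b \<rho> s :: real
  assumes "u < b" "\<rho> > -1" "s > -1"
  shows "integrable (lebesgue_on {u<..<b}) (\<lambda>t. (b - t) powr \<rho> * (t - u) powr s)"
    and "(LINT t|lebesgue_on {u<..<b}. (b - t) powr \<rho> * (t - u) powr s)
      = (b - u) powr (\<rho> + s + 1) * Beta (s + 1) (\<rho> + 1)"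
proof -
  have eq: "(b - t) powr \<rho> * (t - u) powr s = (t - u) powr (s + 1 - 1) * (b - t) powr (\<rho> + 1 - 1)" for t
    by simp
  note B = Beta_interval_integral[OF assms(1), of "s + 1" "\<rho> + 1"]
  show "integrable (lebesgue_on {u<..<b}) (\<lambda>t. (b - t) powr \<rho> * (t - u) powr s)"
    unfolding eq by (subst set_integral_restrict_space(2)[symmetric]) (use B assms in auto)
  show "(LINT t|lebesgue_on {u<..<b}. (b - t) powr \<rho> * (t - u) powr s)
      = (b - u) powr (\<rho> + s + 1) * Beta (s + 1) (\<rho> + 1)"
    unfolding eq by (subst set_integral_restrict_space(1)[symmetric]) (use B assms in \<open>auto simp: algebra_simps\<close>)
qed

text \<open>Moments turn the right-sided integral of \<open>\<phi>\<close> into moments of \<open>\<phi> * (t - a) powr \<mu>\<close>, so that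
  injectivity of the Abel operator follows from the moment theorem.\<close>

lemma frac_integral_moments:
  fixes \<phi> :: "real \<Rightarrow> real"
  assumes ab: "a < b" and mu: "\<mu> > 0" and int: "set_integrable lebesgue {a<..<b} \<phi>"
  obtains H where "H \<in> borel_measurable borel"
    "\<And>x. x \<in> {a<..<b} \<Longrightarrow> H x = (LINT t:{x<..<b}|lebesgue. \<phi> t * (t - x) powr (\<mu> - 1))"
    "\<And>k. (LINT x|lborel. indicator {a<..<b} x * (x - a) ^ k * H x)
        = Beta (real k + 1) \<mu> * (LINT t:{a<..<b}|lebesgue. \<phi> t * (t - a) powr (real k + \<mu>))"
proof -
  obtain h where h: "integrable lborel h" "h \<in> borel_measurable borel"
    "\<And>x. x \<notin> {a<..<b} \<Longrightarrow> h x = 0" "AE x in lebesgue. indicator {a<..<b} x * \<phi> x = h x"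
    using lebesgue_borel_representative[OF int] by auto
  note [measurable] = h(2)
  have g: "(\<lambda>x. indicator {a<..<b} x * \<phi> x) \<in> borel_measurable lebesgue"
    using int by (auto simp: set_integrable_def)
  have leb: "u \<in> borel_measurable lebesgue" if "u \<in> borel_measurable borel" for u :: "real \<Rightarrow> real"
    using that by (intro measurable_completion) simp
  have transfer: "(LINT t:S|lebesgue. \<phi> t * u t) = (LINT t|lborel. h t * (indicator S t * u t))"
    if S: "S \<subseteq> {a<..<b}" and [measurable]: "S \<in> sets borel" "u \<in> borel_measurable borel" for S and u :: "real \<Rightarrow> real"
  proof -
    have "(LINT t:S|lebesgue. \<phi> t * u t) = (LINT t|lebesgue. (indicator {a<..<b} t * \<phi> t) * (indicator S t * u t))"
      unfolding set_lebesgue_integral_def using S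
      by (intro Bochner_Integration.integral_cong refl) (auto simp: indicator_def)
    also have "\<dots> = (LINT t|lebesgue. h t * (indicator S t * u t))"
    proof (rule integral_cong_AE)
      show "(\<lambda>t. (indicator {a<..<b} t * \<phi> t) * (indicator S t * u t)) \<in> borel_measurable lebesgue"
        by (intro borel_measurable_times[OF g] leb) measurable
      show "(\<lambda>t. h t * (indicator S t * u t)) \<in> borel_measurable lebesgue"
        by (intro leb) measurable
    qed (use h(4) in \<open>auto elim: eventually_mono\<close>)
    also have "\<dots> = (LINT t|lborel. h t * (indicator S t * u t))"
      by (subst integral_completion) auto
    finally show ?thesis .
  qed
  \<comment> \<open>Extending the kernel by 0 to t \<le> x turns the integral over (x, b) into one
    over the line, since h already vanishes from b on.\<close>
  define K where "K t x = (if x < t then (t - x) powr (\<mu> - 1) else 0)" for t x :: real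
  have [measurable]: "(\<lambda>z. K (fst z) (snd z)) \<in> borel_measurable (lborel \<Otimes>\<^sub>M lborel)"
    unfolding K_def by measurable
  have [measurable]: "K t \<in> borel_measurable borel" for t unfolding K_def by measurable
  have [measurable]: "(\<lambda>t. K t x) \<in> borel_measurable borel" for x unfolding K_def by measurable
  define H where "H x = (LINT t|lborel. h t * K t x)" for x
  have Hm: "H \<in> borel_measurable borel"
  proof -
    have "(\<lambda>z. h (snd z) * K (snd z) (fst z)) \<in> borel_measurable (lborel \<Otimes>\<^sub>M lborel)"
      unfolding K_def by measurable
    then have "(\<lambda>x. \<integral>t. h t * K t x \<partial>lborel) \<in> borel_measurable lborel"
      by (intro lborel.borel_measurable_lebesgue_integral) (simp add: case_prod_beta)
    then show ?thesis unfolding H_def by simp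
  qed
  have Heq: "H x = (LINT t:{x<..<b}|lebesgue. \<phi> t * (t - x) powr (\<mu> - 1))" if "x \<in> {a<..<b}" for x
  proof -
    have "(LINT t:{x<..<b}|lebesgue. \<phi> t * (t - x) powr (\<mu> - 1))
       = (LINT t|lborel. h t * (indicator {x<..<b} t * (t - x) powr (\<mu> - 1)))"
      using that by (intro transfer) auto
    also have "\<dots> = H x" unfolding H_def using h(3)
      by (intro Bochner_Integration.integral_cong refl) (auto simp: K_def indicator_def)
    finally show ?thesis by simp
  qed
  have mom: "(LINT x|lborel. indicator {a<..<b} x * (x - a) ^ k * H x)
        = Beta (real k + 1) \<mu> * (LINT t:{a<..<b}|lebesgue. \<phi> t * (t - a) powr (real k + \<mu>))" for k
  proof -
    define G where "G t x = h t * (indicator {a<..<b} x * (x - a) ^ k * K t x)" for t x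
    have Gm: "(\<lambda>z. G (fst z) (snd z)) \<in> borel_measurable (lborel \<Otimes>\<^sub>M lborel)"
      unfolding G_def K_def by measurable
    \<comment> \<open>For fixed t the x-integral is a Beta integral over (a, t); this is the origin
      of (t-a)^(k+\<mu>).\<close>
    define N where "N t x = indicator {a<..<b} x * (x - a) ^ k * K t x" for t x
    have N: "integrable lborel (N t)" "(LINT x|lborel. N t x) = Beta (real k + 1) \<mu> * (t - a) powr (real k + \<mu>)"
      if t: "t \<in> {a<..<b}" for t
    proof -
      have [measurable]: "N t \<in> borel_measurable borel" unfolding N_def by measurable
      have Neq: "indicator {a<..<t} x *\<^sub>R ((x - a) powr (real k + 1 - 1) * (t - x) powr (\<mu> - 1)) = N t x" for x
        using t by (auto simp: N_def K_def indicator_def powr_realpow)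
      have at: "a < t" using t by simp
      note B = Beta_interval_integral[OF at, of "real k + 1" \<mu>]
      have "integrable lebesgue (N t)"
        using B(1) mu unfolding set_integrable_def Neq by simp
      then show "integrable lborel (N t)" by (simp add: integrable_completion)
      have "(LINT x|lebesgue. N t x) = (t - a) powr (real k + 1 + \<mu> - 1) * Beta (real k + 1) \<mu>"
        using B(2) mu unfolding set_lebesgue_integral_def Neq by simp
      then show "(LINT x|lborel. N t x) = Beta (real k + 1) \<mu> * (t - a) powr (real k + \<mu>)"
        by (simp add: integral_completion algebra_simps)
    qed
    have Nnn: "N t x \<ge> 0" for t x by (auto simp: N_def K_def indicator_def)
    have GN: "G t x = h t * N t x" for t x by (simp add: G_def N_def)
    have G_int: "integrable lborel (G t)" for t
      using N(1)[of t] h(3)[of t] unfolding GN[abs_def] by (cases "t \<in> {a<..<b}") auto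
    have bnd: "integrable lborel (\<lambda>t. h t * (indicator {a<..<b} t * (Beta (real k + 1) \<mu> * (t - a) powr (real k + \<mu>))))"
    proof (rule integrable_mult_bounded[OF h(1)])
      fix t :: real
      have Bp: "Beta (real k + 1) \<mu> \<ge> 0" using mu by (auto simp: Beta_def intro!: divide_nonneg_nonneg mult_nonneg_nonneg Gamma_real_nonneg less_imp_le[OF Gamma_real_pos])
      have "(t - a) powr (real k + \<mu>) \<le> (b - a) powr (real k + \<mu>)" if "t \<in> {a<..<b}"
        using that mu by (intro powr_mono2) auto
      then show "\<bar>indicator {a<..<b} t * (Beta (real k + 1) \<mu> * (t - a) powr (real k + \<mu>))\<bar>
          \<le> Beta (real k + 1) \<mu> * (b - a) powr (real k + \<mu>)"
        using Bp by (auto simp: indicator_def abs_mult intro!: mult_left_mono)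
    qed measurable
    have inner: "(LINT x|lborel. G t x) = h t * (indicator {a<..<b} t * (Beta (real k + 1) \<mu> * (t - a) powr (real k + \<mu>)))" for t
      unfolding GN using N(2)[of t] h(3)[of t] by (cases "t \<in> {a<..<b}") auto
    \<comment> \<open>Since \<open>N\<close> is nonnegative, the integral of the absolute value is
      the same Beta integral times |h t|, which is what Fubini requires.\<close>
    have inner_norm: "(LINT x|lborel. norm (G t x)) = norm (h t * (indicator {a<..<b} t * (Beta (real k + 1) \<mu> * (t - a) powr (real k + \<mu>))))" for t
    proof -
      have Bp: "Beta (real k + 1) \<mu> \<ge> 0" using mu by (auto simp: Beta_def intro!: divide_nonneg_nonneg mult_nonneg_nonneg less_imp_le[OF Gamma_real_pos])
      have "norm (G t x) = \<bar>h t\<bar> * N t x" for x using Nnn by (simp add: GN abs_mult)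
      then have "(LINT x|lborel. norm (G t x)) = \<bar>h t\<bar> * (LINT x|lborel. N t x)" by simp
      then show ?thesis using N(2)[of t] h(3)[of t] Bp by (cases "t \<in> {a<..<b}") (auto simp: abs_mult)
    qed
    have "integrable (lborel \<Otimes>\<^sub>M lborel) (case_prod G)"
    proof (rule lborel_pair.Fubini_integrable)
      show "case_prod G \<in> borel_measurable (lborel \<Otimes>\<^sub>M lborel)" using Gm by (simp add: case_prod_beta')
      show "integrable lborel (\<lambda>t. \<integral>x. norm (case (t, x) of (t, x) \<Rightarrow> G t x) \<partial>lborel)"
        unfolding prod.case inner_norm by (rule integrable_norm[OF bnd])
      show "AE t in lborel. integrable lborel (\<lambda>x. case (t, x) of (t, x) \<Rightarrow> G t x)"
        using G_int by simp
    qed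
    then have "(LINT x|lborel. (LINT t|lborel. G t x)) = (LINT t|lborel. (LINT x|lborel. G t x))"
      by (rule lborel_pair.Fubini_integral)
    also have "\<dots> = (LINT t|lborel. h t * (indicator {a<..<b} t * (Beta (real k + 1) \<mu> * (t - a) powr (real k + \<mu>))))"
      by (simp only: inner)
    also have "\<dots> = (LINT t:{a<..<b}|lebesgue. \<phi> t * (Beta (real k + 1) \<mu> * (t - a) powr (real k + \<mu>)))"
      by (intro transfer[symmetric]) auto
    also have "\<dots> = Beta (real k + 1) \<mu> * (LINT t:{a<..<b}|lebesgue. \<phi> t * (t - a) powr (real k + \<mu>))"
      by (subst set_integral_mult_right[symmetric]) (simp add: mult_ac)
    also have "(\<lambda>x. \<integral>t. G t x \<partial>lborel) = (\<lambda>x. indicator {a<..<b} x * (x - a) ^ k * H x)"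
    proof
      fix x
      have "(LINT t|lborel. G t x) = (LINT t|lborel. (indicator {a<..<b} x * (x - a) ^ k) * (h t * K t x))"
        by (simp add: G_def mult_ac)
      also have "\<dots> = (indicator {a<..<b} x * (x - a) ^ k) * H x" unfolding H_def by (rule integral_mult_right_zero)
      finally show "(LINT t|lborel. G t x) = indicator {a<..<b} x * (x - a) ^ k * H x" .
    qed
    finally show ?thesis .
  qed
  show ?thesis by (rule that[OF Hm Heq mom])
qed

lemma frac_integral_inj:
  fixes \<phi>1 \<phi>2 :: "real \<Rightarrow> real"
  assumes ab: "a < b" and mu: "\<mu> > 0"
    and int: "set_integrable lebesgue {a<..<b} \<phi>1" "set_integrable lebesgue {a<..<b} \<phi>2"
    and eq: "AE x\<in>{a<..<b} in lebesgue. frac_integral b \<mu> \<phi>1 x = frac_integral b \<mu> \<phi>2 x"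
  shows "AE x\<in>{a<..<b} in lebesgue. \<phi>1 x = \<phi>2 x"
proof -
  obtain H1 where H1: "H1 \<in> borel_measurable borel"
    "\<And>x. x \<in> {a<..<b} \<Longrightarrow> H1 x = (LINT t:{x<..<b}|lebesgue. \<phi>1 t * (t - x) powr (\<mu> - 1))"
    "\<And>k. (LINT x|lborel. indicator {a<..<b} x * (x - a) ^ k * H1 x)
        = Beta (real k + 1) \<mu> * (LINT t:{a<..<b}|lebesgue. \<phi>1 t * (t - a) powr (real k + \<mu>))"
    by (rule frac_integral_moments[OF ab mu int(1)]) (rule that)
  obtain H2 where H2: "H2 \<in> borel_measurable borel"
    "\<And>x. x \<in> {a<..<b} \<Longrightarrow> H2 x = (LINT t:{x<..<b}|lebesgue. \<phi>2 t * (t - x) powr (\<mu> - 1))"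
    "\<And>k. (LINT x|lborel. indicator {a<..<b} x * (x - a) ^ k * H2 x)
        = Beta (real k + 1) \<mu> * (LINT t:{a<..<b}|lebesgue. \<phi>2 t * (t - a) powr (real k + \<mu>))"
    by (rule frac_integral_moments[OF ab mu int(2)]) (rule that)
  note [measurable] = H1(1) H2(1)
  have G: "Gamma \<mu> > 0" using mu by (rule Gamma_real_pos)
  have "AE x in lebesgue. x \<in> {a<..<b} \<longrightarrow> H1 x = H2 x"
    using eq
  proof eventually_elim
    case (elim x)
    show ?case
    proof
      assume x: "x \<in> {a<..<b}"
      then show "H1 x = H2 x" using elim G mu by (simp add: frac_integral_def H1(2) H2(2))
    qed
  qed
  then have ae: "AE x in lborel. x \<in> {a<..<b} \<longrightarrow> H1 x = H2 x"
    by (simp add: AE_completion_iff)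
  have B: "Beta (real k + 1) \<mu> > 0" for k
    unfolding Beta_def using mu by (intro divide_pos_pos mult_pos_pos Gamma_real_pos) auto
  have mom_eq: "(LINT t:{a<..<b}|lebesgue. \<phi>1 t * (t - a) powr (real k + \<mu>))
     = (LINT t:{a<..<b}|lebesgue. \<phi>2 t * (t - a) powr (real k + \<mu>))" for k
  proof -
    have "(LINT x|lborel. indicator {a<..<b} x * (x - a) ^ k * H1 x)
        = (LINT x|lborel. indicator {a<..<b} x * (x - a) ^ k * H2 x)"
      by (rule integral_cong_AE) (use ae in \<open>auto elim!: eventually_mono simp: indicator_def\<close>)
    then show ?thesis using B[of k] by (simp add: H1(3) H2(3))
  qed
  have pw: "set_integrable lebesgue {a<..<b} (\<lambda>t. \<phi> t * (t - a) powr s)"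
    if i: "set_integrable lebesgue {a<..<b} \<phi>" and s: "s \<ge> 0" for \<phi> :: "real \<Rightarrow> real" and s
  proof -
    have "integrable (lebesgue_on {a<..<b}) (\<lambda>t. \<phi> t * (t - a) powr s)"
    proof (rule integrable_mult_bounded)
      show "integrable (lebesgue_on {a<..<b}) \<phi>"
        using i by (subst set_integral_restrict_space(2)[symmetric]) auto
      show "(\<lambda>t. (t - a) powr s) \<in> borel_measurable (lebesgue_on {a<..<b})"
        by (intro measurable_restrict_space1 measurable_completion) measurable
      show "\<bar>(x - a) powr s\<bar> \<le> (b - a) powr s" if "x \<in> space (lebesgue_on {a<..<b})" for x
        using that s by (auto simp: space_restrict_space intro!: powr_mono2)
    qed
    then show ?thesis by (subst set_integral_restrict_space(2)) auto
  qed
  \<comment> \<open>The moments computed through Fubini are ordinary moments of the function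
    multiplied by (x-a)^\<mu>, so this factor is carried along; being positive, it drops out at the
    end.\<close>
  have "AE x\<in>{a<..<b} in lebesgue. (\<phi>1 x - \<phi>2 x) * (x - a) powr \<mu> = 0"
  proof (rule AE_zero_if_moments_zero)
    show "set_integrable lebesgue {a<..<b} (\<lambda>x. (\<phi>1 x - \<phi>2 x) * (x - a) powr \<mu>)"
      using pw[OF int(1), of \<mu>] pw[OF int(2), of \<mu>] mu by (simp add: left_diff_distrib set_integral_diff)
    fix k
    have "(LINT x:{a<..<b}|lebesgue. (\<phi>1 x - \<phi>2 x) * (x - a) powr \<mu> * (x - a) ^ k)
       = (LINT x:{a<..<b}|lebesgue. \<phi>1 x * (x - a) powr (real k + \<mu>) - \<phi>2 x * (x - a) powr (real k + \<mu>))"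
      by (rule set_lebesgue_integral_cong) (auto simp: powr_add powr_realpow algebra_simps)
    also have "\<dots> = 0"
      using pw[OF int(1), of "real k + \<mu>"] pw[OF int(2), of "real k + \<mu>"] mu
      by (subst set_integral_diff) (auto simp: mom_eq)
    finally show "(LINT x:{a<..<b}|lebesgue. (\<phi>1 x - \<phi>2 x) * (x - a) powr \<mu> * (x - a) ^ k) = 0" .
  qed
  then show ?thesis by eventually_elim auto
qed

section \<open>Fractional derivatives of the Jacobi polynomials\<close>

text \<open>Only the first factor can be below 1.\<close>

lemma pochhammer_ge_half:
  fixes z :: real
  assumes "z \<ge> 1/2"
  shows "pochhammer z n \<ge> 1/2"
proof (cases n)
  case 0
  then show ?thesis by simp
next
  case (Suc m)
  have "pochhammer z (Suc m) \<ge> 1/2"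
  proof (induction m)
    case (Suc m)
    have "pochhammer z (Suc m) * 1 \<le> pochhammer z (Suc m) * (z + real (Suc m))"
      using Suc assms by (intro mult_left_mono) auto
    then show ?case using Suc by (subst pochhammer_Suc) linarith
  qed (use assms in simp)
  then show ?thesis using Suc by simp
qed

text \<open>Up to sign this is the product of the last j factors of
  \<open>pochhammer (z + 1) n\<close>; the omitted ones multiply to at least 1/2.\<close>

lemma abs_pochhammer_minus_le:
  fixes z :: real
  assumes z: "z \<ge> -1/2" and j: "j \<le> n"
  shows "\<bar>pochhammer (- (z + real n)) j\<bar> \<le> 2 * pochhammer (z + 1) n"
proof -
  have "\<bar>pochhammer (- (z + real n)) j\<bar> = \<bar>pochhammer (z + 1 + real (n - j)) j\<bar>"
    by (subst pochhammer_minus) (use j in \<open>simp add: abs_mult of_nat_diff algebra_simps\<close>)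
  also have "\<dots> = pochhammer (z + 1 + real (n - j)) j"
    using z by (intro abs_of_nonneg pochhammer_nonneg) auto
  also have "\<dots> \<le> 2 * (pochhammer (z + 1) (n - j) * pochhammer (z + 1 + real (n - j)) j)"
  proof -
    have "1/2 * pochhammer (z + 1 + real (n - j)) j \<le> pochhammer (z + 1) (n - j) * pochhammer (z + 1 + real (n - j)) j"
      using z by (intro mult_right_mono pochhammer_ge_half pochhammer_nonneg) auto
    then show ?thesis by simp
  qed
  also have "pochhammer (z + 1) (n - j) * pochhammer (z + 1 + real (n - j)) j = pochhammer (z + 1) n"
    using pochhammer_product'[of "z + 1" "n - j" j] j by simp
  finally show ?thesis .
qed

text \<open>The binomial coefficients sum to 2^n, and 4 is the square of the constant in
  \<open>abs_pochhammer_minus_le\<close>.\<close>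

lemma jacobi_d_sum_le:
  assumes "\<beta> \<ge> -1/2" "\<gamma> \<ge> -1/2"
  shows "(\<Sum>j\<le>n. \<bar>jacobi_d \<beta> \<gamma> n j\<bar>) \<le> 4 * 2 ^ n * pochhammer (\<beta> + 1) n * pochhammer (\<gamma> + 1) n"
proof -
  have "(\<Sum>j\<le>n. \<bar>jacobi_d \<beta> \<gamma> n j\<bar>)
      \<le> (\<Sum>j\<le>n. real (n choose j) * ((2 * pochhammer (\<beta> + 1) n) * (2 * pochhammer (\<gamma> + 1) n)))"
  proof (rule sum_mono)
    fix j assume "j \<in> {..n}"
    have p0: "pochhammer (\<beta> + 1) n \<ge> 0" using assms by (intro pochhammer_nonneg) auto
    have "\<bar>jacobi_d \<beta> \<gamma> n j\<bar> = real (n choose j) * (\<bar>pochhammer (- (\<beta> + real n)) j\<bar> * \<bar>pochhammer (- (\<gamma> + real n)) (n - j)\<bar>)"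
      by (simp add: jacobi_d_def abs_mult power_abs)
    also have "\<dots> \<le> real (n choose j) * ((2 * pochhammer (\<beta> + 1) n) * (2 * pochhammer (\<gamma> + 1) n))"
      using assms \<open>j \<in> {..n}\<close> p0 by (intro mult_left_mono mult_mono abs_pochhammer_minus_le) auto
    finally show "\<bar>jacobi_d \<beta> \<gamma> n j\<bar> \<le> real (n choose j) * ((2 * pochhammer (\<beta> + 1) n) * (2 * pochhammer (\<gamma> + 1) n))" .
  qed
  also have "\<dots> = real (\<Sum>j\<le>n. n choose j) * (4 * pochhammer (\<beta> + 1) n * pochhammer (\<gamma> + 1) n)"
    unfolding of_nat_sum sum_distrib_right by (intro sum.cong refl) simp
  also have "(\<Sum>j\<le>n. n choose j) = 2 ^ n" by (rule choose_row_sum)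
  finally show ?thesis by (simp add: mult_ac)
qed

text \<open>For \<open>n > k\<close> the factor \<open>pochhammer (\<mu> - k) k\<close> is at most \<open>k!\<close> and splits off; for \<open>n \<le> k\<close>
  the product is at most \<open>k! / (k - n)!\<close>.\<close>

lemma abs_pochhammer_shift_bound:
  fixes \<mu> :: real
  assumes mu: "0 \<le> \<mu>" "\<mu> < 1"
  obtains C where "C > 0"
    "\<And>n k. \<bar>pochhammer (\<mu> - real k) n\<bar> \<le> C * (real k + 1) * 2 ^ k * (fact n * (real n + 1) powr (\<mu> - 1))"
proof -
  \<comment> \<open>The Gamma quotient for the Pochhammer symbol needs \<mu> > 0; at \<mu> = 0 the
    symbol is 1 for n = 0 and 0 afterwards.\<close>
  obtain C0 where C0: "C0 \<ge> 0" "\<And>n. pochhammer \<mu> n \<le> C0 * (fact n * (real n + 1) powr (\<mu> - 1))"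
  proof (cases "\<mu> = 0")
    case True
    then show ?thesis by (intro that[of 1]) (auto simp: pochhammer_0_left)
  next
    case False
    then have m: "\<mu> > 0" using mu by simp
    obtain C where C: "C > 0" "\<And>n. Gamma (real n + \<mu>) \<le> C * (fact n * (real n + 1) powr (\<mu> - 1))"
      by (rule Gamma_fact_powr_bounds[OF m]) (rule that)
    have G: "Gamma \<mu> > 0" using m by (rule Gamma_real_pos)
    show ?thesis
    proof (rule that[of "C / Gamma \<mu>"])
      fix n
      have "\<mu> \<notin> \<int>\<^sub>\<le>\<^sub>0" using m by (auto elim!: nonpos_Ints_cases)
      then have "pochhammer \<mu> n = Gamma (real n + \<mu>) / Gamma \<mu>" by (simp add: pochhammer_Gamma add.commute)
      also have "\<dots> \<le> C * (fact n * (real n + 1) powr (\<mu> - 1)) / Gamma \<mu>"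
        using C G by (intro divide_right_mono) auto
      finally show "pochhammer \<mu> n \<le> C / Gamma \<mu> * (fact n * (real n + 1) powr (\<mu> - 1))" by simp
    qed (use C G in auto)
  qed
  \<comment> \<open>As long as n \<le> k the factors are at most k, k-1, ... in absolute value,
    because 0 \<le> \<mu> < 1.\<close>
  have low: "\<bar>pochhammer (\<mu> - real k) n\<bar> * fact (k - n) \<le> fact k" if "n \<le> k" for n k
    using that
  proof (induction n)
    case (Suc n)
    have "\<bar>pochhammer (\<mu> - real k) (Suc n)\<bar> * fact (k - Suc n)
        = \<bar>pochhammer (\<mu> - real k) n\<bar> * (\<bar>\<mu> - real k + real n\<bar> * fact (k - Suc n))"
      by (simp add: pochhammer_Suc abs_mult)
    also have "\<dots> \<le> \<bar>pochhammer (\<mu> - real k) n\<bar> * (real (k - n) * fact (k - Suc n))"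
    proof -
      have "\<bar>\<mu> - real k + real n\<bar> \<le> real (k - n)" using Suc.prems mu by (auto simp: of_nat_diff)
      then show ?thesis by (intro mult_left_mono mult_right_mono) auto
    qed
    also have "real (k - n) * fact (k - Suc n) = fact (k - n)"
      using Suc.prems by (subst fact_reduce[of "k - n"]) auto
    finally show ?case using Suc by auto
  qed simp
  define C where "C = C0 + 1"
  have C: "C > 0" "C \<ge> C0" "C \<ge> 1" using C0 by (auto simp: C_def)
  have "\<bar>pochhammer (\<mu> - real k) n\<bar> \<le> C * (real k + 1) * 2 ^ k * (fact n * (real n + 1) powr (\<mu> - 1))" for n k
  proof (cases "n \<le> k")
    case True
    have "\<bar>pochhammer (\<mu> - real k) n\<bar> * fact (k - n) \<le> real (k choose n) * fact n * fact (k - n)"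
    proof -
      have "real (k choose n) * fact n * fact (k - n) = fact k"
      proof -
        have "real (fact n * fact (k - n) * (k choose n)) = real (fact k)"
          by (simp only: binomial_fact_lemma[OF True])
        then show ?thesis by (simp add: mult_ac)
      qed
      then show ?thesis using low[OF True] by simp
    qed
    then have "\<bar>pochhammer (\<mu> - real k) n\<bar> \<le> real (k choose n) * fact n"
      by (rule mult_right_le_imp_le) simp
    also have "\<dots> \<le> 2 ^ k * fact n"
    proof -
      have "real (k choose n) \<le> real (2 ^ k)"
        unfolding of_nat_le_iff using binomial_le_pow2 by blast
      then show ?thesis by (intro mult_right_mono) auto
    qed
    also have "\<dots> \<le> C * (2 ^ k * fact n) * ((real k + 1) * (real n + 1) powr (\<mu> - 1))"
    proof -
      have "1 = (real n + 1) * (real n + 1) powr (- 1)" by (simp add: powr_minus field_simps)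
      also have "\<dots> \<le> (real k + 1) * (real n + 1) powr (\<mu> - 1)"
        using True mu by (intro mult_mono powr_mono) auto
      finally have "1 * 1 \<le> C * ((real k + 1) * (real n + 1) powr (\<mu> - 1))"
        using C by (intro mult_mono) auto
      from mult_left_mono[OF this, of "2 ^ k * fact n"] show ?thesis by (simp add: mult_ac)
    qed
    finally show ?thesis by (simp only: mult_ac)
  next
    case False
    define i where "i = n - k"
    have n: "n = k + i" using False by (simp add: i_def)
    have "\<bar>pochhammer (\<mu> - real k) n\<bar> = \<bar>pochhammer (\<mu> - real k) k\<bar> * pochhammer \<mu> i"
    proof -
      have "pochhammer \<mu> i \<ge> 0" using mu by (cases "\<mu> = 0") (auto simp: pochhammer_0_left intro!: pochhammer_nonneg)
      then show ?thesis unfolding n pochhammer_product' by (simp add: abs_mult)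
    qed
    also have "\<dots> \<le> fact k * (C * (fact i * (real i + 1) powr (\<mu> - 1)))"
    proof (rule mult_mono)
      show "\<bar>pochhammer (\<mu> - real k) k\<bar> \<le> fact k" using low[of k k] by simp
      have "C0 * (fact i * (real i + 1) powr (\<mu> - 1)) \<le> C * (fact i * (real i + 1) powr (\<mu> - 1))"
        using C by (intro mult_right_mono) auto
      then show "pochhammer \<mu> i \<le> C * (fact i * (real i + 1) powr (\<mu> - 1))" using C0(2)[of i] by linarith
      show "pochhammer \<mu> i \<ge> 0" using mu by (cases "\<mu> = 0") (auto simp: pochhammer_0_left intro!: pochhammer_nonneg)
    qed auto
    also have "\<dots> = C * ((fact k * fact i) * (real i + 1) powr (\<mu> - 1))" by (simp add: mult_ac)
    also have "\<dots> \<le> C * (fact n * ((real k + 1) * (real n + 1) powr (\<mu> - 1)))"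
    proof (intro mult_left_mono mult_mono)
      have "fact k * fact i * (n choose k) = fact n"
        using binomial_fact_lemma[of k n] n by simp
      moreover have "n choose k \<ge> 1" using n by (simp add: Suc_le_eq)
      ultimately have "fact k * fact i \<le> (fact n :: nat)"
        using mult_le_mono2[of 1 "n choose k" "fact k * fact i"] by simp
      then have "real (fact k * fact i) \<le> real (fact n)" by (simp only: of_nat_le_iff)
      then show "fact k * fact i \<le> (fact n :: real)" by simp
      \<comment> \<open>Rests on n + 1 \<le> (i+1)(k+1) with the negative exponent \<mu> - 1; the
        extra factor k + 1 pays for (k+1)^(\<mu>-1).\<close>
      have "(real i + 1) powr (\<mu> - 1) * 1 \<le> (real k + 1) * ((real i + 1) * (real k + 1)) powr (\<mu> - 1)"
      proof -
        have "1 = (real k + 1) * (real k + 1) powr (- 1)" by (simp add: powr_minus field_simps)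
        also have "\<dots> \<le> (real k + 1) * (real k + 1) powr (\<mu> - 1)"
          using mu by (intro mult_left_mono powr_mono) auto
        finally have "(real i + 1) powr (\<mu> - 1) * 1 \<le> (real i + 1) powr (\<mu> - 1) * ((real k + 1) * (real k + 1) powr (\<mu> - 1))"
          by (intro mult_left_mono) auto
        then show ?thesis by (simp add: powr_mult mult_ac)
      qed
      also have "\<dots> \<le> (real k + 1) * (real n + 1) powr (\<mu> - 1)"
        using mu n by (intro mult_left_mono powr_mono2') (auto simp: algebra_simps)
      finally show "(real i + 1) powr (\<mu> - 1) \<le> (real k + 1) * (real n + 1) powr (\<mu> - 1)" by simp
    qed (use C in auto)
    also have "\<dots> \<le> C * (fact n * ((real k + 1) * (real n + 1) powr (\<mu> - 1))) * 2 ^ k"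
    proof -
      have "C * (fact n * ((real k + 1) * (real n + 1) powr (\<mu> - 1))) * 1
          \<le> C * (fact n * ((real k + 1) * (real n + 1) powr (\<mu> - 1))) * 2 ^ k"
        using C by (intro mult_left_mono) auto
      then show ?thesis by simp
    qed
    finally show ?thesis by (simp only: mult_ac)
  qed
  then show ?thesis by (rule that[OF C(1)])
qed

section \<open>The decay hypothesis and the majorants of p_n\<close>

context jacobi
begin

text \<open>The radius stays free so that losses of the form C^k can be absorbed: it is b - a for
  p_n, 2(b-a) for q_n and 8(b-a) for the Jacobi coefficients of q_n.\<close>

definition "growth R n = \<bar>\<delta> n\<bar> * (\<Sum>k\<le>n. \<bar>A n k\<bar> * R ^ k)"

lemma growth_nonneg: "R \<ge> 0 \<Longrightarrow> growth R n \<ge> 0"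
  by (simp add: growth_def sum_nonneg)

lemma abs_p_le_growth: "x \<in> {a<..<b} \<Longrightarrow> \<bar>p n x\<bar> \<le> growth (b - a) n"
  unfolding p_eq_sum_a growth_def abs_mult
  by (intro mult_left_mono order_trans[OF sum_abs] sum_mono)
     (auto simp: abs_mult power_abs intro!: mult_left_mono power_mono)

text \<open>The two Gamma factors of the hypothesis match the Pochhammer factors of
  \<open>jacobi_d_sum_le\<close>; the quotient that remains is a constant times z^n/n!, and z^n/n!
  is at most exp z.\<close>

lemma summable_growth:
  assumes R: "R \<ge> 0"
    and s: "summable (\<lambda>n. \<bar>f n * (\<delta>' n * fact n * Gamma (real n + \<beta> + 1) * Gamma (real n + \<gamma> + 1) / 4 ^ n)\<bar>)"
  shows "summable (\<lambda>n. \<bar>f n\<bar> * growth R n)"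
proof -
  define L where "L = b - a"
  have L: "L > 0" using ab by (simp add: L_def)
  define c where "c n = \<delta>' n * fact n * Gamma (real n + \<beta> + 1) * Gamma (real n + \<gamma> + 1) / 4 ^ n" for n
  have G: "Gamma (\<beta> + 1) > 0" "Gamma (\<gamma> + 1) > 0" using beta gamma by (auto intro!: Gamma_real_pos)
  have po: "Gamma (real n + z + 1) = pochhammer (z + 1) n * Gamma (z + 1)" if "-1/2 \<le> z" for z n
  proof -
    have "z + 1 \<notin> \<int>\<^sub>\<le>\<^sub>0" "Gamma (z + 1) > 0" using that by (auto elim!: nonpos_Ints_cases intro!: Gamma_real_pos)
    then show ?thesis by (simp add: pochhammer_Gamma algebra_simps)
  qed
  \<comment> \<open>Collects 2^n from the binomials, (L+R)^n from the change of basis, L^(-n) from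
    \<delta>_n and the 4^n in the denominator of c_n.\<close>
  define z where "z = 8 * (L + R) / L"
  have z: "z \<ge> 0" using L R by (simp add: z_def)
  define P where "P = L powr (- (\<beta> + \<gamma> + 1) / 2)"
  have P: "P > 0" using L by (simp add: P_def)
  define K where "K = 4 * P / (Gamma (\<beta> + 1) * Gamma (\<gamma> + 1)) * exp z"
  have K: "K \<ge> 0" using G P by (simp add: K_def)
  have c_pos: "c n > 0" for n
    unfolding c_def using delta'_pos beta gamma by (intro divide_pos_pos mult_pos_pos Gamma_real_pos) auto
  have "growth R n \<le> K * c n" for n
  proof -
    have "growth R n \<le> \<bar>\<delta> n\<bar> * ((\<Sum>j\<le>n. \<bar>jacobi_d \<beta> \<gamma> n j\<bar>) * (L + R) ^ n)"
      unfolding growth_def L_def using R ab by (intro mult_left_mono jacobi_a_abs_sum_le) auto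
    also have "\<dots> \<le> \<bar>\<delta> n\<bar> * ((4 * 2 ^ n * pochhammer (\<beta> + 1) n * pochhammer (\<gamma> + 1) n) * (L + R) ^ n)"
      using beta gamma R L by (intro mult_left_mono mult_right_mono jacobi_d_sum_le) auto
    also have "\<bar>\<delta> n\<bar> = P / L ^ n * \<delta>' n"
    proof -
      have "- real n - (\<beta> + \<gamma> + 1) / 2 = - (\<beta> + \<gamma> + 1) / 2 - real n" by argo
      then have "\<bar>\<delta> n\<bar> = P / L powr real n * \<delta>' n"
        unfolding abs_delta L_def[symmetric] P_def by (simp only: powr_diff)
      then show ?thesis using L by (simp add: powr_realpow)
    qed
    also have "P / L ^ n * \<delta>' n * ((4 * 2 ^ n * pochhammer (\<beta> + 1) n * pochhammer (\<gamma> + 1) n) * (L + R) ^ n)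
       = (4 * P / (Gamma (\<beta> + 1) * Gamma (\<gamma> + 1)) * c n) * (z ^ n / fact n)"
    proof -
      have e8: "(8::real) ^ n = 2 ^ n * 4 ^ n" by (simp add: power_mult_distrib[symmetric])
      have "P / Ln * d * ((4 * t * pb * pc) * M) = (4 * P / (gb * gc) * (d * F * (pb * gb) * (pc * gc) / Q)) * ((t * Q * M / Ln) / F)"
        if "F > 0" "Ln > 0" "gb > 0" "gc > 0" "Q > 0" for F Ln gb gc Q d t pb pc M :: real
        using that by (simp add: field_simps)
      from this[of "fact n" "L ^ n" "Gamma (\<beta> + 1)" "Gamma (\<gamma> + 1)" "4 ^ n"]
      show ?thesis unfolding c_def z_def power_divide power_mult_distrib e8 po[OF beta(1)] po[OF gamma(1)]
        using G L by simp
    qed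
    also have "\<dots> \<le> (4 * P / (Gamma (\<beta> + 1) * Gamma (\<gamma> + 1)) * c n) * exp z"
    proof (intro mult_left_mono)
      have "(\<Sum>i\<in>{n}. z ^ i /\<^sub>R fact i) \<le> (\<Sum>i. z ^ i /\<^sub>R fact i)"
        using z by (intro sum_le_suminf summable_exp_generic) auto
      then show "z ^ n / fact n \<le> exp z" by (simp add: exp_def divide_inverse mult.commute)
    qed (use G P c_pos[of n] in auto)
    finally show ?thesis by (simp add: K_def mult_ac)
  qed
  then have le: "\<bar>f n\<bar> * growth R n \<le> K * \<bar>f n * c n\<bar>" for n
    using c_pos[of n] mult_left_mono[of "growth R n" "K * c n" "\<bar>f n\<bar>"] by (simp add: abs_mult mult_ac)
  have "summable (\<lambda>n. K * \<bar>f n * c n\<bar>)" using s unfolding c_def by (rule summable_mult)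
  then show ?thesis
  proof (rule summable_comparison_test'[where N = 0])
    fix n :: nat
    have "norm (\<bar>f n\<bar> * growth R n) = \<bar>f n\<bar> * growth R n"
      by (simp only: real_norm_def abs_mult abs_abs abs_of_nonneg[OF growth_nonneg[OF R]])
    then show "norm (\<bar>f n\<bar> * growth R n) \<le> K * \<bar>f n * c n\<bar>" using le[of n] by (simp only:)
  qed
qed

end

text \<open>\<open>alpha_gamma\<close> says that (b-x)^\<alpha> is square integrable for the weight,
  or equivalently that \<lambda> > 1/2.\<close>

locale abel_jacobi = jacobi +
  fixes \<alpha> :: real
  assumes alpha: "-1 < \<alpha>" "\<alpha> \<le> 0" and alpha_gamma: "2 * \<alpha> + \<gamma> + 1 > 0"
begin

text \<open>The multiplier of the operator of order \<alpha>, which sends (b-x)^k to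
  \<open>\<kappa> k\<close> times (b-x)^(k+\<alpha>).\<close>

abbreviation "\<kappa> k \<equiv> fact k / Gamma (real k + 1 + \<alpha>)"
abbreviation "decay m \<equiv> (real m + 1) powr (- (2 * \<alpha> + \<gamma> + 3/2))"

definition "q n x = \<delta> n * (\<Sum>k\<le>n. A n k * \<kappa> k * (b - x) powr (real k + \<alpha>))"

lemma Gamma_k_pos: "Gamma (real k + 1 + \<alpha>) > 0"
  using alpha by (intro Gamma_real_pos) auto

text \<open>For \<alpha> < 0 the kernel integral is found in closed form on the whole interval by
  Beta integrals, so that it can be differentiated at x; the factor k+\<alpha>+1 from the derivative
  cancels against the Beta value and leaves \<open>\<kappa> k\<close>.\<close>

lemma frac_op_p:
  assumes x: "x \<in> {a<..<b}"
  shows "frac_op b \<alpha> (p n) x = q n x"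
proof (cases "\<alpha> = 0")
  case True
  have g: "\<kappa> k = 1" for k
    using True Gamma_fact[of k, where 'a = real] by (simp add: add.commute)
  have pw: "(b - x) powr (real k + \<alpha>) = (b - x) ^ k" for k
    using True x by (simp add: powr_realpow)
  have "frac_op b \<alpha> (p n) x = p n x"
    by (simp add: True frac_op_def frac_integral_def)
  then show ?thesis unfolding q_def g pw p_eq_sum_a[OF x] by simp
next
  case False
  then have al: "\<alpha> < 0" using alpha by simp
  have int: "(LINT t:{y<..<b}|lebesgue. p n t * (t - y) powr \<alpha>)
     = \<delta> n * (\<Sum>k\<le>n. A n k * ((b - y) powr (real k + \<alpha> + 1) * Beta (\<alpha> + 1) (real k + 1)))"
    if y: "y \<in> {a<..<b}" for y
  proof -
    let ?R = "lebesgue_on {y<..<b}"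
    have yb: "y < b" using y by simp
    have "(LINT t:{y<..<b}|lebesgue. p n t * (t - y) powr \<alpha>) = (LINT t|?R. p n t * (t - y) powr \<alpha>)"
      by (rule set_integral_restrict_space) auto
    also have "\<dots> = (LINT t|?R. \<delta> n * (\<Sum>k\<le>n. A n k * ((b - t) powr real k * (t - y) powr \<alpha>)))"
      using y by (intro Bochner_Integration.integral_cong refl)
        (auto simp: space_restrict_space p_eq_sum_a sum_distrib_right powr_realpow mult.assoc)
    also have "\<dots> = \<delta> n * (\<Sum>k\<le>n. A n k * (LINT t|?R. (b - t) powr real k * (t - y) powr \<alpha>))"
      using alpha by (subst Bochner_Integration.integral_mult_right_zero, subst Bochner_Integration.integral_sum)
        (auto intro!: integrable_mult_right right_kernel_integral yb)
    finally show ?thesis using alpha by (simp add: right_kernel_integral[OF yb])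
  qed
  have "((\<lambda>y. \<delta> n * (\<Sum>k\<le>n. A n k * ((b - y) powr (real k + \<alpha> + 1) * Beta (\<alpha> + 1) (real k + 1)))) has_field_derivative
      \<delta> n * (\<Sum>k\<le>n. A n k * (- (real k + \<alpha> + 1) * (b - x) powr (real k + \<alpha>) * Beta (\<alpha> + 1) (real k + 1)))) (at x)"
    using x by (intro DERIV_cmult DERIV_sum) (auto intro!: derivative_eq_intros simp: algebra_simps)
  then have "((\<lambda>y. LINT t:{y<..<b}|lebesgue. p n t * (t - y) powr \<alpha>) has_field_derivative
      \<delta> n * (\<Sum>k\<le>n. A n k * (- (real k + \<alpha> + 1) * (b - x) powr (real k + \<alpha>) * Beta (\<alpha> + 1) (real k + 1)))) (at x)"
    by (rule has_field_derivative_transform_within_open[of _ _ _ "{a<..<b}"]) (use x int in auto)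
  then have "deriv (\<lambda>y. LINT t:{y<..<b}|lebesgue. p n t * (t - y) powr \<alpha>) x
      = \<delta> n * (\<Sum>k\<le>n. A n k * (- (real k + \<alpha> + 1) * (b - x) powr (real k + \<alpha>) * Beta (\<alpha> + 1) (real k + 1)))"
    by (rule DERIV_imp_deriv)
  then have "frac_op b \<alpha> (p n) x = - (1 / Gamma (1 + \<alpha>)) * (\<delta> n * (\<Sum>k\<le>n. A n k * (- (real k + \<alpha> + 1) * (b - x) powr (real k + \<alpha>) * Beta (\<alpha> + 1) (real k + 1))))"
    using al by (simp add: frac_op_def frac_derivative_def)
  also have "\<dots> = \<delta> n * (\<Sum>k\<le>n. - (1 / Gamma (1 + \<alpha>)) * (A n k * (- (real k + \<alpha> + 1) * (b - x) powr (real k + \<alpha>) * Beta (\<alpha> + 1) (real k + 1))))"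
    by (simp only: sum_distrib_left mult.left_commute)
  also have "\<dots> = q n x"
    unfolding q_def
  proof (intro arg_cong[where f = "\<lambda>z. \<delta> n * z"] sum.cong refl)
    fix k
    have G1: "Gamma (1 + \<alpha>) > 0" using alpha by (intro Gamma_real_pos) auto
    have "Gamma (real k + 1 + \<alpha> + 1) = (real k + 1 + \<alpha>) * Gamma (real k + 1 + \<alpha>)"
      using alpha by (intro Gamma_plus1) (auto elim!: nonpos_Ints_cases)
    then have B: "Beta (\<alpha> + 1) (real k + 1) = Gamma (1 + \<alpha>) * fact k / ((real k + \<alpha> + 1) * Gamma (real k + 1 + \<alpha>))"
      using Gamma_fact[of k, where 'a = real] by (simp add: Beta_def add_ac)
    have S0: "real k + \<alpha> + 1 > 0" using alpha by simp
    have cancel: "- (1 / g) * (X * (- S * P * (g * F / (S * H)))) = X * (F / H) * P"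
      if "g > 0" "H > 0" "S > 0" for g P F H X S :: real
      using that by (simp add: field_simps)
    show "- (1 / Gamma (1 + \<alpha>)) * (A n k * (- (real k + \<alpha> + 1) * (b - x) powr (real k + \<alpha>) * Beta (\<alpha> + 1) (real k + 1)))
       = A n k * \<kappa> k * (b - x) powr (real k + \<alpha>)"
      unfolding B by (rule cancel[OF G1 Gamma_k_pos S0])
  qed
  finally show ?thesis .
qed

text \<open>The quotient is of order (k+1)^(-\<alpha>) \<le> k + 1 \<le> 2^k; the exponential form
  fits into the radius of \<open>growth\<close>.\<close>

lemma fact_over_Gamma_bound:
  obtains C where "C > 0" "\<And>k. \<kappa> k \<le> C * 2 ^ k"
proof -
  have a1: "\<alpha> + 1 > 0" using alpha by simp
  obtain c where c: "c > 0" "\<And>n. c * (fact n * (real n + 1) powr (\<alpha> + 1 - 1)) \<le> Gamma (real n + (\<alpha> + 1))"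
    by (rule Gamma_fact_powr_bounds[OF a1]) (rule that)
  have "\<kappa> k \<le> 1 / c * 2 ^ k" for k
  proof -
    have "\<kappa> k \<le> fact k / (c * (fact k * (real k + 1) powr \<alpha>))"
      using c(1) c(2)[of k] by (intro divide_left_mono mult_pos_pos Gamma_k_pos) (auto simp: add_ac)
    also have "\<dots> = 1 / c * (real k + 1) powr (- \<alpha>)" by (simp add: powr_minus field_simps)
    also have "(real k + 1) powr (- \<alpha>) \<le> (real k + 1) powr 1"
      using alpha by (intro powr_mono) auto
    also have "\<dots> \<le> 2 ^ k"
    proof -
      have "Suc k \<le> 2 ^ k" by (induction k) auto
      then have "real (Suc k) \<le> real (2 ^ k)" by (simp only: of_nat_le_iff)
      then show ?thesis by simp
    qed
    finally show ?thesis using c by (simp add: mult_left_mono divide_right_mono)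
  qed
  moreover have "1 / c > 0" using c by simp
  ultimately show ?thesis by (rule that[rotated])
qed

text \<open>The singularity (b-x)^\<alpha> is common to all n and splits off; the 2 in the radius
  pays for \<open>\<kappa> k\<close>.\<close>

lemma q_bound:
  obtains C where "C > 0" "\<And>n x. x \<in> {a<..<b} \<Longrightarrow> \<bar>q n x\<bar> \<le> C * growth (2 * (b - a)) n * (b - x) powr \<alpha>"
proof -
  obtain C where C: "C > 0" "\<And>k. \<kappa> k \<le> C * 2 ^ k"
    by (rule fact_over_Gamma_bound) (rule that)
  have "\<bar>q n x\<bar> \<le> C * growth (2 * (b - a)) n * (b - x) powr \<alpha>" if x: "x \<in> {a<..<b}" for n x
  proof -
    have "\<bar>q n x\<bar> \<le> \<bar>\<delta> n\<bar> * (\<Sum>k\<le>n. \<bar>A n k * \<kappa> k * (b - x) powr (real k + \<alpha>)\<bar>)"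
      unfolding q_def abs_mult[of "\<delta> n"] by (intro mult_left_mono sum_abs) auto
    also have "\<dots> \<le> \<bar>\<delta> n\<bar> * (\<Sum>k\<le>n. \<bar>A n k\<bar> * (C * 2 ^ k) * ((b - a) ^ k * (b - x) powr \<alpha>))"
    proof (intro mult_left_mono sum_mono)
      fix k
      have "(b - x) powr (real k + \<alpha>) \<le> (b - a) ^ k * (b - x) powr \<alpha>"
        using x by (auto simp: powr_add powr_realpow intro!: mult_right_mono power_mono)
      then show "\<bar>A n k * \<kappa> k * (b - x) powr (real k + \<alpha>)\<bar>
          \<le> \<bar>A n k\<bar> * (C * 2 ^ k) * ((b - a) ^ k * (b - x) powr \<alpha>)"
        using C(2)[of k] C(1) Gamma_k_pos[of k] unfolding abs_mult
        by (intro mult_mono) (auto simp: abs_of_pos)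
    qed auto
    also have "\<dots> = C * growth (2 * (b - a)) n * (b - x) powr \<alpha>"
    proof -
      have "\<bar>A n k\<bar> * (C * 2 ^ k) * ((b - a) ^ k * (b - x) powr \<alpha>) = (C * (b - x) powr \<alpha>) * (\<bar>A n k\<bar> * (2 * (b - a)) ^ k)" for k
        by (simp only: power_mult_distrib mult_ac)
      then show ?thesis by (simp only: growth_def sum_distrib_left[symmetric]) (simp only: mult_ac)
    qed
    finally show ?thesis .
  qed
  then show ?thesis by (rule that[OF C(1)])
qed

lemma alpha_gamma': "\<gamma> + \<alpha> > -1" using alpha alpha_gamma by simp

text \<open>In the exact formula \<delta>'_m is O(m^(1/2)/m!), the Pochhammer symbol O(m!
  m^(-\<alpha>-1)) and the Beta value O(m^(-\<gamma>-\<alpha>-1)), each read with m + 1 in the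
  powers; the product has exponent -\<lambda>. The dependence on k is (k+1)(2L)^k, at most
  (4L)^k.\<close>

lemma powr_p_coeff_bound:
  obtains C where "C > 0"
    "\<And>k m. \<bar>\<integral>x. (b - x) powr (real k + \<alpha>) * p m x \<partial>J\<bar>
       \<le> C * (4 * (b - a)) ^ k * decay m"
proof -
  obtain C1 where C1: "C1 > 0" "\<And>n. \<delta>' n \<le> C1 * ((real n + 1) powr (1/2) / fact n)"
    by (rule delta'_bound) (rule that)
  obtain C2 where C2: "C2 > 0"
    "\<And>n k. \<bar>pochhammer (- \<alpha> - real k) n\<bar> \<le> C2 * (real k + 1) * 2 ^ k * (fact n * (real n + 1) powr (- \<alpha> - 1))"
  proof (rule abs_pochhammer_shift_bound[of "- \<alpha>"])
    fix C assume "C > 0" "\<And>n k. \<bar>pochhammer (- \<alpha> - real k) n\<bar> \<le> C * (real k + 1) * 2 ^ k * (fact n * (real n + 1) powr (- \<alpha> - 1))"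
    then show thesis by (rule that)
  qed (use alpha in auto)
  have bp: "\<beta> + 1 > 0" "\<beta> + \<gamma> + \<alpha> + 2 > 0" using beta alpha_gamma' by auto
  obtain C3 where C3: "C3 > 0" "\<And>n. Gamma (real n + (\<beta> + 1)) \<le> C3 * (fact n * (real n + 1) powr (\<beta> + 1 - 1))"
    by (rule Gamma_fact_powr_bounds[OF bp(1)]) (rule that)
  obtain c4 where c4: "c4 > 0" "\<And>n. c4 * (fact n * (real n + 1) powr (\<beta> + \<gamma> + \<alpha> + 2 - 1)) \<le> Gamma (real n + (\<beta> + \<gamma> + \<alpha> + 2))"
    by (rule Gamma_fact_powr_bounds[OF bp(2)]) (rule that)
  have e4: "\<beta> + \<gamma> + \<alpha> + 2 - 1 = \<beta> + (\<gamma> + \<alpha> + 1)" by simp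
  note c4 = c4[unfolded e4]
  have Gg: "Gamma (\<gamma> + \<alpha> + 1) > 0" using alpha_gamma' by (intro Gamma_real_pos) auto
  define L where "L = b - a"
  have L: "L > 0" using ab by (simp add: L_def)
  define C where "C = C1 * L powr ((\<beta> + \<gamma> + 1) / 2 + \<alpha>) * C2 * (C3 * Gamma (\<gamma> + \<alpha> + 1) / c4)"
  have C: "C > 0" using C1 C2 C3 c4 Gg L by (simp add: C_def)
  have beta_bound: "Beta (\<beta> + real m + 1) (\<gamma> + (real k + \<alpha>) + 1)
      \<le> C3 * Gamma (\<gamma> + \<alpha> + 1) / c4 * (real m + 1) powr (- (\<gamma> + \<alpha> + 1))" for m k
  proof -
    \<comment> \<open>Beta decreases in its second argument, so the value at k = 0 serves all k
      uniformly.\<close>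
    have "Beta (\<beta> + real m + 1) (\<gamma> + (real k + \<alpha>) + 1) \<le> Beta (\<beta> + real m + 1) (\<gamma> + \<alpha> + 1)"
      using beta alpha_gamma' by (intro Beta_real_mono) auto
    also have "\<dots> = Gamma (real m + (\<beta> + 1)) * Gamma (\<gamma> + \<alpha> + 1) / Gamma (real m + (\<beta> + \<gamma> + \<alpha> + 2))"
      by (simp add: Beta_def add_ac)
    also have "\<dots> \<le> (C3 * (fact m * (real m + 1) powr (\<beta> + 1 - 1))) * Gamma (\<gamma> + \<alpha> + 1)
        / (c4 * (fact m * (real m + 1) powr (\<beta> + (\<gamma> + \<alpha> + 1))))"
      using C3 c4 Gg bp by (intro frac_le mult_right_mono mult_pos_pos mult_nonneg_nonneg) auto
    also have "\<dots> = C3 * Gamma (\<gamma> + \<alpha> + 1) / c4 * (real m + 1) powr (- (\<gamma> + \<alpha> + 1))"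
    proof -
      have "(C3 * (F * u)) * g / (c4 * (F * (u * v))) = C3 * g / c4 * inverse v" if "F > 0" "u > 0" "v > 0" for F u v g :: real
        using that c4 by (simp add: field_simps)
      from this[of "fact m" "(real m + 1) powr \<beta>" "(real m + 1) powr (\<gamma> + \<alpha> + 1)"]
      show ?thesis unfolding powr_add[of _ \<beta>] powr_minus by simp
    qed
    finally show ?thesis .
  qed
  have "\<bar>\<integral>x. (b - x) powr (real k + \<alpha>) * p m x \<partial>J\<bar>
       \<le> C * (4 * (b - a)) ^ k * decay m" for k m
  proof -
    have Bp: "Beta (\<beta> + real m + 1) (\<gamma> + (real k + \<alpha>) + 1) \<ge> 0"
      using beta alpha_gamma' unfolding Beta_def
      by (intro divide_nonneg_nonneg mult_nonneg_nonneg less_imp_le[OF Gamma_real_pos]) auto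
    have dl: "\<bar>\<delta> m\<bar> * L powr (\<beta> + \<gamma> + (real k + \<alpha>) + real m + 1) = \<delta>' m * (L powr ((\<beta> + \<gamma> + 1) / 2 + \<alpha>) * L ^ k)"
    proof -
      have "(- real m - (\<beta> + \<gamma> + 1) / 2) + (\<beta> + \<gamma> + (real k + \<alpha>) + real m + 1) = (\<beta> + \<gamma> + 1) / 2 + \<alpha> + real k"
        by (simp add: field_simps)
      then have "L powr (- real m - (\<beta> + \<gamma> + 1) / 2) * L powr (\<beta> + \<gamma> + (real k + \<alpha>) + real m + 1) = L powr ((\<beta> + \<gamma> + 1) / 2 + \<alpha>) * L ^ k"
        unfolding powr_add[symmetric] using L by (simp only:) (simp add: powr_add powr_realpow)
      then show ?thesis by (simp add: abs_delta L_def[symmetric] mult_ac)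
    qed
    have neg: "- (real k + \<alpha>) = - \<alpha> - real k" by simp
    have "\<bar>\<integral>x. (b - x) powr (real k + \<alpha>) * p m x \<partial>J\<bar>
      = (\<bar>\<delta> m\<bar> * L powr (\<beta> + \<gamma> + (real k + \<alpha>) + real m + 1)) * (\<bar>pochhammer (- \<alpha> - real k) m\<bar> * Beta (\<beta> + real m + 1) (\<gamma> + (real k + \<alpha>) + 1))"
    proof -
      have "\<gamma> + (real k + \<alpha>) > -1" using alpha_gamma' by simp
      note integral_powr_p(2)[OF this, of m, unfolded neg L_def[symmetric]]
      then show ?thesis using Bp by (simp only: abs_mult power_abs abs_minus_cancel abs_one power_one abs_of_nonneg[OF Bp] mult_1_left mult.assoc) simp
    qed
    also have "\<dots> = (\<delta>' m * (L powr ((\<beta> + \<gamma> + 1) / 2 + \<alpha>) * L ^ k)) * (\<bar>pochhammer (- \<alpha> - real k) m\<bar> * Beta (\<beta> + real m + 1) (\<gamma> + (real k + \<alpha>) + 1))"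
      unfolding dl ..
    also have "\<dots> \<le> ((C1 * ((real m + 1) powr (1/2) / fact m)) * (L powr ((\<beta> + \<gamma> + 1) / 2 + \<alpha>) * L ^ k))
       * ((C2 * (real k + 1) * 2 ^ k * (fact m * (real m + 1) powr (- \<alpha> - 1)))
          * (C3 * Gamma (\<gamma> + \<alpha> + 1) / c4 * (real m + 1) powr (- (\<gamma> + \<alpha> + 1))))"
      using C1 C2 L Bp less_imp_le[OF delta'_pos[of m]]
      by (intro mult_mono mult_right_mono mult_nonneg_nonneg beta_bound C1(2) C2(2)) auto
    also have "\<dots> = C * ((real k + 1) * (2 * L) ^ k) * ((real m + 1) powr (1/2) * (real m + 1) powr (- \<alpha> - 1) * (real m + 1) powr (- (\<gamma> + \<alpha> + 1)))"
      by (simp add: C_def power_mult_distrib mult_ac)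
    also have "(real m + 1) powr (1/2) * (real m + 1) powr (- \<alpha> - 1) * (real m + 1) powr (- (\<gamma> + \<alpha> + 1)) = decay m"
      unfolding powr_add[symmetric] by (rule arg_cong[where f = "(powr) (real m + 1)"]) (simp add: field_simps)
    also have "C * ((real k + 1) * (2 * L) ^ k) * decay m \<le> C * (2 ^ k * (2 * L) ^ k) * decay m"
    proof -
      have "Suc k \<le> 2 ^ k" by (induction k) auto
      then have "real (Suc k) \<le> real (2 ^ k)" by (simp only: of_nat_le_iff)
      then have "real k + 1 \<le> 2 ^ k" by simp
      then show ?thesis using C L by (intro mult_right_mono mult_left_mono) auto
    qed
    also have "2 ^ k * (2 * L) ^ k = (4 * (b - a)) ^ k" by (simp add: L_def power_mult_distrib[symmetric])
    finally show ?thesis .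
  qed
  then show ?thesis by (rule that[OF C])
qed

lemma q_measurable [measurable]: "q n \<in> borel_measurable J"
proof -
  have "(\<lambda>x. \<delta> n * (\<Sum>k\<le>n. A n k * \<kappa> k * (b - x) powr (real k + \<alpha>))) \<in> borel_measurable borel"
    by measurable
  also have "(\<lambda>x. \<delta> n * (\<Sum>k\<le>n. A n k * \<kappa> k * (b - x) powr (real k + \<alpha>))) = q n"
    by (rule ext) (simp only: q_def)
  finally show ?thesis by (rule borel_measurable_J)
qed

text \<open>The radius 8(b-a) is the 2 from \<open>\<kappa> k\<close> times the 4(b-a) from the
  coefficients of the powers.\<close>

lemma q_coeff_bound:
  obtains C where "C > 0"
    "\<And>n m. \<bar>\<integral>x. q n x * p m x \<partial>J\<bar> \<le> C * growth (8 * (b - a)) n * decay m"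
proof -
  obtain C1 where C1: "C1 > 0"
    "\<And>k m. \<bar>\<integral>x. (b - x) powr (real k + \<alpha>) * p m x \<partial>J\<bar>
       \<le> C1 * (4 * (b - a)) ^ k * decay m"
  proof (rule powr_p_coeff_bound)
    fix C assume "C > 0" "\<And>k m. \<bar>\<integral>x. (b - x) powr (real k + \<alpha>) * p m x \<partial>J\<bar>
       \<le> C * (4 * (b - a)) ^ k * decay m"
    then show thesis by (rule that)
  qed
  obtain C2 where C2: "C2 > 0" "\<And>k. \<kappa> k \<le> C2 * 2 ^ k"
    by (rule fact_over_Gamma_bound) (rule that)
  have "\<bar>\<integral>x. q n x * p m x \<partial>J\<bar> \<le> C1 * C2 * growth (8 * (b - a)) n * decay m" for n m
  proof -
    let ?I = "\<lambda>k. \<integral>x. (b - x) powr (real k + \<alpha>) * p m x \<partial>J"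
    let ?l = "decay m"
    have i: "integrable J (\<lambda>x. (b - x) powr (real k + \<alpha>) * p m x)" for k
      using alpha_gamma' by (intro integral_powr_p) auto
    have "(LINT x|J. q n x * p m x) = (LINT x|J. \<delta> n * (\<Sum>k\<le>n. (A n k * \<kappa> k) * ((b - x) powr (real k + \<alpha>) * p m x)))"
      by (simp only: q_def sum_distrib_right mult.assoc)
    also have "\<dots> = \<delta> n * (LINT x|J. (\<Sum>k\<le>n. (A n k * \<kappa> k) * ((b - x) powr (real k + \<alpha>) * p m x)))"
      by (rule integral_mult_right_zero)
    also have "(LINT x|J. (\<Sum>k\<le>n. (A n k * \<kappa> k) * ((b - x) powr (real k + \<alpha>) * p m x)))
        = (\<Sum>k\<le>n. \<integral>x. (A n k * \<kappa> k) * ((b - x) powr (real k + \<alpha>) * p m x) \<partial>J)"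
      by (rule Bochner_Integration.integral_sum) (rule integrable_mult_right, rule i)
    also have "\<dots> = (\<Sum>k\<le>n. (A n k * \<kappa> k) * ?I k)"
      by (intro sum.cong refl integral_mult_right_zero)
    finally have "\<bar>\<integral>x. q n x * p m x \<partial>J\<bar> = \<bar>\<delta> n * (\<Sum>k\<le>n. (A n k * \<kappa> k) * ?I k)\<bar>"
      by (rule arg_cong)
    also have "\<bar>\<delta> n * (\<Sum>k\<le>n. (A n k * \<kappa> k) * ?I k)\<bar> \<le> \<bar>\<delta> n\<bar> * (\<Sum>k\<le>n. \<bar>(A n k * \<kappa> k) * ?I k\<bar>)"
      unfolding abs_mult[of "\<delta> n"] by (intro mult_left_mono sum_abs) auto
    also have "\<dots> \<le> \<bar>\<delta> n\<bar> * (\<Sum>k\<le>n. \<bar>A n k\<bar> * (C2 * 2 ^ k) * (C1 * (4 * (b - a)) ^ k * ?l))"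
    proof (intro mult_left_mono sum_mono)
      fix k
      have f0: "\<bar>\<kappa> k\<bar> \<le> C2 * 2 ^ k"
      proof -
        have "\<kappa> k > 0" by (intro divide_pos_pos Gamma_k_pos) simp
        then show ?thesis using C2(2)[of k] by linarith
      qed
      show "\<bar>A n k * \<kappa> k * ?I k\<bar> \<le> \<bar>A n k\<bar> * (C2 * 2 ^ k) * (C1 * (4 * (b - a)) ^ k * ?l)"
        unfolding abs_mult[of "A n k * _"] abs_mult[of "A n k"]
        using C2(1) by (intro mult_mono f0 C1(2) mult_nonneg_nonneg) auto
    qed auto
    also have "\<dots> = C1 * C2 * growth (8 * (b - a)) n * ?l"
    proof -
      have p8: "(2::real) ^ k * (4 * (b - a)) ^ k = (8 * (b - a)) ^ k" for k
        by (simp add: power_mult_distrib[symmetric])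
      have "\<bar>A n k\<bar> * (C2 * 2 ^ k) * (C1 * (4 * (b - a)) ^ k * ?l) = (C1 * C2 * ?l) * (\<bar>A n k\<bar> * (8 * (b - a)) ^ k)" for k
      proof -
        have "x * (C2 * u) * (C1 * v * l) = (C1 * C2 * l) * (x * (u * v))" for x u v l :: real
          by (simp only: mult_ac)
        then show ?thesis by (simp only: p8)
      qed
      then have "(\<Sum>k\<le>n. \<bar>A n k\<bar> * (C2 * 2 ^ k) * (C1 * (4 * (b - a)) ^ k * ?l))
          = (C1 * C2 * ?l) * (\<Sum>k\<le>n. \<bar>A n k\<bar> * (8 * (b - a)) ^ k)"
        unfolding sum_distrib_left by (intro sum.cong refl)
      then show ?thesis unfolding growth_def by (simp only: mult_ac)
    qed
    finally show ?thesis .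
  qed
  then show ?thesis by (rule that[OF mult_pos_pos[OF C1(1) C2(1)]])
qed

end

section \<open>The solution of the Abel equation\<close>

text \<open>A bound with separated variables, K n times h x, gives absolute summability both
  pointwise and under the integral, so sum and integral commute against any bounded u. It serves for
  the series of \<psi>, for the Abel kernel and for the series of f.\<close>

lemma dominated_series:
  fixes g :: "nat \<Rightarrow> 'a \<Rightarrow> real" and c K :: "nat \<Rightarrow> real"
  assumes g: "\<And>n. g n \<in> borel_measurable M"
    and h: "integrable M h"
    and bound: "\<And>n x. x \<in> space M \<Longrightarrow> \<bar>g n x\<bar> \<le> K n * h x"
    and u: "u \<in> borel_measurable M" "\<And>x. x \<in> space M \<Longrightarrow> \<bar>u x\<bar> \<le> B"
    and s: "summable (\<lambda>n. \<bar>c n\<bar> * K n)"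
  shows "\<And>x. x \<in> space M \<Longrightarrow> summable (\<lambda>n. \<bar>c n * g n x\<bar>)"
    and "integrable M (\<lambda>x. (\<Sum>n. c n * g n x) * u x)"
    and "(\<lambda>n. c n * (LINT x|M. g n x * u x)) sums (LINT x|M. (\<Sum>n. c n * g n x) * u x)"
proof -
  have le: "\<bar>c n * g n x\<bar> \<le> \<bar>c n\<bar> * K n * h x" if "x \<in> space M" for n x
    using mult_left_mono[OF bound[OF that], of "\<bar>c n\<bar>" n] by (simp add: abs_mult mult.assoc)
  show sx: "summable (\<lambda>n. \<bar>c n * g n x\<bar>)" if "x \<in> space M" for x
    by (rule summable_comparison_test'[OF summable_mult2[OF s, of "h x"], of 0])
       (use le[OF that] in simp)
  let ?f = "\<lambda>n x. c n * (g n x * u x)"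
  have leu: "\<bar>?f n x\<bar> \<le> \<bar>c n\<bar> * K n * (\<bar>B\<bar> * h x)" if x: "x \<in> space M" for n x
  proof -
    have "\<bar>?f n x\<bar> = \<bar>c n * g n x\<bar> * \<bar>u x\<bar>" by (simp add: abs_mult)
    also have "\<dots> \<le> (\<bar>c n\<bar> * K n * h x) * \<bar>B\<bar>"
    proof (rule mult_mono)
      show "\<bar>u x\<bar> \<le> \<bar>B\<bar>" using u(2)[OF x] by linarith
      show "0 \<le> \<bar>c n\<bar> * K n * h x" using le[OF x, of n] abs_ge_zero[of "c n * g n x"] by linarith
    qed (use le[OF x] in auto)
    finally show ?thesis by (simp add: mult_ac)
  qed
  have i: "integrable M (?f n)" for n
  proof (rule Bochner_Integration.integrable_bound)
    show "integrable M (\<lambda>x. \<bar>c n\<bar> * K n * (\<bar>B\<bar> * h x))" using h by simp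
    show "?f n \<in> borel_measurable M" using g u(1) by measurable
    show "AE x in M. norm (?f n x) \<le> norm (\<bar>c n\<bar> * K n * (\<bar>B\<bar> * h x))"
    proof (rule AE_I2)
      fix x assume "x \<in> space M"
      from order_trans[OF leu[OF this] abs_ge_self]
      show "norm (?f n x) \<le> norm (\<bar>c n\<bar> * K n * (\<bar>B\<bar> * h x))" by (simp only: real_norm_def)
    qed
  qed
  have ae: "AE x in M. summable (\<lambda>n. norm (?f n x))"
  proof (rule AE_I2)
    fix x assume x: "x \<in> space M"
    have "summable (\<lambda>n. \<bar>c n\<bar> * K n * (\<bar>B\<bar> * h x))" by (rule summable_mult2[OF s])
    then show "summable (\<lambda>n. norm (?f n x))"
      by (rule summable_comparison_test'[where N = 0]) (use leu[OF x] in simp)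
  qed
  have si: "summable (\<lambda>n. \<integral>x. norm (?f n x) \<partial>M)"
  proof (rule summable_comparison_test'[OF summable_mult2[OF s, of "\<bar>B\<bar> * (LINT x|M. h x)"], of 0])
    fix n :: nat
    have "(LINT x|M. norm (?f n x)) \<le> (LINT x|M. \<bar>c n\<bar> * K n * (\<bar>B\<bar> * h x))"
      using i h leu by (intro integral_mono) auto
    then show "norm (LINT x|M. norm (?f n x)) \<le> \<bar>c n\<bar> * K n * (\<bar>B\<bar> * (LINT x|M. h x))"
      by simp
  qed
  have eq: "(\<Sum>n. c n * g n x) * u x = (\<Sum>n. ?f n x)" if "x \<in> space M" for x
    using suminf_mult2[OF summable_rabs_cancel[OF sx[OF that]], of "u x"] by (simp add: mult.assoc)
  have "integrable M (\<lambda>x. \<Sum>n. ?f n x)" by (rule integrable_suminf[OF i ae si])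
  also have "?this \<longleftrightarrow> integrable M (\<lambda>x. (\<Sum>n. c n * g n x) * u x)"
    using eq by (intro Bochner_Integration.integrable_cong) auto
  finally show "integrable M (\<lambda>x. (\<Sum>n. c n * g n x) * u x)" .
  have "(\<lambda>n. \<integral>x. ?f n x \<partial>M) sums (LINT x|M. (\<Sum>n. ?f n x))" by (rule sums_integral[OF i ae si])
  moreover have "(LINT x|M. (\<Sum>n. ?f n x)) = (LINT x|M. (\<Sum>n. c n * g n x) * u x)"
    using eq by (intro Bochner_Integration.integral_cong) auto
  ultimately show "(\<lambda>n. c n * (LINT x|M. g n x * u x)) sums (LINT x|M. (\<Sum>n. c n * g n x) * u x)"
    by simp
qed

section \<open>The function spaces in terms of the weighted measure\<close>

context jacobi
begin

lemma Lp_space_iff: "f \<in> Lp_space a b w s \<longleftrightarrow> f \<in> borel_measurable J \<and> integrable J (\<lambda>x. \<bar>f x\<bar> powr s)"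
proof -
  have "integrable J (\<lambda>x. \<bar>f x\<bar> powr s) \<longleftrightarrow> set_integrable lebesgue {a<..<b} (\<lambda>x. \<bar>f x\<bar> powr s * w x)"
    if [measurable]: "f \<in> borel_measurable J" by (rule integrable_J_iff) measurable
  then show ?thesis unfolding Lp_space_def measurable_J_iff[symmetric] by blast
qed

lemma Lp_norm_eq: "f \<in> borel_measurable J \<Longrightarrow> Lp_norm a b w s f = (LINT x|J. \<bar>f x\<bar> powr s) powr (1 / s)"
  unfolding Lp_norm_def by (subst integral_J_eq) auto

lemma jacobi_coeff_eq:
  assumes [measurable]: "f \<in> borel_measurable J"
  shows "jacobi_coeff a b \<beta> \<gamma> f n = (LINT x|J. f x * p n x)"
  unfolding jacobi_coeff_def by (rule integral_J_eq[symmetric]) measurable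

lemma p_bounded: obtains B where "\<And>x. x \<in> space J \<Longrightarrow> \<bar>p n x\<bar> \<le> B"
  using abs_p_le_growth[of _ n] by (intro that[of "growth (b - a) n"]) simp

text \<open>From 2|\<phi>|w \<le> \<phi>^2 w^2 + 1, where 1/w is integrable because \<beta>,
  \<gamma> \<le> 1/2. Injectivity of the fractional integral is stated for this unweighted
  integrability.\<close>

lemma set_integrable_if_L2:
  assumes "\<phi> \<in> Lp_space a b w 2"
  shows "set_integrable lebesgue {a<..<b} \<phi>"
proof -
  let ?R = "lebesgue_on {a<..<b}"
  have m: "\<phi> \<in> borel_measurable ?R" using assms by (simp add: Lp_space_iff measurable_J)
  have i1: "integrable ?R (\<lambda>x. \<bar>\<phi> x\<bar> powr 2 * w x)"
    using assms by (subst set_integral_restrict_space(2)[symmetric]) (auto simp: Lp_space_def)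
  have "set_integrable lebesgue {a<..<b} (\<lambda>t. (t - a) powr (1 - \<beta> - 1) * (b - t) powr (1 - \<gamma> - 1))"
    using beta gamma by (intro Beta_interval_integral ab) auto
  then have i2: "integrable ?R (\<lambda>t. (t - a) powr (1 - \<beta> - 1) * (b - t) powr (1 - \<gamma> - 1))"
    by (subst set_integral_restrict_space(2)[symmetric]) auto
  have "integrable ?R \<phi>"
  proof (rule Bochner_Integration.integrable_bound[OF Bochner_Integration.integrable_add[OF i1 i2] m])
    show "AE x in ?R. norm (\<phi> x) \<le> norm (\<bar>\<phi> x\<bar> powr 2 * w x + (x - a) powr (1 - \<beta> - 1) * (b - x) powr (1 - \<gamma> - 1))"
    proof (rule AE_I2)
      fix x assume "x \<in> space ?R"
      then have x: "x \<in> {a<..<b}" by (simp add: space_restrict_space)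
      have w0: "w x > 0" by (rule weight_pos[OF x])
      have inv: "(x - a) powr (1 - \<beta> - 1) * (b - x) powr (1 - \<gamma> - 1) = 1 / w x"
        by (simp add: jacobi_weight_def powr_minus field_simps)
      have "\<bar>\<phi> x\<bar> \<le> (\<phi> x)\<^sup>2 * w x + 1 / w x"
      proof -
        have "0 \<le> (\<bar>\<phi> x\<bar> * w x - 1)\<^sup>2" by simp
        then have "2 * (\<bar>\<phi> x\<bar> * w x) \<le> (\<phi> x)\<^sup>2 * (w x * w x) + 1"
          by (simp add: power2_eq_square algebra_simps abs_mult[symmetric])
        moreover have "\<bar>\<phi> x\<bar> * w x \<ge> 0" using w0 by simp
        ultimately have "\<bar>\<phi> x\<bar> * w x \<le> (\<phi> x)\<^sup>2 * (w x * w x) + 1" by linarith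
        then show ?thesis using w0 by (simp add: field_simps)
      qed
      moreover have "\<bar>\<phi> x\<bar> powr 2 = (\<phi> x)\<^sup>2" by (cases "\<phi> x = 0") (auto simp: powr_numeral)
      ultimately have "\<bar>\<phi> x\<bar> \<le> \<bar>\<phi> x\<bar> powr 2 * w x + (x - a) powr (1 - \<beta> - 1) * (b - x) powr (1 - \<gamma> - 1)"
        unfolding inv by simp
      then show "norm (\<phi> x) \<le> norm (\<bar>\<phi> x\<bar> powr 2 * w x + (x - a) powr (1 - \<beta> - 1) * (b - x) powr (1 - \<gamma> - 1))"
        unfolding real_norm_def by (rule order_trans[OF _ abs_ge_self])
    qed
  qed
  then show ?thesis by (subst set_integral_restrict_space(2)) auto
qed

end

text \<open>For z \<ge> -1/2 the chain 2z + 1 < 2z + 2 < 2z + 3 puts the two fractions on either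
  side of 1/2; a zero denominator gives \<infinity>, which is also above.\<close>

lemma pollard_two:
  assumes "-1/2 \<le> \<beta>" "-1/2 \<le> \<gamma>"
  shows "pollard \<beta> \<gamma> 2"
proof -
  have 1: "(z + 1) / (2 * z + 3) < 1/2" if "-1/2 \<le> z" for z :: real
    using that by (simp add: field_simps)
  have 2: "pollard_upper z = \<infinity> \<or> (\<exists>t > 1/2. pollard_upper z = ereal t)" if "-1/2 \<le> z" for z
  proof (cases "2 * z + 1 = 0")
    case False
    then have "2 * z + 1 > 0" using that by simp
    then have "(z + 1) / (2 * z + 1) > 1/2" by (simp add: field_simps)
    then show ?thesis using False by (auto simp: pollard_upper_def)
  qed (simp add: pollard_upper_def)
  have 3: "ereal (1/2) < min (pollard_upper \<beta>) (pollard_upper \<gamma>)"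
    using 2[OF assms(1)] 2[OF assms(2)] by auto
  have "ereal 2 = 4 * ereal (1/2)" by simp
  also have "\<dots> < 4 * min (pollard_upper \<beta>) (pollard_upper \<gamma>)"
    using 3 by (intro ereal_mult_strict_left_mono) auto
  finally have upper: "ereal 2 < 4 * min (pollard_upper \<beta>) (pollard_upper \<gamma>)" .
  have "max ((\<beta> + 1) / (2 * \<beta> + 3)) ((\<gamma> + 1) / (2 * \<gamma> + 3)) < 1/2"
    using 1[OF assms(1)] 1[OF assms(2)] by (simp only: max_less_iff_conj)
  then have "4 * max ((\<beta> + 1) / (2 * \<beta> + 3)) ((\<gamma> + 1) / (2 * \<gamma> + 3)) < 2"
    by linarith
  with upper show ?thesis unfolding pollard_def by blast
qed

text \<open>The fraction in \<beta> is at least 1/4 for \<beta> \<ge> -1/2. On the finite weighted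
  measure this makes f integrable, as the completeness argument requires.\<close>

lemma pollard_gt_one:
  assumes "-1/2 \<le> \<beta>" "pollard \<beta> \<gamma> r"
  shows "r > 1"
proof -
  have "1 \<le> 4 * ((\<beta> + 1) / (2 * \<beta> + 3))" using assms(1) by (simp add: field_simps)
  also have "\<dots> \<le> 4 * max ((\<beta> + 1) / (2 * \<beta> + 3)) ((\<gamma> + 1) / (2 * \<gamma> + 3))"
    by (intro mult_left_mono max.cobounded1) simp
  also have "\<dots> < r" using assms(2) by (simp add: pollard_def)
  finally show ?thesis .
qed

section \<open>Solving the equation by termwise inversion\<close>

context abel_jacobi
begin

lemma integrable_powr_alpha: "integrable J (\<lambda>x. (b - x) powr \<alpha>)"
proof -
  have "integrable J (\<lambda>x. (x - a) powr 0 * (b - x) powr \<alpha>)"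
    using beta alpha_gamma' by (intro powr_product_integral) auto
  also have "?this \<longleftrightarrow> ?thesis" by (intro Bochner_Integration.integrable_cong) auto
  finally show ?thesis .
qed

lemma abel_A_eq: "abel_A a b \<alpha> \<beta> \<gamma> m n = (-1) ^ m * (LINT x|J. q n x * p m x)"
proof -
  have "(LINT x:{a<..<b}|lebesgue. p m x * frac_op b \<alpha> (p n) x * w x) = (LINT x:{a<..<b}|lebesgue. (q n x * p m x) * w x)"
    by (rule set_lebesgue_integral_cong) (auto simp: frac_op_p mult_ac)
  also have "\<dots> = (LINT x|J. q n x * p m x)"
    by (rule integral_J_eq[symmetric]) measurable
  finally show ?thesis by (simp only: abel_A_def)
qed

text \<open>The Beta value of the kernel against the k-th power is Gamma(-\<alpha>) /
  \<open>\<kappa> k\<close>, so the multiplier is undone power by power.\<close>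

lemma q_kernel_integral:
  assumes al: "\<alpha> < 0" and x: "x \<in> {a<..<b}"
  shows "(LINT t|lebesgue_on {x<..<b}. q n t * (t - x) powr (- \<alpha> - 1)) = Gamma (- \<alpha>) * p n x"
proof -
  let ?R = "lebesgue_on {x<..<b}"
  have xb: "x < b" using x by simp
  let ?g = "\<lambda>k t. (b - t) powr (real k + \<alpha>) * (t - x) powr (- \<alpha> - 1)"
  have r: "real k + \<alpha> > -1" "- \<alpha> - 1 > -1" for k using alpha al by auto
  have i: "integrable ?R (?g k)" for k by (rule right_kernel_integral(1)[OF xb r])
  have v: "\<kappa> k * (LINT t|?R. ?g k t) = Gamma (- \<alpha>) * (b - x) ^ k" for k
  proof -
    have "(LINT t|?R. ?g k t) = (b - x) powr (real k + \<alpha> + (- \<alpha> - 1) + 1) * Beta (- \<alpha> - 1 + 1) (real k + \<alpha> + 1)"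
      by (rule right_kernel_integral(2)[OF xb r])
    also have "real k + \<alpha> + (- \<alpha> - 1) + 1 = real k" by simp
    also have "(b - x) powr real k = (b - x) ^ k" using xb by (simp add: powr_realpow)
    also have "Beta (- \<alpha> - 1 + 1) (real k + \<alpha> + 1) = Gamma (- \<alpha>) * Gamma (real k + 1 + \<alpha>) / fact k"
      using Gamma_fact[of k, where 'a = real] by (simp add: Beta_def add_ac)
    finally have e: "(LINT t|?R. ?g k t) = (b - x) ^ k * (Gamma (- \<alpha>) * Gamma (real k + 1 + \<alpha>) / fact k)" .
    show ?thesis unfolding e using Gamma_k_pos[of k] by simp
  qed
  have "(LINT t|?R. q n t * (t - x) powr (- \<alpha> - 1))
      = (LINT t|?R. \<delta> n * (\<Sum>k\<le>n. (A n k * \<kappa> k) * ?g k t))"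
    by (simp only: q_def sum_distrib_right mult.assoc)
  also have "\<dots> = \<delta> n * (LINT t|?R. (\<Sum>k\<le>n. (A n k * \<kappa> k) * ?g k t))"
    by (rule integral_mult_right_zero)
  also have "(LINT t|?R. (\<Sum>k\<le>n. (A n k * \<kappa> k) * ?g k t))
      = (\<Sum>k\<le>n. \<integral>t. (A n k * \<kappa> k) * ?g k t \<partial>?R)"
    by (rule Bochner_Integration.integral_sum) (rule integrable_mult_right, rule i)
  also have "\<dots> = (\<Sum>k\<le>n. (A n k * \<kappa> k) * (LINT t|?R. ?g k t))"
    by (intro sum.cong refl integral_mult_right_zero)
  also have "\<dots> = (\<Sum>k\<le>n. Gamma (- \<alpha>) * (A n k * (b - x) ^ k))"
  proof (rule sum.cong[OF refl])
    fix k
    have "(A n k * \<kappa> k) * (LINT t|?R. ?g k t) = A n k * (Gamma (- \<alpha>) * (b - x) ^ k)"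
      by (simp only: mult.assoc v)
    then show "(A n k * \<kappa> k) * (LINT t|?R. ?g k t) = Gamma (- \<alpha>) * (A n k * (b - x) ^ k)"
      by (simp only: mult.left_commute)
  qed
  also have "\<delta> n * (\<Sum>k\<le>n. Gamma (- \<alpha>) * (A n k * (b - x) ^ k)) = Gamma (- \<alpha>) * p n x"
    unfolding p_eq_sum_a[OF x] sum_distrib_left[symmetric] by (rule mult.left_commute)
  finally show ?thesis .
qed

text \<open>For \<alpha> < 0 termwise integration over (x, b) is allowed by the majorant
  (b-t)^\<alpha> (t-x)^(-\<alpha>-1), which is integrable at both ends; the identity therefore holds
  at every x and not just almost everywhere.\<close>

lemma frac_op_series:
  assumes s: "\<And>R. R \<ge> 0 \<Longrightarrow> summable (\<lambda>n. \<bar>c n\<bar> * growth R n)" and x: "x \<in> {a<..<b}"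
  shows "frac_op b (- \<alpha>) (\<lambda>t. \<Sum>n. c n * q n t) x = (\<Sum>n. c n * p n x)"
proof (cases "\<alpha> = 0")
  case True
  have "q n x = p n x" for n
    using frac_op_p[OF x, of n] True by (simp add: frac_op_def frac_integral_def)
  then show ?thesis using True by (simp add: frac_op_def frac_integral_def)
next
  case False
  then have al: "\<alpha> < 0" using alpha by simp
  let ?R = "lebesgue_on {x<..<b}"
  have xb: "x < b" using x by simp
  obtain C where C: "C > 0" "\<And>n x. x \<in> {a<..<b} \<Longrightarrow> \<bar>q n x\<bar> \<le> C * growth (2 * (b - a)) n * (b - x) powr \<alpha>"
    by (rule q_bound) (rule that)
  define g where "g n t = q n t * (t - x) powr (- \<alpha> - 1)" for n t
  have gm: "g n \<in> borel_measurable ?R" for n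
  proof -
    have "(\<lambda>t. (\<delta> n * (\<Sum>k\<le>n. A n k * \<kappa> k * (b - t) powr (real k + \<alpha>))) * (t - x) powr (- \<alpha> - 1)) \<in> borel_measurable borel"
      by measurable
    also have "(\<lambda>t. (\<delta> n * (\<Sum>k\<le>n. A n k * \<kappa> k * (b - t) powr (real k + \<alpha>))) * (t - x) powr (- \<alpha> - 1)) = g n"
      by (rule ext) (simp only: q_def g_def)
    finally show ?thesis by (intro measurable_restrict_space1 measurable_completion) simp
  qed
  have "(\<lambda>n. c n * (LINT t|?R. g n t * 1)) sums (LINT t|?R. (\<Sum>n. c n * g n t) * 1)"
  proof (rule dominated_series(3)[where B = 1 and K = "\<lambda>n. C * growth (2 * (b - a)) n"])
    show "integrable ?R (\<lambda>t. (b - t) powr \<alpha> * (t - x) powr (- \<alpha> - 1))"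
      using alpha al by (intro right_kernel_integral xb) auto
    show "\<bar>g n t\<bar> \<le> C * growth (2 * (b - a)) n * ((b - t) powr \<alpha> * (t - x) powr (- \<alpha> - 1))"
      if "t \<in> space ?R" for n t
    proof -
      have t: "t \<in> {a<..<b}" using that x by (auto simp: space_restrict_space)
      have "\<bar>g n t\<bar> = \<bar>q n t\<bar> * (t - x) powr (- \<alpha> - 1)" by (simp add: g_def abs_mult)
      also have "\<dots> \<le> (C * growth (2 * (b - a)) n * (b - t) powr \<alpha>) * (t - x) powr (- \<alpha> - 1)"
        by (intro mult_right_mono C(2) t) auto
      finally show ?thesis by (simp only: mult.assoc)
    qed
    have "summable (\<lambda>n. C * (\<bar>c n\<bar> * growth (2 * (b - a)) n))"
      using ab by (intro summable_mult s) auto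
    then show "summable (\<lambda>n. \<bar>c n\<bar> * (C * growth (2 * (b - a)) n))"
      by (simp only: mult.left_commute)
  qed (auto simp: gm)
  then have sums: "(\<lambda>n. c n * (Gamma (- \<alpha>) * p n x)) sums (LINT t|?R. (\<Sum>n. c n * g n t))"
    unfolding g_def mult_1_right q_kernel_integral[OF al x] .
  have G: "Gamma (- \<alpha>) > 0" using al by (intro Gamma_real_pos) auto
  have sp: "summable (\<lambda>n. c n * p n x)"
  proof (rule summable_comparison_test'[OF s[of "b - a"], of 0])
    show "norm (c n * p n x) \<le> \<bar>c n\<bar> * growth (b - a) n" for n
      by (simp add: abs_mult mult_left_mono abs_p_le_growth[OF x])
  qed (use ab in simp)
  have "frac_op b (- \<alpha>) (\<lambda>t. \<Sum>n. c n * q n t) x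
     = 1 / Gamma (- \<alpha>) * (LINT t:{x<..<b}|lebesgue. (\<Sum>n. c n * q n t) * (t - x) powr (- \<alpha> - 1))"
    using al by (simp add: frac_op_def frac_integral_def)
  also have "(LINT t:{x<..<b}|lebesgue. (\<Sum>n. c n * q n t) * (t - x) powr (- \<alpha> - 1))
     = (LINT t|?R. (\<Sum>n. c n * q n t) * (t - x) powr (- \<alpha> - 1))"
    by (rule set_integral_restrict_space) auto
  also have "\<dots> = (LINT t|?R. (\<Sum>n. c n * g n t))"
  proof (rule Bochner_Integration.integral_cong[OF refl])
    fix t assume "t \<in> space ?R"
    then have t: "t \<in> {a<..<b}" using x by (auto simp: space_restrict_space)
    have "summable (\<lambda>n. c n * q n t)"
    proof (rule summable_comparison_test'[of "\<lambda>n. (C * (b - t) powr \<alpha>) * (\<bar>c n\<bar> * growth (2 * (b - a)) n)" 0])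
      show "summable (\<lambda>n. (C * (b - t) powr \<alpha>) * (\<bar>c n\<bar> * growth (2 * (b - a)) n))"
        using ab by (intro summable_mult s) auto
      show "norm (c n * q n t) \<le> (C * (b - t) powr \<alpha>) * (\<bar>c n\<bar> * growth (2 * (b - a)) n)" for n
        using mult_left_mono[OF C(2)[OF t, of n], of "\<bar>c n\<bar>"] by (simp add: abs_mult mult_ac)
    qed
    from suminf_mult2[OF this, of "(t - x) powr (- \<alpha> - 1)"]
    show "(\<Sum>n. c n * q n t) * (t - x) powr (- \<alpha> - 1) = (\<Sum>n. c n * g n t)"
      by (simp only: g_def mult.assoc)
  qed
  also have "\<dots> = (\<Sum>n. Gamma (- \<alpha>) * (c n * p n x))"
    using sums by (simp only: sums_iff mult.left_commute)
  also have "\<dots> = Gamma (- \<alpha>) * (\<Sum>n. c n * p n x)" by (rule suminf_mult[OF sp])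
  finally show ?thesis using G by simp
qed

text \<open>Two constructions meet here: \<psi>, defined pointwise through q_n, and the L_t sum T of
  the Jacobi series with the coefficients of \<psi>. Both are integrable with the same coefficients,
  so completeness identifies them. The condition on t is t(s - \<lambda>) < 2s - 1 written
  out.\<close>

lemma jacobi_series_Lp:
  assumes s: "\<And>R. R \<ge> 0 \<Longrightarrow> summable (\<lambda>n. \<bar>c n\<bar> * growth R n)"
  defines "\<psi> \<equiv> \<lambda>x. \<Sum>n. c n * q n x"
  shows "\<psi> \<in> borel_measurable J" "integrable J \<psi>"
    and "\<And>m. (\<lambda>n. c n * abel_A a b \<alpha> \<beta> \<gamma> m n) sums ((-1) ^ m * (LINT x|J. \<psi> x * p m x))"
    and "\<And>t. t \<ge> 2 \<Longrightarrow> t * (max \<beta> \<gamma> + 1/2 + 1 - (2 * \<alpha> + \<gamma> + 3/2)) < 2 * (max \<beta> \<gamma> + 1/2) + 1 \<Longrightarrow>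
      integrable J (\<lambda>x. \<bar>\<psi> x\<bar> powr t) \<and>
      (\<lambda>N. \<integral>x. \<bar>(\<Sum>m<N. (LINT x|J. \<psi> x * p m x) * p m x) - \<psi> x\<bar> powr t \<partial>J) \<longlonglongrightarrow> 0"
proof -
  obtain C where C: "C > 0" "\<And>n x. x \<in> {a<..<b} \<Longrightarrow> \<bar>q n x\<bar> \<le> C * growth (2 * (b - a)) n * (b - x) powr \<alpha>"
    by (rule q_bound) (rule that)
  obtain D where D: "D > 0"
    "\<And>n m. \<bar>\<integral>x. q n x * p m x \<partial>J\<bar> \<le> D * growth (8 * (b - a)) n * decay m"
    by (rule q_coeff_bound) (rule that)
  have "summable (\<lambda>n. C * (\<bar>c n\<bar> * growth (2 * (b - a)) n))"
    using ab by (intro summable_mult s) auto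
  then have sC: "summable (\<lambda>n. \<bar>c n\<bar> * (C * growth (2 * (b - a)) n))"
    by (simp only: mult.left_commute)
  have bnd: "\<bar>q n x\<bar> \<le> (C * growth (2 * (b - a)) n) * (b - x) powr \<alpha>" if "x \<in> space J" for n x
    using C(2) that by simp
  note dom = dominated_series[where g = q and M = J and c = c, OF q_measurable integrable_powr_alpha bnd _ _ sC]
  have "integrable J (\<lambda>x. (\<Sum>n. c n * q n x) * 1)"
    by (rule dom(2)[where B = 1]) auto
  then show \<psi>_int: "integrable J \<psi>" by (simp add: \<psi>_def)
  then show [measurable]: "\<psi> \<in> borel_measurable J" by auto
  have coeff: "(\<lambda>n. c n * (LINT x|J. q n x * p m x)) sums (LINT x|J. \<psi> x * p m x)" for m
  proof -
    obtain B where "\<And>x. x \<in> space J \<Longrightarrow> \<bar>p m x\<bar> \<le> B" by (rule p_bounded) (rule that)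
    then show ?thesis unfolding \<psi>_def by (intro dom(3) p_measurable)
  qed
  show "(\<lambda>n. c n * abel_A a b \<alpha> \<beta> \<gamma> m n) sums ((-1) ^ m * (LINT x|J. \<psi> x * p m x))" for m
    using sums_mult[OF coeff[of m], of "(-1) ^ m"] by (simp only: abel_A_eq mult.left_commute)
  define S where "S = (\<Sum>n. \<bar>c n\<bar> * growth (8 * (b - a)) n)"
  have s8: "summable (\<lambda>n. \<bar>c n\<bar> * growth (8 * (b - a)) n)" using ab by (intro s) auto
  \<comment> \<open>The bound on the coefficients of q_n separates n from m, so summing over n
    leaves the decay in m intact.\<close>
  have cb: "\<bar>\<integral>x. \<psi> x * p m x \<partial>J\<bar> \<le> (D * S) * decay m" for m
  proof -
    let ?l = "decay m"
    have le: "\<bar>c n * (LINT x|J. q n x * p m x)\<bar> \<le> (D * ?l) * (\<bar>c n\<bar> * growth (8 * (b - a)) n)" for n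
      using mult_left_mono[OF D(2)[of n m], of "\<bar>c n\<bar>"] by (simp add: abs_mult mult_ac)
    have sm: "summable (\<lambda>n. (D * ?l) * (\<bar>c n\<bar> * growth (8 * (b - a)) n))" by (rule summable_mult[OF s8])
    have sa: "summable (\<lambda>n. \<bar>c n * (LINT x|J. q n x * p m x)\<bar>)"
      by (rule summable_comparison_test'[OF sm, of 0]) (use le in simp)
    have "\<bar>\<integral>x. \<psi> x * p m x \<partial>J\<bar> = \<bar>\<Sum>n. c n * (LINT x|J. q n x * p m x)\<bar>"
      using coeff[of m] by (simp only: sums_iff)
    also have "\<dots> \<le> (\<Sum>n. \<bar>c n * (LINT x|J. q n x * p m x)\<bar>)" by (rule summable_rabs[OF sa])
    also have "\<dots> \<le> (\<Sum>n. (D * ?l) * (\<bar>c n\<bar> * growth (8 * (b - a)) n))" by (rule suminf_le[OF le sa sm])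
    also have "\<dots> = (D * ?l) * S" unfolding S_def by (rule suminf_mult[OF s8])
    finally show ?thesis by (simp only: mult_ac)
  qed
  fix t :: real
  assume t: "t \<ge> 2" "t * (max \<beta> \<gamma> + 1/2 + 1 - (2 * \<alpha> + \<gamma> + 3/2)) < 2 * (max \<beta> \<gamma> + 1/2) + 1"
  obtain E where E: "E \<ge> 0" "\<And>n x. x \<in> {a<..<b} \<Longrightarrow> \<bar>p n x\<bar> \<le> E * (real n + 1) powr (max \<beta> \<gamma> + 1/2)"
    by (rule p_sup_bound) (rule that)
  interpret bo: bounded_orthonormal J p E "max \<beta> \<gamma> + 1/2"
    by unfold_locales (use E p_orthonormal in auto)
  obtain T where T: "T \<in> borel_measurable J" "integrable J (\<lambda>x. \<bar>T x\<bar> powr t)"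
    "(\<lambda>N. \<integral>x. \<bar>(\<Sum>n<N. (LINT x|J. \<psi> x * p n x) * p n x) - T x\<bar> powr t \<partial>J) \<longlonglongrightarrow> 0"
    "integrable J T" "\<And>m. (LINT x|J. T x * p m x) = (LINT x|J. \<psi> x * p m x)"
    by (rule bo.orthonormal_series_Lp[OF cb t]) (rule that)
  note [measurable] = T(1)
  have "AE x in J. T x - \<psi> x = 0"
  proof (rule AE_zero_if_coeff_zero)
    show "integrable J (\<lambda>x. T x - \<psi> x)" using T(4) \<psi>_int by simp
    show "(LINT x|J. (T x - \<psi> x) * p n x) = 0" for n
      using T(4,5) \<psi>_int by (simp add: left_diff_distrib bo.integrable_times_\<phi>)
  qed
  then have ae: "AE x in J. T x = \<psi> x" by (rule eventually_mono) simp
  have "integrable J (\<lambda>x. \<bar>\<psi> x\<bar> powr t)"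
    by (rule integrable_cong_AE_imp[OF T(2)]) (use ae in \<open>auto elim: eventually_mono\<close>)
  moreover have "(LINT x|J. \<bar>(\<Sum>n<N. (LINT x|J. \<psi> x * p n x) * p n x) - T x\<bar> powr t)
      = (LINT x|J. \<bar>(\<Sum>n<N. (LINT x|J. \<psi> x * p n x) * p n x) - \<psi> x\<bar> powr t)" for N
    by (rule integral_cong_AE) (use ae in \<open>auto elim: eventually_mono\<close>)
  ultimately show "integrable J (\<lambda>x. \<bar>\<psi> x\<bar> powr t) \<and>
      (\<lambda>N. \<integral>x. \<bar>(\<Sum>m<N. (LINT x|J. \<psi> x * p m x) * p m x) - \<psi> x\<bar> powr t \<partial>J) \<longlonglongrightarrow> 0"
    using T(3) by simp
qed

end

context jacobi
begin

text \<open>The hypothesis makes the series converge uniformly on the interval, so its coefficients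
  may be computed termwise; completeness then identifies its sum with f.\<close>

lemma AE_eq_jacobi_series:
  assumes f: "integrable J f" and s: "summable (\<lambda>n. \<bar>\<integral>x. f x * p n x \<partial>J\<bar> * growth (b - a) n)"
  shows "AE x in J. f x = (\<Sum>n. (LINT x|J. f x * p n x) * p n x)"
proof -
  define c where "c n = (LINT x|J. f x * p n x)" for n
  have i1: "integrable J (\<lambda>x. 1 :: real)" by simp
  have bnd: "\<bar>p n x\<bar> \<le> growth (b - a) n * 1" if "x \<in> space J" for n x
    using abs_p_le_growth that by simp
  note dom = dominated_series[where g = p and M = J and c = c, OF p_measurable i1 bnd _ _ s[folded c_def]]
  have "integrable J (\<lambda>x. (\<Sum>n. c n * p n x) * 1)" by (rule dom(2)[where B = 1]) auto
  then have Fi: "integrable J (\<lambda>x. \<Sum>n. c n * p n x)" by simp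
  have Fc: "(LINT x|J. (\<Sum>n. c n * p n x) * p m x) = c m" for m
  proof -
    obtain B where "\<And>x. x \<in> space J \<Longrightarrow> \<bar>p m x\<bar> \<le> B" by (rule p_bounded) (rule that)
    then have "(\<lambda>n. c n * (LINT x|J. p n x * p m x)) sums (LINT x|J. (\<Sum>n. c n * p n x) * p m x)"
      by (intro dom(3) p_measurable)
    moreover have "(\<lambda>n. c n * (LINT x|J. p n x * p m x)) sums c m"
      using sums_single[of m c] by (rule sums_cong[THEN iffD1, rotated]) (simp add: p_orthonormal)
    ultimately show ?thesis by (rule sums_unique2)
  qed
  have "AE x in J. f x - (\<Sum>n. c n * p n x) = 0"
  proof (rule AE_zero_if_coeff_zero)
    show "integrable J (\<lambda>x. f x - (\<Sum>n. c n * p n x))" using f Fi by simp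
    fix n
    obtain B where B: "\<And>x. x \<in> space J \<Longrightarrow> \<bar>p n x\<bar> \<le> B" by (rule p_bounded) (rule that)
    show "(LINT x|J. (f x - (\<Sum>n. c n * p n x)) * p n x) = 0"
      using integrable_mult_bounded[OF f p_measurable B] integrable_mult_bounded[OF Fi p_measurable B]
      by (simp add: left_diff_distrib Fc) (simp add: c_def)
  qed
  then show ?thesis unfolding c_def by (rule eventually_mono) simp
qed

end

section \<open>Existence, uniqueness and L_q convergence\<close>

theorem theorem3:
  fixes a b \<alpha> \<beta> \<gamma> r lam s :: real
    and f w :: "real \<Rightarrow> real"
    and p :: "nat \<Rightarrow> real \<Rightarrow> real"
    and fc c :: "nat \<Rightarrow> real"
    and A :: "nat \<Rightarrow> nat \<Rightarrow> real"
  assumes ab: "a < b"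
    and alpha: "-1 < \<alpha>" "\<alpha> \<le> 0"
    and beta: "-1/2 \<le> \<beta>" "\<beta> \<le> 1/2"
    and gamma: "-1/2 \<le> \<gamma>" "\<gamma> \<le> 1/2"
    and alpha_gamma: "2 * \<alpha> + \<gamma> + 1 > 0"
  defines "w \<equiv> jacobi_weight a b \<beta> \<gamma>"
    and "p \<equiv> jacobi_p a b \<beta> \<gamma>"
    and "fc \<equiv> jacobi_coeff a b \<beta> \<gamma> f"
    and "A \<equiv> abel_A a b \<alpha> \<beta> \<gamma>"
    and "c \<equiv> \<lambda>n. jacobi_delta' \<beta> \<gamma> n * fact n * Gamma (real n + \<beta> + 1)
                    * Gamma (real n + \<gamma> + 1) / 4 ^ n"
    and "lam \<equiv> 2 * \<alpha> + \<gamma> + 3/2"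
    and "s \<equiv> 3/2 + max \<beta> \<gamma>"
  assumes r: "pollard \<beta> \<gamma> r"
    and f: "f \<in> Lp_space a b w r"
    and summ: "summable (\<lambda>n. \<bar>fc n * c n\<bar>)"
  shows "\<exists>p0. pollard \<beta> \<gamma> p0 \<and>
    (\<exists>\<psi>. \<psi> \<in> Lp_space a b w p0 \<and> abel_solution a b \<alpha> f \<psi> \<and>
       (\<forall>\<phi>. \<phi> \<in> Lp_space a b w p0 \<and> abel_solution a b \<alpha> f \<phi> \<longrightarrow>
          (AE x\<in>{a<..<b} in lebesgue. \<phi> x = \<psi> x)) \<and>
       (\<forall>m. summable (\<lambda>n. fc n * A m n)) \<and>
       (\<forall>q. (1/2 < lam \<and> lam < s \<and> (\<exists>t < (2 * s - 1) / (s - lam). q = max p0 t)) \<or>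
            (lam \<ge> s \<and> 1 \<le> q) \<longrightarrow>
          \<psi> \<in> Lp_space a b w q \<and>
          Lp_converges a b w q
            (\<lambda>N x. \<Sum>m<N. p m x * (-1) ^ m * (\<Sum>n. fc n * A m n)) \<psi>))"
proof -
  interpret abel_jacobi a b \<beta> \<gamma> \<alpha>
    using ab alpha beta gamma alpha_gamma by unfold_locales
  let ?J = "jacobi_measure a b \<beta> \<gamma>"
  have r1: "r > 1" using pollard_gt_one[OF _ r] beta by simp
  have fm: "f \<in> borel_measurable ?J" and fr: "integrable ?J (\<lambda>x. \<bar>f x\<bar> powr r)"
    using f unfolding w_def Lp_space_iff by auto
  have "integrable ?J (\<lambda>x. \<bar>f x\<bar> powr 1)"
    by (rule integrable_powr_mono[OF fm fr]) (use r1 in auto)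
  then have fi: "integrable ?J f"
    by (intro integrable_norm_cancel[OF _ fm]) simp
  have fc_eq: "fc n = (LINT x|?J. f x * p n x)" for n
    unfolding fc_def p_def by (rule jacobi_coeff_eq[OF fm])
  have growth: "summable (\<lambda>n. \<bar>fc n\<bar> * growth R n)" if "R \<ge> 0" for R
    by (rule summable_growth[OF that]) (use summ in \<open>simp only: c_def\<close>)
  define \<psi> where "\<psi> x = (\<Sum>n. fc n * q n x)" for x
  define d where "d m = (LINT x|?J. \<psi> x * p m x)" for m
  have \<psi>_meas [measurable]: "\<psi> \<in> borel_measurable ?J" 
    unfolding \<psi>_def[abs_def] by (rule jacobi_series_Lp(1)[OF growth])
  have p_meas [measurable]: "p m \<in> borel_measurable ?J" for m unfolding p_def by (rule p_measurable)
  have sums: "(\<lambda>n. fc n * A m n) sums ((-1) ^ m * d m)" for m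
    unfolding A_def d_def \<psi>_def[abs_def] p_def by (rule jacobi_series_Lp(3)[OF growth])
  define F where "F N x = (\<Sum>m<N. p m x * (-1) ^ m * (\<Sum>n. fc n * A m n))" for N x
  \<comment> \<open>The sign inside \<open>A\<close> and the explicit (-1)^m cancel, so the stated
    series is the ordinary Jacobi series of \<psi>.\<close>
  have F_eq: "F N x = (\<Sum>m<N. d m * p m x)" for N x
  proof -
    have "p m x * (-1) ^ m * ((-1) ^ m * d m) = d m * p m x" for m
    proof -
      have "(-1 :: real) ^ m * (-1) ^ m = 1" by (simp add: power_mult_distrib[symmetric])
      moreover have "p m x * (-1) ^ m * ((-1) ^ m * d m) = ((-1) ^ m * (-1) ^ m) * (d m * p m x)"
        by (simp only: mult_ac)
      ultimately show ?thesis by simp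
    qed
    then show ?thesis unfolding F_def sums_unique[OF sums, symmetric] by (rule sum.cong[OF refl])
  qed
  have F_meas [measurable]: "F N \<in> borel_measurable ?J" for N
    unfolding F_eq[abs_def] by measurable
  obtain E where E: "E \<ge> 0" "\<And>n x. x \<in> {a<..<b} \<Longrightarrow> \<bar>jacobi_p a b \<beta> \<gamma> n x\<bar> \<le> E * (real n + 1) powr (max \<beta> \<gamma> + 1/2)"
    by (rule p_sup_bound) (rule that)
  interpret bo: bounded_orthonormal ?J "jacobi_p a b \<beta> \<gamma>" E "max \<beta> \<gamma> + 1/2"
    by unfold_locales (use E p_orthonormal in auto)
  have F_int: "integrable ?J (\<lambda>x. \<bar>F N x\<bar> powr t)" if "t \<ge> 0" for N t
    unfolding F_eq p_def by (rule bo.integrable_sum_\<phi>_powr[OF that])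
  have conv: "\<psi> \<in> Lp_space a b w t \<and> Lp_converges a b w t F \<psi>"
    if t: "t > 0" and i: "integrable ?J (\<lambda>x. \<bar>\<psi> x\<bar> powr t)"
      and l: "(\<lambda>N. \<integral>x. \<bar>F N x - \<psi> x\<bar> powr t \<partial>?J) \<longlonglongrightarrow> 0" for t
  proof -
    have mem: "\<psi> \<in> Lp_space a b w t" "F N \<in> Lp_space a b w t" for N
      unfolding w_def Lp_space_iff using i F_int t by auto
    have "(\<lambda>N. (LINT x|?J. \<bar>F N x - \<psi> x\<bar> powr t) powr (1 / t)) \<longlonglongrightarrow> 0 powr (1 / t)"
      by (rule tendsto_powr'[OF l tendsto_const]) (use t in auto)
    moreover have "Lp_norm a b w t (\<lambda>x. F N x - \<psi> x) = (LINT x|?J. \<bar>F N x - \<psi> x\<bar> powr t) powr (1 / t)" for N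
      unfolding w_def by (rule Lp_norm_eq) measurable
    ultimately show ?thesis unfolding Lp_converges_def using mem by simp
  qed
  have large: "integrable ?J (\<lambda>x. \<bar>\<psi> x\<bar> powr t) \<and> (\<lambda>N. \<integral>x. \<bar>F N x - \<psi> x\<bar> powr t \<partial>?J) \<longlonglongrightarrow> 0"
    if "t \<ge> 2" "t * (s - lam) < 2 * s - 1" for t
    unfolding F_eq d_def \<psi>_def[abs_def] p_def
    by (rule jacobi_series_Lp(4)[OF growth]) (use that in \<open>auto simp: s_def lam_def algebra_simps\<close>)
  \<comment> \<open>At t = 2 the condition reduces to \<lambda> > 1/2, which is
    \<open>alpha_gamma\<close>.\<close>
  have two: "integrable ?J (\<lambda>x. \<bar>\<psi> x\<bar> powr 2) \<and> (\<lambda>N. \<integral>x. \<bar>F N x - \<psi> x\<bar> powr 2 \<partial>?J) \<longlonglongrightarrow> 0"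
    by (rule large) (use alpha_gamma in \<open>auto simp: lam_def\<close>)
  have F\<psi>_int: "integrable ?J (\<lambda>x. \<bar>F N x - \<psi> x\<bar> powr 2)" for N
  proof (rule Bochner_Integration.integrable_bound)
    show "integrable ?J (\<lambda>x. 2 powr 2 * (\<bar>F N x\<bar> powr 2 + \<bar>- \<psi> x\<bar> powr 2))"
      using two F_int[of 2 N] by simp
    show "AE x in ?J. norm (\<bar>F N x - \<psi> x\<bar> powr 2) \<le> norm (2 powr 2 * (\<bar>F N x\<bar> powr 2 + \<bar>- \<psi> x\<bar> powr 2))"
    proof (rule AE_I2)
      fix x
      have "\<bar>F N x + - \<psi> x\<bar> powr 2 \<le> 2 powr 2 * (\<bar>F N x\<bar> powr 2 + \<bar>- \<psi> x\<bar> powr 2)"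
        by (rule abs_add_powr_le) simp
      then show "norm (\<bar>F N x - \<psi> x\<bar> powr 2) \<le> norm (2 powr 2 * (\<bar>F N x\<bar> powr 2 + \<bar>- \<psi> x\<bar> powr 2))"
        by simp
    qed
  qed measurable
  have Lq: "\<psi> \<in> Lp_space a b w t \<and> Lp_converges a b w t F \<psi>"
    if "(1/2 < lam \<and> lam < s \<and> (\<exists>u < (2 * s - 1) / (s - lam). t = max 2 u)) \<or> (lam \<ge> s \<and> 1 \<le> t)" for t
    using that
  proof
    assume "1/2 < lam \<and> lam < s \<and> (\<exists>u < (2 * s - 1) / (s - lam). t = max 2 u)"
    then obtain u where u: "lam < s" "1/2 < lam" "u < (2 * s - 1) / (s - lam)" "t = max 2 u" by blast
    \<comment> \<open>The exponent max 2 u is admissible because both 2 and u are.\<close>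
    have "u * (s - lam) < 2 * s - 1" using u by (simp add: field_simps)
    moreover have "2 * (s - lam) < 2 * s - 1" using u by simp
    ultimately have "t * (s - lam) < 2 * s - 1" using u(4) by (simp add: max_def)
    with large[of t] u(4) show ?thesis by (intro conv) auto
  next
    assume t: "s \<le> lam \<and> 1 \<le> t"
    show ?thesis
    \<comment> \<open>The block estimate is for t \<ge> 2; smaller exponents descend from t = 2 on
      the finite measure.\<close>
    proof (cases "t \<ge> 2")
      case True
      have "s \<ge> 1" using beta by (simp add: s_def max_def)
      \<comment> \<open>With s \<le> \<lambda> the left side is nonpositive for every exponent, so
        nothing limits t from above.\<close>
      moreover have "t * (s - lam) \<le> 0" using t True by (intro mult_nonneg_nonpos) auto
      ultimately have "t * (s - lam) < 2 * s - 1" by linarith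
      with large[OF True] True show ?thesis by (intro conv) auto
    next
      case False
      show ?thesis
      proof (rule conv)
        show "integrable ?J (\<lambda>x. \<bar>\<psi> x\<bar> powr t)"
          by (rule integrable_powr_mono[OF \<psi>_meas conjunct1[OF two]]) (use t False in auto)
        show "(\<lambda>N. \<integral>x. \<bar>F N x - \<psi> x\<bar> powr t \<partial>?J) \<longlonglongrightarrow> 0"
          by (rule tendsto_powr_mono[OF _ F\<psi>_int _ _ conjunct2[OF two]]) (use t False in auto)
      qed (use t in simp)
    qed
  qed
  have \<psi>_L2: "\<psi> \<in> Lp_space a b w 2" using conv[of 2] two by simp
  have sol: "abel_solution a b \<alpha> f \<psi>"
  proof -
    have "AE x in ?J. f x = (\<Sum>n. fc n * p n x)"
      using AE_eq_jacobi_series[OF fi] growth[of "b - a"] ab unfolding fc_eq p_def by simp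
    then have "AE x\<in>{a<..<b} in lebesgue. f x = (\<Sum>n. fc n * p n x)" by (simp only: AE_J_iff)
    then show ?thesis unfolding abel_solution_def
    proof eventually_elim
      case (elim x)
      show ?case
      proof
        assume x: "x \<in> {a<..<b}"
        have "frac_op b (- \<alpha>) \<psi> x = (\<Sum>n. fc n * p n x)"
          unfolding \<psi>_def[abs_def] p_def by (rule frac_op_series[OF growth x])
        then show "frac_op b (- \<alpha>) \<psi> x = f x" using elim x by simp
      qed
    qed
  qed
  have uniq: "AE x\<in>{a<..<b} in lebesgue. \<phi> x = \<psi> x"
    if \<phi>: "\<phi> \<in> Lp_space a b w 2" "abel_solution a b \<alpha> f \<phi>" for \<phi>
  proof -
    have "AE x in lebesgue. (x \<in> {a<..<b} \<longrightarrow> frac_op b (- \<alpha>) \<phi> x = f x) \<and> (x \<in> {a<..<b} \<longrightarrow> frac_op b (- \<alpha>) \<psi> x = f x)"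
      using \<phi>(2) sol unfolding abel_solution_def by (rule eventually_conj)
    then have eq: "AE x\<in>{a<..<b} in lebesgue. frac_integral b (- \<alpha>) \<phi> x = frac_integral b (- \<alpha>) \<psi> x"
      by (rule eventually_mono) (use alpha in \<open>simp add: frac_op_def\<close>)
    show ?thesis
    \<comment> \<open>Order 0 is the identity; \<open>frac_integral_inj\<close> is for positive
      order.\<close>
    proof (cases "\<alpha> = 0")
      case True
      then show ?thesis using eq by (simp add: frac_integral_def)
    next
      case False
      then show ?thesis
        using alpha \<phi>(1) \<psi>_L2 unfolding w_def
        by (intro frac_integral_inj[OF ab _ _ _ eq] set_integrable_if_L2) auto
    qed
  qed
  show ?thesis
  proof (intro exI[of _ 2] exI[of _ \<psi>] conjI allI impI)
    show "pollard \<beta> \<gamma> 2" using pollard_two beta gamma by simp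
    show "summable (\<lambda>n. fc n * A m n)" for m using sums by (rule sums_summable)
    show "\<psi> \<in> Lp_space a b w 2" "abel_solution a b \<alpha> f \<psi>" by (rule \<psi>_L2, rule sol)
    show "AE x\<in>{a<..<b} in lebesgue. \<phi> x = \<psi> x" if "\<phi> \<in> Lp_space a b w 2 \<and> abel_solution a b \<alpha> f \<phi>" for \<phi>
      using that uniq by blast
    fix t
    assume t: "1/2 < lam \<and> lam < s \<and> (\<exists>u < (2 * s - 1) / (s - lam). t = max 2 u) \<or> lam \<ge> s \<and> 1 \<le> t"
    show "\<psi> \<in> Lp_space a b w t" using Lq[OF t] by blast
    show "Lp_converges a b w t (\<lambda>N x. \<Sum>m<N. p m x * (-1) ^ m * (\<Sum>n. fc n * A m n)) \<psi>"
      using Lq[OF t] unfolding F_def[abs_def] by blast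
  qed
qed

end
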